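(* Let $N$ be a positive integer, let $2\le p<N$, and let $p^*=\frac{pN}{N-p}$. Let $\Omega\subseteq\mathbb{R}^N$ be an open connected set with smooth boundary ($\Omega$ may be unbounded). Let $M:[0,+\infty)\to[0,+\infty)$ be a continuous function and let $\widehat M(t)=\int_0^t M(s)\,\mathrm{d}s$ for $t\ge 0$. Assume that i) $\widehat M(t+s)\ge \widehat M(t)+\widehat M(s)$ for every $t,s\in[0,+\infty)$; ii) $\displaystyle\inf_{t>0}\frac{\widehat M(t)}{t^{p^*/p}}\ge c_p$, where $c_p=(2^{p-1}-1)^{\frac{p^*}{p}}\,\frac{p}{p^*}\,S_N^{-\frac{p^*}{p}}$. Then the functional $\mathcal E:W^{1,p}_0(\Omega)\to\mathbb{R}$ defined by $$\mathcal E(u)=\frac1p\widehat M(\|u\|^p)-\frac{1}{p^*}\|u\|_{p^*}^{p^*}$$ is sequentially weakly lower semicontinuous on $W^{1,p}_0(\Omega)$.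
   Context: The space $W^{1,p}_0(\Omega)$ is endowed with the norm $\|u\|=\left(\int_\Omega|\nabla u|^p\,\mathrm{d}x\right)^{1/p}$, and $\|u\|_q=\left(\int_\Omega|u|^q\,\mathrm{d}x\right)^{1/q}$ denotes the norm of $L^q(\Omega)$. $S_N>0$ denotes the (best) embedding constant of $W^{1,p}_0(\Omega)\hookrightarrow L^{p^*}(\Omega)$, i.e. the largest constant such that $\|u\|_{p^*}^p\le S_N^{-1}\|u\|^p$ for every $u\in W^{1,p}_0(\Omega)$. *)

theory Defs
  imports "HOL-Analysis.Analysis"
begin

section \<open>Smooth functions and domains with smooth boundary\<close>

fun C_k :: "nat \<Rightarrow> ('a::euclidean_space \<Rightarrow> real) \<Rightarrow> bool" where
  "C_k 0 f \<longleftrightarrow> continuous_on UNIV f"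
| "C_k (Suc k) f \<longleftrightarrow> (\<forall>x. f differentiable (at x)) \<and>
     (\<forall>i\<in>Basis. C_k k (\<lambda>x. frechet_derivative f (at x) i))"

definition smooth :: "('a::euclidean_space \<Rightarrow> real) \<Rightarrow> bool" where
  "smooth f \<longleftrightarrow> (\<forall>k. C_k k f)"

text \<open>
  Near each of its boundary points the set is the strict epigraph, in some direction \<open>e\<close>, of a
  smooth function of the remaining \<open>N - 1\<close> variables.  Such a function is represented by a
  function \<open>\<gamma>\<close> on the whole space which is constant along \<open>e\<close>.
\<close>

definition smooth_boundary :: "'a::euclidean_space set \<Rightarrow> bool" where
  "smooth_boundary \<Omega> \<longleftrightarrow>
     (\<forall>x0\<in>frontier \<Omega>. \<exists>r>0. \<exists>e \<gamma>. norm e = 1 \<and> smooth \<gamma> \<and>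
        (\<forall>x t. \<gamma> (x + t *\<^sub>R e) = \<gamma> x) \<and>
        \<Omega> \<inter> ball x0 r = {x \<in> ball x0 r. \<gamma> x < x \<bullet> e})"

definition test_functions :: "'a::euclidean_space set \<Rightarrow> ('a \<Rightarrow> real) set" where
  "test_functions \<Omega> =
     {\<phi>. smooth \<phi> \<and> compact (closure {x. \<phi> x \<noteq> 0}) \<and> closure {x. \<phi> x \<noteq> 0} \<subseteq> \<Omega>}"

section \<open>Lebesgue and Sobolev spaces\<close>

text \<open>
  Elements of the spaces below are functions on the whole Euclidean space of which only the values
  on \<open>\<Omega>\<close> matter.  Functions that agree almost everywhere on \<open>\<Omega>\<close> are not identified; hence the
  norms are only seminorms on the level of functions.
\<close>

definition Lp_space ::
    "'a::euclidean_space set \<Rightarrow> real \<Rightarrow> ('a \<Rightarrow> 'b::euclidean_space) set" where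
  "Lp_space \<Omega> q =
     {u \<in> borel_measurable (lebesgue_on \<Omega>). integrable (lebesgue_on \<Omega>) (\<lambda>x. norm (u x) powr q)}"

definition Lp_norm ::
    "'a::euclidean_space set \<Rightarrow> real \<Rightarrow> ('a \<Rightarrow> 'b::euclidean_space) \<Rightarrow> real" where
  "Lp_norm \<Omega> q u = (LINT x|lebesgue_on \<Omega>. norm (u x) powr q) powr (1 / q)"

definition locally_integrable ::
    "'a::euclidean_space set \<Rightarrow> ('a \<Rightarrow> 'b::euclidean_space) \<Rightarrow> bool" where
  "locally_integrable \<Omega> u \<longleftrightarrow> (\<forall>K. compact K \<and> K \<subseteq> \<Omega> \<longrightarrow> u absolutely_integrable_on K)"

definition is_weak_gradient ::
    "'a::euclidean_space set \<Rightarrow> ('a \<Rightarrow> real) \<Rightarrow> ('a \<Rightarrow> 'a) \<Rightarrow> bool" where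
  "is_weak_gradient \<Omega> u g \<longleftrightarrow> locally_integrable \<Omega> u \<and> locally_integrable \<Omega> g \<and>
     (\<forall>\<phi>\<in>test_functions \<Omega>. \<forall>i\<in>Basis.
        (LINT x|lebesgue_on \<Omega>. u x * frechet_derivative \<phi> (at x) i) =
        - (LINT x|lebesgue_on \<Omega>. (g x \<bullet> i) * \<phi> x))"

text \<open>A weak gradient on an open set is unique up to a null set, so the choice is harmless.\<close>

definition weak_gradient ::
    "'a::euclidean_space set \<Rightarrow> ('a \<Rightarrow> real) \<Rightarrow> 'a \<Rightarrow> 'a" where
  "weak_gradient \<Omega> u = (SOME g. is_weak_gradient \<Omega> u g)"

definition W1p :: "'a::euclidean_space set \<Rightarrow> real \<Rightarrow> ('a \<Rightarrow> real) set" where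
  "W1p \<Omega> p = {u \<in> Lp_space \<Omega> p. \<exists>g\<in>Lp_space \<Omega> p. is_weak_gradient \<Omega> u g}"

definition grad_norm :: "'a::euclidean_space set \<Rightarrow> real \<Rightarrow> ('a \<Rightarrow> real) \<Rightarrow> real" where
  "grad_norm \<Omega> p u = Lp_norm \<Omega> p (weak_gradient \<Omega> u)"

definition W1p_norm :: "'a::euclidean_space set \<Rightarrow> real \<Rightarrow> ('a \<Rightarrow> real) \<Rightarrow> real" where
  "W1p_norm \<Omega> p u = (Lp_norm \<Omega> p u powr p + grad_norm \<Omega> p u powr p) powr (1 / p)"

definition W01p :: "'a::euclidean_space set \<Rightarrow> real \<Rightarrow> ('a \<Rightarrow> real) set" where
  "W01p \<Omega> p = {u \<in> W1p \<Omega> p. \<exists>\<phi>. (\<forall>n::nat. \<phi> n \<in> test_functions \<Omega>) \<and>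
     (\<lambda>n. W1p_norm \<Omega> p (\<lambda>x. \<phi> n x - u x)) \<longlonglongrightarrow> 0}"

definition best_embedding_constant ::
    "'a::euclidean_space set \<Rightarrow> real \<Rightarrow> real \<Rightarrow> real" where
  "best_embedding_constant \<Omega> p q =
     (GREATEST S. S > 0 \<and> (\<forall>u\<in>W01p \<Omega> p. u \<in> Lp_space \<Omega> q \<and>
        Lp_norm \<Omega> q u powr p \<le> inverse S * grad_norm \<Omega> p u powr p))"

section \<open>Weak topology and the functional\<close>

text \<open>
  In the next three definitions \<open>V\<close> is a linear space of functions and \<open>nrm\<close> a seminorm on it.  The
  bound by \<open>nrm\<close> forces a functional to agree on functions at \<open>nrm\<close>-distance zero, so these are
  the bounded linear functionals on the associated normed space.
\<close>

definition bounded_functional ::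
    "('a \<Rightarrow> real) set \<Rightarrow> (('a \<Rightarrow> real) \<Rightarrow> real) \<Rightarrow> (('a \<Rightarrow> real) \<Rightarrow> real) \<Rightarrow> bool" where
  "bounded_functional V nrm T \<longleftrightarrow>
     (\<forall>u\<in>V. \<forall>v\<in>V. T (\<lambda>x. u x + v x) = T u + T v) \<and>
     (\<forall>u\<in>V. \<forall>c. T (\<lambda>x. c * u x) = c * T u) \<and>
     (\<exists>C. \<forall>u\<in>V. \<bar>T u\<bar> \<le> C * nrm u)"

definition weakly_converges ::
    "('a \<Rightarrow> real) set \<Rightarrow> (('a \<Rightarrow> real) \<Rightarrow> real) \<Rightarrow> (nat \<Rightarrow> 'a \<Rightarrow> real) \<Rightarrow> ('a \<Rightarrow> real) \<Rightarrow> bool"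
  where
  "weakly_converges V nrm u l \<longleftrightarrow>
     (\<forall>n. u n \<in> V) \<and> l \<in> V \<and> (\<forall>T. bounded_functional V nrm T \<longrightarrow> (\<lambda>n. T (u n)) \<longlonglongrightarrow> T l)"

definition seq_weakly_lsc ::
    "('a \<Rightarrow> real) set \<Rightarrow> (('a \<Rightarrow> real) \<Rightarrow> real) \<Rightarrow> (('a \<Rightarrow> real) \<Rightarrow> real) \<Rightarrow> bool" where
  "seq_weakly_lsc V nrm F \<longleftrightarrow>
     (\<forall>u l. weakly_converges V nrm u l \<longrightarrow> ereal (F l) \<le> liminf (\<lambda>n. ereal (F (u n))))"

definition primitive :: "(real \<Rightarrow> real) \<Rightarrow> real \<Rightarrow> real" where
  "primitive M t = integral {0..t} M"

definition kirchhoff_energy ::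
    "(real \<Rightarrow> real) \<Rightarrow> 'a::euclidean_space set \<Rightarrow> real \<Rightarrow> real \<Rightarrow> ('a \<Rightarrow> real) \<Rightarrow> real" where
  "kirchhoff_energy M \<Omega> p q u =
     1 / p * primitive M (grad_norm \<Omega> p u powr p) - 1 / q * Lp_norm \<Omega> q u powr q"

end

theory Submission
  imports Defs
begin

text \<open>
  Let \<open>w = u n - l\<close>, where \<open>u n\<close> converges weakly to \<open>l\<close>.  Lindqvist's inequality for \<open>p \<ge> 2\<close> gives
  \<open>\<parallel>u n\<parallel>^p \<ge> \<parallel>l\<parallel>^p + o(1) + c \<parallel>w\<parallel>^p\<close> with \<open>c = 1 / (2 powr (p - 1) - 1)\<close>, because its linear term is a
  bounded functional of \<open>w\<close>.  Since the primitive of \<open>M\<close> is monotone and superadditive, the first part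
  of the energy grows by at least \<open>primitive M (c \<parallel>w\<parallel>^p) / p\<close>, up to \<open>o(1)\<close>.  By the growth condition
  and the embedding inequality this is at least \<open>\<parallel>w\<parallel>_q^q / q\<close>, where \<open>q\<close> is the critical exponent.  By
  the Brezis--Lieb lemma that is exactly what the second part loses, up to \<open>o(1)\<close>.

  Both the Sobolev inequality and the local compactness needed for the Brezis--Lieb lemma come from the
  averages \<open>A_r f\<close> of \<open>f\<close> over balls of radius \<open>r\<close>: the \<open>L^p\<close> distance of \<open>f\<close> and \<open>A_r f\<close> is at most
  \<open>r \<parallel>\<nabla>f\<parallel>\<close>, and summing \<open>A_r f - A_{2r} f\<close> over dyadic radii gives
  \<open>\<bar>A_r f\<bar> \<le> C r powr (1 - N / p) \<parallel>\<nabla>f\<parallel>\<close>.  Optimising in \<open>r\<close> yields the weak-type Sobolev inequality,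
  and Maz'ya's truncation at dyadic levels turns it into the strong one.
\<close>

section \<open>Elementary inequalities\<close>

text \<open>At the critical exponent the embedding is not compact, so the L^q norm of
  \<open>w\<close> need not tend to 0 and the negative part of the energy may lose mass; the growth
  condition on the primitive of \<open>M\<close> has to pay for exactly that loss. This explains the
  constant in the growth condition: \<open>(2 powr (p - 1) - 1) powr (q / p)\<close> cancels
  \<open>c powr (q / p)\<close>, the ratio \<open>p / q\<close> exchanges the prefactors
  \<open>1 / p\<close> and \<open>1 / q\<close>, and the power of the embedding constant turns the
  gradient norm into the L^q norm. Weak convergence is tested only by functionals bounded by the
  gradient seminorm. The Sobolev inequality makes integration over a ball such a functional; hence
  the averages of a weakly null sequence tend to 0 pointwise, which is the source of local
  compactness.\<close>

lemma powr_tangent: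
  fixes x y p :: real
  assumes "1 \<le> p" "0 \<le> x" "0 \<le> y"
  shows "x powr p + p * x powr (p - 1) * (y - x) \<le> y powr p"
proof (cases "p = 1 \<or> x = 0 \<or> y = 0")
  case True
  have "x powr p = x powr (p - 1) * x" if "x > 0"
    using that by (simp add: powr_diff)
  then show ?thesis
  proof (cases "x = 0")
    case False
    show ?thesis
    proof (cases "p = 1")
      case True
      with assms False show ?thesis by simp
    next
      case p: False
      then have "y = 0" using True False by blast
      moreover have "x powr p \<le> p * x powr p" using assms by (simp add: mult_le_cancel_right1)
      ultimately show ?thesis
        using \<open>x > 0 \<Longrightarrow> x powr p = x powr (p - 1) * x\<close> False assms by (simp add: algebra_simps)
    qed
  qed (use assms in simp)
next
  case False
  then have p: "p > 1" and x: "x > 0" and y: "y > 0" using assms by auto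
  \<comment> \<open>Young's inequality for the product \<open>y * x powr (p - 1)\<close> with
    exponents \<open>p\<close> and \<open>p / (p - 1)\<close>; multiplied by \<open>p\<close> it is
    the tangent line inequality.\<close>
  have "(y powr p) powr (1/p) * (x powr p) powr ((p-1)/p) \<le> 1/p * y powr p + (p-1)/p * x powr p"
    using p x y by (intro Youngs_inequality_0) (auto simp: field_simps)
  then have "y * x powr (p-1) \<le> 1/p * y powr p + (p-1)/p * x powr p"
    using p x y by (simp add: powr_powr)
  then have "p * (y * x powr (p-1)) \<le> p * (1/p * y powr p + (p-1)/p * x powr p)"
    using p by (intro mult_left_mono) auto
  also have "\<dots> = y powr p + (p-1) * x powr p" using p by (simp add: field_simps)
  finally have "p * (y * x powr (p-1)) \<le> y powr p + (p-1) * x powr p" .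
  moreover have "x powr p = x powr (p - 1) * x" using x by (simp add: powr_diff)
  ultimately show ?thesis by (simp add: algebra_simps)
qed

text \<open>The tangent at the midpoint lies below the graph at \<open>x\<close> and at
  \<open>y\<close>; on averaging the two inequalities the linear terms cancel.\<close>

lemma powr_midpoint_le:
  fixes x y s :: real
  assumes "1 \<le> s" "0 \<le> x" "0 \<le> y"
  shows "((x + y) / 2) powr s \<le> (x powr s + y powr s) / 2"
  using powr_tangent[of s "(x+y)/2" x] powr_tangent[of s "(x+y)/2" y] assms
  by (simp add: field_simps)

lemma powr_superadditive:
  fixes x y s :: real
  assumes "1 \<le> s" "0 \<le> x" "0 \<le> y"
  shows "x powr s + y powr s \<le> (x + y) powr s"
proof (cases "x = 0 \<or> y = 0")
  case False
  then have x: "x > 0" and y: "y > 0" using assms by auto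
  have 1: "z powr s = z powr (s-1) * z" if "z > 0" for z :: real using that by (simp add: powr_diff)
  have "x powr (s-1) \<le> (x+y) powr (s-1)" "y powr (s-1) \<le> (x+y) powr (s-1)"
    using x y assms by (auto intro!: powr_mono2)
  then have "x powr (s-1) * x + y powr (s-1) * y \<le> (x+y) powr (s-1) * x + (x+y) powr (s-1) * y"
    using x y by (intro add_mono mult_right_mono) auto
  then show ?thesis using x y by (simp add: 1[of x] 1[of y] 1[of "x+y"] algebra_simps)
qed auto

lemma powr_lipschitz:
  fixes x y s :: real
  assumes "1 \<le> s" "0 \<le> x" "0 \<le> y" "x \<le> m" "y \<le> m"
  shows "\<bar>y powr s - x powr s\<bar> \<le> s * m powr (s - 1) * \<bar>y - x\<bar>"
proof -
  have *: "y powr s - x powr s \<le> s * m powr (s - 1) * \<bar>y - x\<bar>"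
    if "0 \<le> x" "0 \<le> y" "y \<le> m" for x y
  proof -
    have "y powr s - x powr s \<le> s * y powr (s-1) * (y - x)"
      using powr_tangent[of s y x] assms that by (simp add: algebra_simps)
    also have "\<dots> \<le> s * y powr (s-1) * \<bar>y - x\<bar>"
      using assms by (intro mult_left_mono) auto
    also have "\<dots> \<le> s * m powr (s-1) * \<bar>y - x\<bar>"
      using assms that by (intro mult_right_mono mult_left_mono powr_mono2) auto
    finally show ?thesis .
  qed
  have "x powr s - y powr s \<le> s * m powr (s - 1) * \<bar>y - x\<bar>"
    using *[of y x] assms by (simp add: abs_minus_commute)
  with *[of x y] assms show ?thesis by linarith
qed

section \<open>Convexity and uniform convexity of powers of a norm\<close>

lemma norm_add_powr_le:
  fixes a b :: "'b::real_normed_vector"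
  assumes "0 \<le> p"
  shows "norm (a + b) powr p \<le> 2 powr p * (norm a powr p + norm b powr p)"
proof -
  have "norm (a + b) powr p \<le> (2 * max (norm a) (norm b)) powr p"
    using assms norm_triangle_ineq[of a b] by (intro powr_mono2) auto
  also have "\<dots> = 2 powr p * max (norm a) (norm b) powr p"
    by (simp add: powr_mult)
  also have "\<dots> \<le> 2 powr p * (norm a powr p + norm b powr p)"
    by (intro mult_left_mono) (auto simp: max_def)
  finally show ?thesis .
qed

text \<open>Convexity of the p-th power of the norm, whose gradient at \<open>a\<close> is
  \<open>p * norm a powr (p - 2)\<close> times \<open>a\<close>; Cauchy--Schwarz reduces it to the
  scalar case. It starts the iteration in \<open>lindqvist\<close> with the constant 0.\<close>

lemma norm_powr_tangent:
  fixes a b :: "'b::real_inner"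
  assumes "1 < p"
  shows "norm a powr p + p * (norm a powr (p - 2) * (a \<bullet> (b - a))) \<le> norm b powr p"
proof (cases "a = 0")
  case False
  then have na: "norm a > 0" by simp
  have 1: "norm a powr p = norm a powr (p-2) * (a \<bullet> a)"
    using na by (simp add: dot_square_norm powr_diff powr_numeral power2_eq_square)
  have 2: "norm a powr (p-1) = norm a powr (p-2) * norm a"
    using na by (simp add: powr_diff powr_numeral power2_eq_square)
  have "norm a powr (p-2) * (a \<bullet> b) \<le> norm a powr (p-2) * (norm a * norm b)"
    by (intro mult_left_mono norm_cauchy_schwarz) auto
  also have "\<dots> = norm a powr (p-1) * norm b" by (simp add: 2)
  finally have 3: "norm a powr (p-2) * (a \<bullet> b) \<le> norm a powr (p-1) * norm b" .
  have "norm a powr (p-2) * (a \<bullet> (b-a)) \<le> norm a powr (p-1) * (norm b - norm a)"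
    using 3 1 2 by (simp add: inner_diff_right right_diff_distrib dot_square_norm power2_eq_square mult.assoc)
  then have "p * (norm a powr (p-2) * (a \<bullet> (b-a))) \<le> p * (norm a powr (p-1) * (norm b - norm a))"
    using assms by (intro mult_left_mono) auto
  with powr_tangent[of p "norm a" "norm b"] assms show ?thesis by (simp add: algebra_simps)
qed simp

text \<open>The parallelogram law evaluates the sum of the two squared norms on the left. The power
  \<open>p / 2\<close> is at least 1, so superadditivity applies before this law and midpoint
  convexity after it.\<close>

lemma clarkson_norm:
  fixes a b :: "'b::real_inner"
  assumes "2 \<le> p"
  shows "norm ((1/2) *\<^sub>R (a + b)) powr p + norm ((1/2) *\<^sub>R (a - b)) powr p
    \<le> (norm a powr p + norm b powr p) / 2"
proof -
  have sq: "norm x powr p = ((norm x)\<^sup>2) powr (p/2)" for x :: 'b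
    by (cases "x = 0") (auto simp: powr_powr simp flip: powr_numeral)
  let ?c = "(norm ((1/2) *\<^sub>R (a + b)))\<^sup>2" and ?d = "(norm ((1/2) *\<^sub>R (a - b)))\<^sup>2"
  have "?c powr (p/2) + ?d powr (p/2) \<le> (?c + ?d) powr (p/2)"
    using assms by (intro powr_superadditive) auto
  also have "?c + ?d = ((norm a)\<^sup>2 + (norm b)\<^sup>2) / 2"
    unfolding power2_norm_eq_inner by (simp add: algebra_simps inner_commute)
  also have "\<dots> powr (p/2) \<le> (((norm a)\<^sup>2) powr (p/2) + ((norm b)\<^sup>2) powr (p/2)) / 2"
    using assms by (intro powr_midpoint_le) auto
  finally show ?thesis by (simp only: sq)
qed

text \<open>
  If the inequality holds with the constant \<open>c\<close>, then inserting the midpoint of \<open>a\<close> and \<open>b\<close> and using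
  Clarkson's inequality gives it with the constant \<open>2 powr (1 - p) * (1 + c)\<close>; the constant
  \<open>1 / (2 powr (p - 1) - 1)\<close> is the fixed point of this contraction.
\<close>

lemma lindqvist:
  fixes a b :: "'b::real_inner"
  assumes "2 \<le> p"
  shows "norm a powr p + p * (norm a powr (p - 2) * (a \<bullet> (b - a)))
           + norm (b - a) powr p / (2 powr (p - 1) - 1) \<le> norm b powr p"
proof -
  \<comment> \<open>The gap in the convexity inequality at \<open>a\<close>; the goal is a lower
    bound for it by a multiple of \<open>norm (b - a) powr p\<close>.\<close>
  define g where "g a b = norm b powr p - norm a powr p - p * (norm a powr (p - 2) * (a \<bullet> (b - a)))"
    for a b :: 'b
  define \<theta> where "\<theta> = (2::real) powr (1 - p)"
  have \<theta>: "0 < \<theta>" "\<theta> < 1" using assms powr_less_cancel_iff[of 2 "1-p" 0] by (auto simp: \<theta>_def)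
  define c where "c n = ((\<lambda>c. \<theta> * (1 + c)) ^^ n) 0" for n
  \<comment> \<open>Twice Clarkson's inequality. The linear term at the midpoint is half the one at
    \<open>b\<close>, so passing from \<open>g a b\<close> to twice the gap at the midpoint leaves
    no linear remainder.\<close>
  have mid: "2 * g a ((1/2) *\<^sub>R (a + b)) + \<theta> * norm (b - a) powr p \<le> g a b" for a b
  proof -
    have h: "(1/2) *\<^sub>R (a + b) - a = (1/2) *\<^sub>R (b - a)"
    proof -
      have "(1/2) *\<^sub>R (a + b) - (1/2) *\<^sub>R (a + a) = (1/2) *\<^sub>R (b - a)"
        by (simp only: scaleR_diff_right[symmetric]) simp
      then show ?thesis by (simp only: scaleR_half_double)
    qed
    have "norm ((1/2) *\<^sub>R (a - b)) powr p = (1/2) powr p * norm (b - a) powr p"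
      by (simp add: powr_mult norm_minus_commute powr_divide)
    moreover have "(1/2::real) powr p = \<theta> / 2"
      by (simp add: \<theta>_def powr_diff powr_divide)
    ultimately show ?thesis
      using clarkson_norm[OF assms, of a b] unfolding g_def h by (simp add: algebra_simps)
  qed
  have ind: "c n * norm (b - a) powr p \<le> g a b" for n a b
  proof (induction n arbitrary: b)
    case 0
    then show ?case using norm_powr_tangent[of p a b] assms by (simp add: c_def g_def)
  next
    case (Suc n)
    let ?m = "(1/2) *\<^sub>R (a + b)"
    have h: "?m - a = (1/2) *\<^sub>R (b - a)"
    proof -
      have "(1/2) *\<^sub>R (a + b) - (1/2) *\<^sub>R (a + a) = (1/2) *\<^sub>R (b - a)"
        by (simp only: scaleR_diff_right[symmetric]) simp
      then show ?thesis by (simp only: scaleR_half_double)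
    qed
    have e: "norm (?m - a) powr p = \<theta> / 2 * norm (b - a) powr p"
      unfolding h by (simp add: powr_mult powr_divide \<theta>_def powr_diff)
    have "c (Suc n) * norm (b - a) powr p = 2 * (c n * norm (?m - a) powr p) + \<theta> * norm (b - a) powr p"
      unfolding e by (simp add: c_def algebra_simps)
    also have "\<dots> \<le> 2 * g a ?m + \<theta> * norm (b - a) powr p" using Suc[of ?m] by simp
    also have "\<dots> \<le> g a b" by (rule mid)
    finally show ?case .
  qed
  define L where "L = 1 / (2 powr (p - 1) - 1)"
  have L: "L = \<theta> * (1 + L)"
    using assms powr_less_cancel_iff[of 2 0 "p-1"] by (simp add: L_def \<theta>_def powr_diff field_simps)
  have "c n = L - \<theta> ^ n * L" for n
  proof (induction n)
    case (Suc n)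
    have "c (Suc n) = \<theta> * (1 + c n)" by (simp add: c_def)
    also have "\<dots> = \<theta> * (1 + L) - \<theta> ^ Suc n * L" by (simp add: Suc algebra_simps)
    finally show ?case using L by simp
  qed (simp add: c_def)
  moreover have "(\<lambda>n. \<theta> ^ n) \<longlonglongrightarrow> 0" by (rule LIMSEQ_power_zero) (use \<theta> in simp)
  then have "(\<lambda>n. L - \<theta> ^ n * L) \<longlonglongrightarrow> L - 0 * L" by (intro tendsto_diff tendsto_mult tendsto_const)
  ultimately have "c \<longlonglongrightarrow> L" by (metis (no_types, lifting) ext diff_zero mult_zero_left)
  then have "(\<lambda>n. c n * norm (b - a) powr p) \<longlonglongrightarrow> L * norm (b - a) powr p"
    by (intro tendsto_intros)
  then have "L * norm (b - a) powr p \<le> g a b"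
    using ind by (intro LIMSEQ_le_const2) auto
  then show ?thesis by (simp add: L_def g_def algebra_simps)
qed

section \<open>Pointwise inequalities for the Brezis--Lieb remainder\<close>

lemma young_eps:
  fixes \<epsilon> \<alpha> \<beta> :: real
  assumes "\<epsilon> > 0" "\<alpha> > 0" "\<beta> > 0"
  obtains C where "C \<ge> 0"
    "\<And>s t. s \<ge> 0 \<Longrightarrow> t \<ge> 0 \<Longrightarrow> s powr \<alpha> * t powr \<beta> \<le> \<epsilon> * s powr (\<alpha> + \<beta>) + C * t powr (\<alpha> + \<beta>)"
proof
  \<comment> \<open>With \<open>\<delta> powr \<beta> = \<epsilon>\<close> the two regions separated
    by \<open>t = \<delta> * s\<close> produce the two terms: \<open>t\<close> is replaced by
    \<open>\<delta> * s\<close> in one and \<open>s\<close> by \<open>t / \<delta>\<close> in the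
    other.\<close>
  define \<delta> where "\<delta> = \<epsilon> powr (1 / \<beta>)"
  have d: "\<delta> > 0" using assms by (simp add: \<delta>_def)
  have db: "\<delta> powr \<beta> = \<epsilon>" using assms by (simp add: \<delta>_def powr_powr)
  show "\<delta> powr (- \<alpha>) \<ge> 0" by simp
  fix s t :: real assume st: "s \<ge> 0" "t \<ge> 0"
  show "s powr \<alpha> * t powr \<beta> \<le> \<epsilon> * s powr (\<alpha> + \<beta>) + \<delta> powr (- \<alpha>) * t powr (\<alpha> + \<beta>)"
  proof (cases "t \<le> \<delta> * s")
    case True
    have "s powr \<alpha> * t powr \<beta> \<le> s powr \<alpha> * (\<delta> * s) powr \<beta>"
      using True st assms d by (intro mult_left_mono powr_mono2) auto
    also have "\<dots> = \<epsilon> * s powr (\<alpha> + \<beta>)" using d st db by (simp add: powr_mult powr_add)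
    finally show ?thesis by (simp add: add_increasing2)
  next
    case False
    then have "s \<le> t / \<delta>" using d by (simp add: field_simps)
    then have "s powr \<alpha> * t powr \<beta> \<le> (t / \<delta>) powr \<alpha> * t powr \<beta>"
      using st assms d by (intro mult_right_mono powr_mono2) auto
    also have "\<dots> = \<delta> powr (- \<alpha>) * t powr (\<alpha> + \<beta>)"
      using d st by (simp add: powr_divide powr_add powr_minus field_simps)
    finally show ?thesis using assms by (simp add: add_increasing)
  qed
qed

text \<open>By symmetry let \<open>b\<close> be the smaller one in absolute value. Then all
  arguments of the power are at most twice \<open>\<bar>a\<bar>\<close>, and its Lipschitz bound
  there gives the first summand of the constant; the summand 1 accounts for
  \<open>\<bar>b\<bar> powr q\<close>.\<close>

lemma brezis_lieb_aux:
  fixes a b q :: real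
  assumes "1 \<le> q"
  shows "\<bar>\<bar>a + b\<bar> powr q - \<bar>a\<bar> powr q - \<bar>b\<bar> powr q\<bar>
    \<le> (q * 2 powr (q - 1) + 1) * (\<bar>a\<bar> powr (q - 1) * \<bar>b\<bar> + \<bar>a\<bar> * \<bar>b\<bar> powr (q - 1))"
proof -
  have *: "\<bar>\<bar>a + b\<bar> powr q - \<bar>a\<bar> powr q - \<bar>b\<bar> powr q\<bar>
      \<le> (q * 2 powr (q - 1) + 1) * (\<bar>a\<bar> powr (q - 1) * \<bar>b\<bar>)" if "\<bar>b\<bar> \<le> \<bar>a\<bar>" for a b :: real
  proof (cases "a = 0 \<or> b = 0")
    case False
    have "\<bar>\<bar>a + b\<bar> powr q - \<bar>a\<bar> powr q\<bar> \<le> q * (2 * \<bar>a\<bar>) powr (q - 1) * \<bar>\<bar>a + b\<bar> - \<bar>a\<bar>\<bar>"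
      using assms that by (intro powr_lipschitz) auto
    also have "\<dots> \<le> q * (2 * \<bar>a\<bar>) powr (q - 1) * \<bar>b\<bar>"
      using assms by (intro mult_left_mono) auto
    also have "\<dots> = q * 2 powr (q - 1) * (\<bar>a\<bar> powr (q-1) * \<bar>b\<bar>)" by (simp add: powr_mult)
    finally have 1: "\<bar>\<bar>a + b\<bar> powr q - \<bar>a\<bar> powr q\<bar> \<le> q * 2 powr (q - 1) * (\<bar>a\<bar> powr (q-1) * \<bar>b\<bar>)" .
    have "\<bar>b\<bar> powr q = \<bar>b\<bar> powr (q-1) * \<bar>b\<bar>" using False by (simp add: powr_diff)
    also have "\<dots> \<le> \<bar>a\<bar> powr (q-1) * \<bar>b\<bar>"
      using assms that by (intro mult_right_mono powr_mono2) auto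
    finally have 2: "\<bar>b\<bar> powr q \<le> \<bar>a\<bar> powr (q-1) * \<bar>b\<bar>" .
    have "\<bar>\<bar>a + b\<bar> powr q - \<bar>a\<bar> powr q - \<bar>b\<bar> powr q\<bar> \<le> \<bar>\<bar>a + b\<bar> powr q - \<bar>a\<bar> powr q\<bar> + \<bar>b\<bar> powr q"
      using abs_triangle_ineq4[of "\<bar>a + b\<bar> powr q - \<bar>a\<bar> powr q" "\<bar>b\<bar> powr q"] by simp
    also have "\<dots> \<le> (q * 2 powr (q - 1)) * (\<bar>a\<bar> powr (q-1) * \<bar>b\<bar>) + \<bar>a\<bar> powr (q-1) * \<bar>b\<bar>"
      by (rule add_mono[OF 1 2])
    also have "\<dots> = (q * 2 powr (q - 1) + 1) * (\<bar>a\<bar> powr (q - 1) * \<bar>b\<bar>)"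
      by (simp only: distrib_right mult_1)
    finally show ?thesis .
  next
    case True
    then have "b = 0" using that by auto
    then show ?thesis by simp
  qed
  show ?thesis
  proof (cases "\<bar>b\<bar> \<le> \<bar>a\<bar>")
    case True
    have "(q * 2 powr (q - 1) + 1) * (\<bar>a\<bar> powr (q - 1) * \<bar>b\<bar>)
      \<le> (q * 2 powr (q - 1) + 1) * (\<bar>a\<bar> powr (q - 1) * \<bar>b\<bar> + \<bar>a\<bar> * \<bar>b\<bar> powr (q - 1))"
      using assms by (intro mult_left_mono) auto
    with *[OF True] show ?thesis by (rule order_trans)
  next
    case False
    have "(q * 2 powr (q - 1) + 1) * (\<bar>b\<bar> powr (q - 1) * \<bar>a\<bar>)
      \<le> (q * 2 powr (q - 1) + 1) * (\<bar>a\<bar> powr (q - 1) * \<bar>b\<bar> + \<bar>a\<bar> * \<bar>b\<bar> powr (q - 1))"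
      using assms by (intro mult_left_mono) (auto simp: algebra_simps)
    moreover have "\<bar>\<bar>b + a\<bar> powr q - \<bar>b\<bar> powr q - \<bar>a\<bar> powr q\<bar>
      \<le> (q * 2 powr (q - 1) + 1) * (\<bar>b\<bar> powr (q - 1) * \<bar>a\<bar>)"
      using False by (intro *) simp
    ultimately show ?thesis
      by (simp only: add.commute[of a b] diff_diff_eq add.commute[of "\<bar>a\<bar> powr q"])
  qed
qed

text \<open>In \<open>brezis_lieb\<close>, \<open>a\<close> is the weakly null part and
  \<open>b\<close> the limit. This form serves where the mass of the limit is small, so that the
  size of \<open>C\<close> is harmless.\<close>

lemma brezis_lieb_eps:
  fixes \<epsilon> q :: real
  assumes "1 < q" "\<epsilon> > 0"
  obtains C where "C \<ge> 0" "\<And>a b. \<bar>\<bar>a + b\<bar> powr q - \<bar>a\<bar> powr q - \<bar>b\<bar> powr q\<bar>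
    \<le> \<epsilon> * \<bar>a\<bar> powr q + C * \<bar>b\<bar> powr q"
proof -
  define D where "D = q * 2 powr (q - 1) + 1"
  have D: "D > 0" using assms by (simp add: D_def add_nonneg_pos)
  have e: "\<epsilon> / (2 * D) > 0" using assms D by simp
  obtain C1 where C1: "C1 \<ge> 0" "\<And>s t. s \<ge> 0 \<Longrightarrow> t \<ge> 0 \<Longrightarrow> s powr (q - 1) * t powr 1 \<le> \<epsilon> / (2 * D) * s powr (q - 1 + 1) + C1 * t powr (q - 1 + 1)"
    using young_eps[OF e, of "q - 1" 1] assms by auto
  obtain C2 where C2: "C2 \<ge> 0" "\<And>s t. s \<ge> 0 \<Longrightarrow> t \<ge> 0 \<Longrightarrow> s powr 1 * t powr (q - 1) \<le> \<epsilon> / (2 * D) * s powr (1 + (q - 1)) + C2 * t powr (1 + (q - 1))"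
    using young_eps[OF e, of 1 "q - 1"] assms by auto
  show ?thesis
  proof
    show "D * (C1 + C2) \<ge> 0" using D C1 C2 by simp
    fix a b :: real
    have "\<bar>a\<bar> powr (q - 1) * \<bar>b\<bar> + \<bar>a\<bar> * \<bar>b\<bar> powr (q - 1)
      \<le> (\<epsilon> / (2 * D) * \<bar>a\<bar> powr q + C1 * \<bar>b\<bar> powr q) + (\<epsilon> / (2 * D) * \<bar>a\<bar> powr q + C2 * \<bar>b\<bar> powr q)"
      using C1(2)[of "\<bar>a\<bar>" "\<bar>b\<bar>"] C2(2)[of "\<bar>a\<bar>" "\<bar>b\<bar>"] by (intro add_mono) auto
    then have "D * (\<bar>a\<bar> powr (q - 1) * \<bar>b\<bar> + \<bar>a\<bar> * \<bar>b\<bar> powr (q - 1))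
      \<le> D * ((\<epsilon> / (2 * D) * \<bar>a\<bar> powr q + C1 * \<bar>b\<bar> powr q) + (\<epsilon> / (2 * D) * \<bar>a\<bar> powr q + C2 * \<bar>b\<bar> powr q))"
      using D by (intro mult_left_mono) auto
    also have "\<dots> = \<epsilon> * \<bar>a\<bar> powr q + D * (C1 + C2) * \<bar>b\<bar> powr q"
      using D by (simp add: field_simps)
    finally have X: "D * (\<bar>a\<bar> powr (q - 1) * \<bar>b\<bar> + \<bar>a\<bar> * \<bar>b\<bar> powr (q - 1)) \<le> \<epsilon> * \<bar>a\<bar> powr q + D * (C1 + C2) * \<bar>b\<bar> powr q" .
    have "1 \<le> q" using assms by simp
    then show "\<bar>\<bar>a + b\<bar> powr q - \<bar>a\<bar> powr q - \<bar>b\<bar> powr q\<bar> \<le> \<epsilon> * \<bar>a\<bar> powr q + D * (C1 + C2) * \<bar>b\<bar> powr q"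
      by (rule order_trans[OF brezis_lieb_aux[of q a b, folded D_def] X])
  qed
qed

text \<open>The companion form, for the region where the limit is bounded by \<open>m\<close>: the
  large constant now multiplies \<open>\<bar>a\<bar>\<close> itself, so local convergence in L^1
  controls it.\<close>

lemma brezis_lieb_bounded:
  fixes \<epsilon> q m :: real
  assumes "2 \<le> q" "\<epsilon> > 0" "m \<ge> 0"
  obtains C where "C \<ge> 0" "\<And>a b. \<bar>b\<bar> \<le> m \<Longrightarrow> \<bar>\<bar>a + b\<bar> powr q - \<bar>a\<bar> powr q - \<bar>b\<bar> powr q\<bar>
    \<le> \<epsilon> * \<bar>a\<bar> powr q + C * \<bar>a\<bar>"
proof -
  define D where "D = q * 2 powr (q - 1) + 1"
  have D: "D > 0" using assms by (simp add: D_def add_nonneg_pos)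
  define \<delta> where "\<delta> = \<epsilon> / (D * (m + 1))"
  have \<delta>: "\<delta> > 0" using assms D by (simp add: \<delta>_def)
  \<comment> \<open>The exponent \<open>q - 1\<close> lies between 1 and \<open>q\<close>, since
    \<open>2 \<le> q\<close>. Large \<open>s\<close> are absorbed by
    \<open>\<delta> * s powr q\<close>, and below \<open>1 / \<delta>\<close> the power grows at
    most linearly.\<close>
  have low: "s powr (q - 1) \<le> \<delta> * s powr q + (1 / \<delta>) powr (q - 2) * s" if "s \<ge> 0" for s
  proof (cases "s = 0 \<or> 1 / \<delta> \<le> s")
    case True
    show ?thesis
    proof (cases "s = 0")
      case False
      then have s: "s > 0" "1 \<le> \<delta> * s" using True that \<delta> by (auto simp: field_simps)
      have "s powr (q - 1) * 1 \<le> s powr (q - 1) * (\<delta> * s)" using s by (intro mult_left_mono) auto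
      also have "\<dots> = \<delta> * s powr q" using s by (simp add: powr_diff)
      finally show ?thesis using s by (simp add: add_increasing2)
    qed simp
  next
    case False
    have "s powr (q - 1) = s powr (q - 2) * s" using False that by (simp add: powr_diff powr_numeral power2_eq_square)
    also have "\<dots> \<le> (1 / \<delta>) powr (q - 2) * s"
      using False that assms by (intro mult_right_mono powr_mono2) auto
    finally show ?thesis using \<delta> by (simp add: add_increasing)
  qed
  define C where "C = D * (m * (1 / \<delta>) powr (q - 2) + m powr (q - 1))"
  show ?thesis
  proof
    show "C \<ge> 0" using D assms by (simp add: C_def)
    fix a b :: real assume b: "\<bar>b\<bar> \<le> m"
    have "\<bar>a\<bar> powr (q - 1) * \<bar>b\<bar> + \<bar>a\<bar> * \<bar>b\<bar> powr (q - 1) \<le> (\<delta> * \<bar>a\<bar> powr q + (1 / \<delta>) powr (q - 2) * \<bar>a\<bar>) * m + \<bar>a\<bar> * m powr (q - 1)"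
      using b low[of "\<bar>a\<bar>"] assms \<delta> by (intro add_mono mult_mono powr_mono2) auto
    then have "D * (\<bar>a\<bar> powr (q - 1) * \<bar>b\<bar> + \<bar>a\<bar> * \<bar>b\<bar> powr (q - 1))
      \<le> D * ((\<delta> * \<bar>a\<bar> powr q + (1 / \<delta>) powr (q - 2) * \<bar>a\<bar>) * m + \<bar>a\<bar> * m powr (q - 1))"
      using D by (intro mult_left_mono) auto
    also have "\<dots> = (D * m * \<delta>) * \<bar>a\<bar> powr q + C * \<bar>a\<bar>" by (simp add: C_def algebra_simps)
    also have "\<dots> \<le> \<epsilon> * \<bar>a\<bar> powr q + C * \<bar>a\<bar>"
    proof -
      have "m + 1 > 0" using assms by simp
      then have "D * m * \<delta> = \<epsilon> * (m / (m + 1))" using D assms by (simp add: \<delta>_def)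
      also have "\<dots> \<le> \<epsilon> * 1" using assms by (intro mult_left_mono) auto
      finally show ?thesis by (intro add_right_mono mult_right_mono) auto
    qed
    finally have X: "D * (\<bar>a\<bar> powr (q - 1) * \<bar>b\<bar> + \<bar>a\<bar> * \<bar>b\<bar> powr (q - 1)) \<le> \<epsilon> * \<bar>a\<bar> powr q + C * \<bar>a\<bar>" .
    have "1 \<le> q" using assms by simp
    then show "\<bar>\<bar>a + b\<bar> powr q - \<bar>a\<bar> powr q - \<bar>b\<bar> powr q\<bar> \<le> \<epsilon> * \<bar>a\<bar> powr q + C * \<bar>a\<bar>"
      by (rule order_trans[OF brezis_lieb_aux[of q a b, folded D_def] X])
  qed
qed

section \<open>Hoelder's inequality\<close>

lemma holder_inequality:
  fixes f g :: "'b \<Rightarrow> real"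
  assumes pq: "1 < p" "1 < q" "1/p + 1/q = 1"
    and [measurable]: "f \<in> borel_measurable M" "g \<in> borel_measurable M"
    and f: "integrable M (\<lambda>x. \<bar>f x\<bar> powr p)" and g: "integrable M (\<lambda>x. \<bar>g x\<bar> powr q)"
  shows "integrable M (\<lambda>x. f x * g x)"
    and "(LINT x|M. \<bar>f x * g x\<bar>) \<le> (LINT x|M. \<bar>f x\<bar> powr p) powr (1/p) * (LINT x|M. \<bar>g x\<bar> powr q) powr (1/q)"
proof -
  show int: "integrable M (\<lambda>x. f x * g x)"
  proof (rule Bochner_Integration.integrable_bound)
    show "integrable M (\<lambda>x. \<bar>f x\<bar> powr p / p + \<bar>g x\<bar> powr q / q)"
      using f g by (intro Bochner_Integration.integrable_add integrable_divide)
    show "AE x in M. norm (f x * g x) \<le> norm (\<bar>f x\<bar> powr p / p + \<bar>g x\<bar> powr q / q)"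
    proof (intro AE_I2)
      fix x
      have "\<bar>f x\<bar> * \<bar>g x\<bar> \<le> \<bar>f x\<bar> powr p / p + \<bar>g x\<bar> powr q / q"
        using pq by (intro Youngs_inequality) auto
      then show "norm (f x * g x) \<le> norm (\<bar>f x\<bar> powr p / p + \<bar>g x\<bar> powr q / q)" by (simp add: abs_mult)
    qed
  qed simp
  define F where "F = (LINT x|M. \<bar>f x\<bar> powr p)"
  define G where "G = (LINT x|M. \<bar>g x\<bar> powr q)"
  have FG: "F \<ge> 0" "G \<ge> 0" by (auto simp: F_def G_def)
  \<comment> \<open>The usual proof divides by the norms, which may vanish. Enlarging both by
    \<open>e > 0\<close> makes the division legitimate, and \<open>e\<close> tends to 0 at the
    end.\<close>
  have eps: "(LINT x|M. \<bar>f x * g x\<bar>) \<le> (F powr (1/p) + e) * (G powr (1/q) + e)" if e: "e > 0" for e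
  proof -
    define A where "A = F powr (1/p) + e"
    define B where "B = G powr (1/q) + e"
    have A: "A > 0" and B: "B > 0" using e by (auto simp: A_def B_def add_nonneg_pos)
    have FA: "F \<le> A powr p"
    proof -
      have "F = (F powr (1/p)) powr p" using FG pq by (simp add: powr_powr)
      also have "\<dots> \<le> A powr p" using e pq by (intro powr_mono2) (auto simp: A_def)
      finally show ?thesis .
    qed
    have GB: "G \<le> B powr q"
    proof -
      have "G = (G powr (1/q)) powr q" using FG pq by (simp add: powr_powr)
      also have "\<dots> \<le> B powr q" using e pq by (intro powr_mono2) (auto simp: B_def)
      finally show ?thesis .
    qed
    have "(LINT x|M. \<bar>f x * g x\<bar>) \<le> (LINT x|M. A * B * (\<bar>f x\<bar> powr p / (A powr p * p) + \<bar>g x\<bar> powr q / (B powr q * q)))"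
    proof (intro integral_mono integrable_abs int integrable_mult_right Bochner_Integration.integrable_add integrable_divide f g)
      fix x
      have "\<bar>f x\<bar> / A * (\<bar>g x\<bar> / B) \<le> (\<bar>f x\<bar> / A) powr p / p + (\<bar>g x\<bar> / B) powr q / q"
        using pq A B by (intro Youngs_inequality) auto
      then show "\<bar>f x * g x\<bar> \<le> A * B * (\<bar>f x\<bar> powr p / (A powr p * p) + \<bar>g x\<bar> powr q / (B powr q * q))"
      proof -
        have "\<bar>f x * g x\<bar> = A * B * (\<bar>f x\<bar> / A * (\<bar>g x\<bar> / B))" using A B by (simp add: abs_mult)
        also have "\<dots> \<le> A * B * ((\<bar>f x\<bar> / A) powr p / p + (\<bar>g x\<bar> / B) powr q / q)"
          using A B calculation by (intro mult_left_mono \<open>\<bar>f x\<bar> / A * (\<bar>g x\<bar> / B) \<le> _\<close>) auto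
        finally show ?thesis using A B by (simp add: powr_divide)
      qed
    qed
    also have "\<dots> = A * B * (F / (A powr p * p) + G / (B powr q * q))"
      using f g by (simp add: F_def G_def)
    also have "\<dots> \<le> A * B * (1/p + 1/q)"
    proof -
      have "F / A powr p \<le> 1" "G / B powr q \<le> 1" using FA GB A B by (auto simp: field_simps)
      then have "F / A powr p / p \<le> 1 / p" "G / B powr q / q \<le> 1 / q"
        using pq by (auto simp del: divide_divide_eq_left intro!: divide_right_mono)
      then show ?thesis using A B by (intro mult_left_mono add_mono) auto
    qed
    finally show ?thesis using pq by (simp add: A_def B_def)
  qed
  have "((\<lambda>e. (F powr (1/p) + e) * (G powr (1/q) + e)) \<longlongrightarrow> (F powr (1/p) + 0) * (G powr (1/q) + 0)) (at_right 0)"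
    by (intro tendsto_intros)
  moreover have "eventually (\<lambda>e. (LINT x|M. \<bar>f x * g x\<bar>) \<le> (F powr (1/p) + e) * (G powr (1/q) + e)) (at_right 0)"
    using eps by (auto simp: eventually_at_right_less eventually_at_filter)
  ultimately show "(LINT x|M. \<bar>f x * g x\<bar>) \<le> F powr (1/p) * G powr (1/q)"
    using tendsto_lowerbound[of _ "F powr (1/p) * G powr (1/q)" "at_right (0::real)"] by simp
qed

section \<open>Averages of compactly supported functions\<close>

text \<open>Hoelder's inequality against the indicator of \<open>A\<close>, that is, Jensen's
  inequality for a measure of total mass other than 1.\<close>

lemma set_integral_powr_le:
  fixes h :: "'b \<Rightarrow> real"
  assumes p: "1 < p" and A [measurable]: "A \<in> sets M" and fin: "emeasure M A < \<infinity>"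
    and h [measurable]: "h \<in> borel_measurable M" and int: "set_integrable M A (\<lambda>x. \<bar>h x\<bar> powr p)"
  shows "set_integrable M A h"
    and "\<bar>LINT x:A|M. h x\<bar> powr p \<le> measure M A powr (p - 1) * (LINT x:A|M. \<bar>h x\<bar> powr p)"
proof -
  define q where "q = p / (p - 1)"
  have q: "1 < q" "1/p + 1/q = 1" using p by (auto simp: q_def field_simps)
  let ?f = "\<lambda>x. indicator A x * h x" and ?g = "indicator A :: 'b \<Rightarrow> real"
  have 1: "\<bar>?f x\<bar> powr p = indicator A x *\<^sub>R \<bar>h x\<bar> powr p" for x by (auto simp: indicator_def)
  have 2: "\<bar>?g x\<bar> powr q = indicator A x" for x by (auto simp: indicator_def)
  have i1: "integrable M (\<lambda>x. \<bar>?f x\<bar> powr p)" using int unfolding 1 set_integrable_def .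
  have i2: "integrable M (\<lambda>x. \<bar>?g x\<bar> powr q)" unfolding 2 using A fin by (simp add: less_top)
  have 3: "?f x * ?g x = indicator A x *\<^sub>R h x" for x by (auto simp: indicator_def)
  have "integrable M (\<lambda>x. ?f x * ?g x)"
    by (rule holder_inequality(1)[OF p q _ _ i1 i2]) auto
  then show int': "set_integrable M A h" unfolding set_integrable_def 3 .
  define I where "I = (LINT x:A|M. \<bar>h x\<bar> powr p)"
  have I: "I \<ge> 0" unfolding I_def set_lebesgue_integral_def by (intro integral_nonneg_AE) auto
  have "\<bar>LINT x:A|M. h x\<bar> \<le> (LINT x|M. \<bar>?f x * ?g x\<bar>)"
    unfolding set_lebesgue_integral_def 3 by (rule integral_abs_bound)
  also have "\<dots> \<le> (LINT x|M. \<bar>?f x\<bar> powr p) powr (1/p) * (LINT x|M. \<bar>?g x\<bar> powr q) powr (1/q)"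
    by (rule holder_inequality(2)[OF p q _ _ i1 i2]) auto
  also have "\<dots> = I powr (1/p) * measure M A powr (1/q)"
    unfolding 1 2 I_def set_lebesgue_integral_def using A by simp
  finally have "\<bar>LINT x:A|M. h x\<bar> powr p \<le> (I powr (1/p) * measure M A powr (1/q)) powr p"
    using p by (intro powr_mono2) auto
  also have "\<dots> = measure M A powr (p - 1) * I"
    using p I by (simp add: powr_mult powr_powr q_def)
  finally show "\<bar>LINT x:A|M. h x\<bar> powr p \<le> measure M A powr (p - 1) * (LINT x:A|M. \<bar>h x\<bar> powr p)"
    by (simp add: I_def)
qed

text \<open>The right-hand side is an extended nonnegative integral so that later steps can exchange
  integrals by Tonelli's theorem without integrability conditions.\<close>

lemma compact_integral_powr_le:
  fixes h :: "'a::euclidean_space \<Rightarrow> real"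
  assumes p: "1 < p" and A: "compact A" and h: "continuous_on UNIV h"
  shows "ennreal (\<bar>LINT x:A|lborel. h x\<bar> powr p)
    \<le> ennreal (measure lborel A powr (p - 1)) * (\<integral>\<^sup>+x\<in>A. ennreal (\<bar>h x\<bar> powr p) \<partial>lborel)"
proof -
  have c: "continuous_on A (\<lambda>x. \<bar>h x\<bar> powr p)"
    using p by (intro continuous_on_powr' continuous_intros continuous_on_subset[OF h]) auto
  have int: "set_integrable lborel A (\<lambda>x. \<bar>h x\<bar> powr p)"
    unfolding set_integrable_def using A c by (rule borel_integrable_compact)
  have "\<bar>LINT x:A|lborel. h x\<bar> powr p \<le> measure lborel A powr (p - 1) * (LINT x:A|lborel. \<bar>h x\<bar> powr p)"
  proof (rule set_integral_powr_le(2)[OF p _ _ _ int])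
    show "A \<in> sets lborel" using A by (simp add: borel_closed compact_imp_closed)
    show "emeasure lborel A < \<infinity>" by (rule emeasure_bounded_finite[OF compact_imp_bounded[OF A]])
    show "h \<in> borel_measurable lborel" using h by (simp add: borel_measurable_continuous_onI)
  qed
  moreover have "ennreal (LINT x:A|lborel. \<bar>h x\<bar> powr p) = (\<integral>\<^sup>+x\<in>A. ennreal (\<bar>h x\<bar> powr p) \<partial>lborel)"
    unfolding set_lebesgue_integral_def
    by (subst nn_integral_eq_integral[symmetric])
       (use int in \<open>auto simp: set_integrable_def intro!: nn_integral_cong split: split_indicator\<close>)
  ultimately show ?thesis
    by (metis (no_types, lifting) ennreal_leI ennreal_mult' powr_ge_zero)
qed

lemma nn_integral_lborel_affine:
  fixes h :: "'a::euclidean_space \<Rightarrow> ennreal"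
  assumes [measurable]: "h \<in> borel_measurable borel" and c: "c > 0"
  shows "(\<integral>\<^sup>+x. h (t + c *\<^sub>R x) \<partial>lborel) = ennreal ((1 / c) ^ DIM('a)) * (\<integral>\<^sup>+x. h x \<partial>lborel)"
proof -
  have "(\<integral>\<^sup>+x. h x \<partial>lborel) = ennreal (c ^ DIM('a)) * (\<integral>\<^sup>+x. h (t + c *\<^sub>R x) \<partial>lborel)"
    using c by (subst lborel_affine[of c t])
      (auto simp: nn_integral_density nn_integral_distr nn_integral_cmult)
  then have "ennreal ((1 / c) ^ DIM('a)) * (\<integral>\<^sup>+x. h x \<partial>lborel)
      = ennreal ((1 / c) ^ DIM('a) * c ^ DIM('a)) * (\<integral>\<^sup>+x. h (t + c *\<^sub>R x) \<partial>lborel)"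
    using c by (simp add: ennreal_mult mult.assoc)
  also have "(1 / c) ^ DIM('a) * c ^ DIM('a) = 1" using c by (simp add: power_one_over)
  finally show ?thesis by simp
qed

lemma nn_integral_lborel_translate:
  fixes h :: "'a::euclidean_space \<Rightarrow> ennreal"
  assumes "h \<in> borel_measurable borel"
  shows "(\<integral>\<^sup>+x. h (x + t) \<partial>lborel) = (\<integral>\<^sup>+x. h x \<partial>lborel)"
  using nn_integral_lborel_affine[OF assms, of 1 t] by (simp add: add.commute)

text \<open>C1 is the right class because the truncations in \<open>C1_truncation\<close> leave the
  smooth functions. Carrying the gradient \<open>g\<close> explicitly makes its values under
  truncation and products available as formulas.\<close>

definition C1_compact :: "('a::euclidean_space \<Rightarrow> real) \<Rightarrow> ('a \<Rightarrow> 'a) \<Rightarrow> bool" where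
  "C1_compact f g \<longleftrightarrow> (\<forall>x. (f has_derivative (\<lambda>h. g x \<bullet> h)) (at x)) \<and>
     continuous_on UNIV g \<and> bounded {x. f x \<noteq> 0}"

lemma C1_compactD:
  assumes "C1_compact f g"
  shows "(f has_derivative (\<lambda>h. g x \<bullet> h)) (at x)" "continuous_on UNIV f" "continuous_on UNIV g"
    "f \<in> borel_measurable borel" "g \<in> borel_measurable borel"
proof -
  show 1: "(f has_derivative (\<lambda>h. g x \<bullet> h)) (at x)" "continuous_on UNIV g" for x
    using assms by (auto simp: C1_compact_def)
  show 2: "continuous_on UNIV f" using 1(1)
    by (auto intro!: continuous_at_imp_continuous_on has_derivative_continuous)
  show "f \<in> borel_measurable borel" "g \<in> borel_measurable borel"
    using 1 2 by (auto intro: borel_measurable_continuous_onI)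
qed

lemma C1_compact_support:
  assumes "C1_compact f g"
  obtains R where "R > 0" "\<And>x. norm x > R \<Longrightarrow> f x = 0" "\<And>x. norm x > R \<Longrightarrow> g x = 0"
proof -
  obtain R where R: "R > 0" "\<And>x. x \<in> {x. f x \<noteq> 0} \<Longrightarrow> norm x \<le> R"
    using assms unfolding C1_compact_def by (meson bounded_pos)
  then have f0: "f x = 0" if "norm x > R" for x using that by force
  have "g x = 0" if "norm x > R" for x
  proof -
    have "(f has_derivative (\<lambda>h. 0)) (at x)"
    proof (rule has_derivative_transform_within_open)
      show "((\<lambda>x. 0) has_derivative (\<lambda>h. 0)) (at x)" by simp
      show "open (- cball 0 R)" "x \<in> - cball 0 R" using that by auto
    qed (use f0 in auto)
    with C1_compactD(1)[OF assms, of x] have "(\<lambda>h. g x \<bullet> h) = (\<lambda>h. 0)"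
      by (rule has_derivative_unique)
    then have "g x \<bullet> g x = 0" by meson
    then show ?thesis by simp
  qed
  with f0 R that show ?thesis by blast
qed

lemma continuous_compact_support_integrable:
  fixes h :: "'a::euclidean_space \<Rightarrow> 'b::{banach, second_countable_topology}"
  assumes "continuous_on UNIV h" "\<And>x. norm x > R \<Longrightarrow> h x = 0"
  shows "integrable lborel h"
proof -
  have "integrable lborel (\<lambda>x. indicator (cball 0 R) x *\<^sub>R h x)"
    using assms by (intro borel_integrable_compact continuous_on_subset[OF assms(1)]) auto
  also have "(\<lambda>x. indicator (cball 0 R) x *\<^sub>R h x) = h"
    using assms(2) by (auto simp: indicator_def fun_eq_iff)
  finally show ?thesis .
qed

lemma C1_compact_integrable:
  assumes "C1_compact f g" "0 < p"
  shows "integrable lborel f" "integrable lborel g"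
    "integrable lborel (\<lambda>x. \<bar>f x\<bar> powr p)" "integrable lborel (\<lambda>x. norm (g x) powr p)"
proof -
  obtain R where R: "\<And>x. norm x > R \<Longrightarrow> f x = 0" "\<And>x. norm x > R \<Longrightarrow> g x = 0"
    using C1_compact_support[OF assms(1)] by metis
  note c = C1_compactD(2,3)[OF assms(1)]
  have cp: "continuous_on UNIV (\<lambda>x. \<bar>f x\<bar> powr p)" "continuous_on UNIV (\<lambda>x. norm (g x) powr p)"
    using assms(2) by (intro continuous_on_powr' continuous_intros c; simp)+
  show "integrable lborel f" "integrable lborel g"
    "integrable lborel (\<lambda>x. \<bar>f x\<bar> powr p)" "integrable lborel (\<lambda>x. norm (g x) powr p)"
    using R by (auto intro!: continuous_compact_support_integrable[of _ R] c cp)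
qed

text \<open>The fundamental theorem of calculus along the segment from \<open>x\<close> to
  \<open>x + z\<close>, followed by Jensen's inequality on the unit interval.\<close>

lemma C1_increment:
  assumes f: "C1_compact f g" and p: "1 < p"
  shows "ennreal (\<bar>f (x + z) - f x\<bar> powr p)
    \<le> ennreal (norm z powr p) * (\<integral>\<^sup>+t\<in>{0..1}. ennreal (norm (g (x + t *\<^sub>R z)) powr p) \<partial>lborel)"
proof -
  note c = C1_compactD[OF f]
  note [measurable] = c(5)
  have cg: "continuous_on S (\<lambda>t. g (x + t *\<^sub>R z))" for S
    by (intro continuous_on_compose2[OF c(3)] continuous_intros) auto
  have "(LINT t:{0..1}|lborel. g (x + t *\<^sub>R z) \<bullet> z) = f (x + 1 *\<^sub>R z) - f (x + 0 *\<^sub>R z)"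
    unfolding set_lebesgue_integral_def
  proof (rule integral_FTC_Icc)
    fix t :: real
    have "((\<lambda>t. f (x + t *\<^sub>R z)) has_derivative (\<lambda>h. g (x + t *\<^sub>R z) \<bullet> (h *\<^sub>R z))) (at t within {0..1})"
      by (rule has_derivative_compose[where f="\<lambda>t. x + t *\<^sub>R z" and g=f, OF _ c(1)])
         (auto intro!: derivative_eq_intros)
    then show "((\<lambda>t. f (x + t *\<^sub>R z)) has_vector_derivative g (x + t *\<^sub>R z) \<bullet> z) (at t within {0..1})"
      by (simp add: has_vector_derivative_def mult.commute)
  qed (auto intro!: continuous_intros cg)
  then have "ennreal (\<bar>f (x + z) - f x\<bar> powr p) = ennreal (\<bar>LINT t:{0..1}|lborel. g (x + t *\<^sub>R z) \<bullet> z\<bar> powr p)"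
    by simp
  also have "\<dots> \<le> ennreal (measure lborel {0..1::real} powr (p - 1)) *
      (\<integral>\<^sup>+t\<in>{0..1}. ennreal (\<bar>g (x + t *\<^sub>R z) \<bullet> z\<bar> powr p) \<partial>lborel)"
    using p by (intro compact_integral_powr_le continuous_intros cg) auto
  also have "\<dots> = (\<integral>\<^sup>+t\<in>{0..1}. ennreal (\<bar>g (x + t *\<^sub>R z) \<bullet> z\<bar> powr p) \<partial>lborel)" by simp
  also have "\<dots> \<le> (\<integral>\<^sup>+t. ennreal (norm z powr p) * (ennreal (norm (g (x + t *\<^sub>R z)) powr p) * indicator {0..1} t) \<partial>lborel)"
  proof (intro nn_integral_mono)
    fix t :: real
    have "\<bar>g (x + t *\<^sub>R z) \<bullet> z\<bar> powr p \<le> (norm (g (x + t *\<^sub>R z)) * norm z) powr p"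
      using p by (intro powr_mono2 Cauchy_Schwarz_ineq2) auto
    also have "\<dots> = norm z powr p * norm (g (x + t *\<^sub>R z)) powr p" by (simp add: powr_mult)
    finally have "ennreal (\<bar>g (x + t *\<^sub>R z) \<bullet> z\<bar> powr p) \<le> ennreal (norm z powr p) * ennreal (norm (g (x + t *\<^sub>R z)) powr p)"
      by (simp add: ennreal_leI flip: ennreal_mult)
    then show "ennreal (\<bar>g (x + t *\<^sub>R z) \<bullet> z\<bar> powr p) * indicator {0..1} t
      \<le> ennreal (norm z powr p) * (ennreal (norm (g (x + t *\<^sub>R z)) powr p) * indicator {0..1} t)"
      by (auto split: split_indicator)
  qed
  also have "\<dots> = ennreal (norm z powr p) * (\<integral>\<^sup>+t\<in>{0..1}. ennreal (norm (g (x + t *\<^sub>R z)) powr p) \<partial>lborel)"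
    by (intro nn_integral_cmult) measurable
  finally show ?thesis .
qed

text \<open>The p-th power of the gradient norm over the whole space, with values in
  \<open>ennreal\<close> in order to work with Tonelli's theorem and changes of variables.\<close>

definition Lp_energy :: "real \<Rightarrow> ('a::euclidean_space \<Rightarrow> 'a) \<Rightarrow> ennreal" where
  "Lp_energy p g = (\<integral>\<^sup>+x. ennreal (norm (g x) powr p) \<partial>lborel)"

text \<open>After exchanging the integrals in \<open>C1_increment\<close>, translation invariance
  makes the inner integral independent of the position \<open>t\<close> on the segment.\<close>

lemma C1_translation:
  fixes f :: "'a::euclidean_space \<Rightarrow> real"
  assumes f: "C1_compact f g" and p: "1 < p"
  shows "(\<integral>\<^sup>+x. ennreal (\<bar>f (x + z) - f x\<bar> powr p) \<partial>lborel) \<le> ennreal (norm z powr p) * Lp_energy p g"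
proof -
  note [measurable] = C1_compactD(4,5)[OF f]
  have "(\<integral>\<^sup>+x. ennreal (\<bar>f (x + z) - f x\<bar> powr p) \<partial>lborel)
    \<le> (\<integral>\<^sup>+x. ennreal (norm z powr p) * (\<integral>\<^sup>+t\<in>{0..1}. ennreal (norm (g (x + t *\<^sub>R z)) powr p) \<partial>lborel) \<partial>lborel)"
    by (intro nn_integral_mono C1_increment[OF f p])
  also have "\<dots> = ennreal (norm z powr p) * (\<integral>\<^sup>+x. (\<integral>\<^sup>+t\<in>{0..1}. ennreal (norm (g (x + t *\<^sub>R z)) powr p) \<partial>lborel) \<partial>lborel)"
    by (intro nn_integral_cmult) measurable
  also have "(\<integral>\<^sup>+x. (\<integral>\<^sup>+t\<in>{0..1::real}. ennreal (norm (g (x + t *\<^sub>R z)) powr p) \<partial>lborel) \<partial>lborel)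
     = (\<integral>\<^sup>+t. (\<integral>\<^sup>+x. ennreal (norm (g (x + t *\<^sub>R z)) powr p) * indicator {0..1::real} t \<partial>lborel) \<partial>lborel)"
    by (intro lborel_pair.Fubini') measurable
  also have "\<dots> = (\<integral>\<^sup>+t\<in>{0..1::real}. Lp_energy p g \<partial>lborel)"
    by (intro nn_integral_cong, subst nn_integral_multc, measurable)
       (simp add: Lp_energy_def nn_integral_lborel_translate[of "\<lambda>x. ennreal (norm (g x) powr p)"])
  also have "\<dots> = Lp_energy p g" by (subst nn_integral_cmult_indicator) auto
  finally show ?thesis .
qed

section \<open>Averages over balls\<close>

definition unit_vol :: "'a::euclidean_space itself \<Rightarrow> real" where
  "unit_vol _ = measure lborel (cball 0 1 :: 'a set)"

lemma unit_vol_pos: "unit_vol TYPE('a::euclidean_space) > 0"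
  unfolding unit_vol_def by (simp add: content_cball)

text \<open>Integrating over the fixed unit ball, instead of the ball around \<open>x\<close>, lets
  averages with different radii be compared under one integral sign, point by point in
  \<open>z\<close>.\<close>

definition ball_avg :: "('a::euclidean_space \<Rightarrow> real) \<Rightarrow> real \<Rightarrow> 'a \<Rightarrow> real" where
  "ball_avg f r x = (LINT z:cball 0 1|lborel. f (x + r *\<^sub>R z)) / unit_vol TYPE('a)"

text \<open>Jensen's inequality for the normalised measure on the unit ball; \<open>f x\<close>
  itself is an average of this kind, with a constant integrand.\<close>

lemma ball_avg_diff_le:
  fixes h k :: "'a::euclidean_space \<Rightarrow> real"
  assumes p: "1 < p" and h: "continuous_on UNIV h" "continuous_on UNIV k"
    and V_def: "V = unit_vol TYPE('a)"
  shows "ennreal (\<bar>(LINT z:cball 0 1|lborel. h z) / V - (LINT z:cball 0 1|lborel. k z) / V\<bar> powr p)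
    \<le> ennreal (1 / V) * (\<integral>\<^sup>+z\<in>cball 0 1. ennreal (\<bar>h z - k z\<bar> powr p) \<partial>lborel)"
proof -
  have V: "V > 0" unfolding V_def by (rule unit_vol_pos)
  have i: "set_integrable lborel (cball 0 1) h" "set_integrable lborel (cball 0 1) k"
    unfolding set_integrable_def
    by (intro borel_integrable_compact continuous_on_subset[OF h(1)] continuous_on_subset[OF h(2)]; simp)+
  have "(LINT z:cball 0 1|lborel. h z) / V - (LINT z:cball 0 1|lborel. k z) / V = (LINT z:cball 0 1|lborel. h z - k z) / V"
    using i by (simp add: diff_divide_distrib)
  then have "\<bar>(LINT z:cball 0 1|lborel. h z) / V - (LINT z:cball 0 1|lborel. k z) / V\<bar> powr p
      = (1 / V) powr p * \<bar>LINT z:cball 0 1|lborel. h z - k z\<bar> powr p"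
    using V by (simp add: abs_divide powr_divide)
  then have "ennreal (\<bar>(LINT z:cball 0 1|lborel. h z) / V - (LINT z:cball 0 1|lborel. k z) / V\<bar> powr p)
     = ennreal ((1 / V) powr p) * ennreal (\<bar>LINT z:cball 0 1|lborel. h z - k z\<bar> powr p)"
    by (simp add: ennreal_mult)
  also have "\<dots> \<le> ennreal ((1 / V) powr p) * (ennreal (measure lborel (cball 0 1 :: 'a set) powr (p - 1)) *
      (\<integral>\<^sup>+z\<in>cball 0 1. ennreal (\<bar>h z - k z\<bar> powr p) \<partial>lborel))"
    using p h by (intro mult_left_mono compact_integral_powr_le continuous_intros) auto
  also have "\<dots> = ennreal ((1 / V) powr p * V powr (p - 1)) * (\<integral>\<^sup>+z\<in>cball 0 1. ennreal (\<bar>h z - k z\<bar> powr p) \<partial>lborel)"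
    by (simp add: ennreal_mult mult.assoc V_def unit_vol_def)
  also have "(1 / V) powr p * V powr (p - 1) = 1 / V" using V by (simp add: powr_divide powr_diff)
  finally show ?thesis .
qed

lemma ball_avg_const:
  "(LINT z:cball (0::'a) 1|lborel. c) / unit_vol TYPE('a::euclidean_space) = c" for c :: real
proof -
  have "measure lborel (cball 0 1 :: 'a set) \<noteq> 0"
    using unit_vol_pos[where 'a='a] unfolding unit_vol_def by linarith
  then show ?thesis
    unfolding unit_vol_def set_lebesgue_integral_def by simp
qed

lemma cball_borel [measurable]: "cball a r \<in> sets borel" for a :: "'a::euclidean_space"
  by (simp add: borel_closed)

lemma ball_avg_measurable [measurable]:
  fixes f :: "'a::euclidean_space \<Rightarrow> real"
  assumes [measurable]: "f \<in> borel_measurable borel"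
  shows "ball_avg f r \<in> borel_measurable borel"
  unfolding ball_avg_def set_lebesgue_integral_def by measurable

text \<open>The error at \<open>x\<close> averages the increments by \<open>r *\<^sub>R z\<close>
  over the unit ball. Each such increment obeys \<open>C1_translation\<close> with displacement at
  most \<open>r\<close>.\<close>

lemma C1_ball_avg_approx:
  fixes f :: "'a::euclidean_space \<Rightarrow> real"
  assumes f: "C1_compact f g" and p: "1 < p" and r: "r > 0"
  shows "(\<integral>\<^sup>+x. ennreal (\<bar>f x - ball_avg f r x\<bar> powr p) \<partial>lborel) \<le> ennreal (r powr p) * Lp_energy p g"
proof -
  note [measurable] = C1_compactD(4,5)[OF f]
  define V where "V = unit_vol TYPE('a)"
  have V: "V > 0" unfolding V_def by (rule unit_vol_pos)
  have cf: "continuous_on UNIV (\<lambda>z. f (x + r *\<^sub>R z))" for x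
    by (intro continuous_on_compose2[OF C1_compactD(2)[OF f]] continuous_intros) auto
  have "(\<integral>\<^sup>+x. ennreal (\<bar>f x - ball_avg f r x\<bar> powr p) \<partial>lborel)
     \<le> (\<integral>\<^sup>+x. ennreal (1 / V) * (\<integral>\<^sup>+z\<in>cball 0 1. ennreal (\<bar>f x - f (x + r *\<^sub>R z)\<bar> powr p) \<partial>lborel) \<partial>lborel)"
  proof (intro nn_integral_mono)
    fix x
    show "ennreal (\<bar>f x - ball_avg f r x\<bar> powr p) \<le> ennreal (1 / V) * (\<integral>\<^sup>+z\<in>cball 0 1. ennreal (\<bar>f x - f (x + r *\<^sub>R z)\<bar> powr p) \<partial>lborel)"
      using ball_avg_diff_le[OF p, of "\<lambda>_. f x" "\<lambda>z. f (x + r *\<^sub>R z)" V] cf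
      by (simp add: V_def ball_avg_const ball_avg_def)
  qed
  also have "\<dots> = ennreal (1 / V) * (\<integral>\<^sup>+x. (\<integral>\<^sup>+z\<in>cball 0 1. ennreal (\<bar>f x - f (x + r *\<^sub>R z)\<bar> powr p) \<partial>lborel) \<partial>lborel)"
    by (intro nn_integral_cmult) measurable
  also have "(\<integral>\<^sup>+x. (\<integral>\<^sup>+z\<in>cball 0 1. ennreal (\<bar>f x - f (x + r *\<^sub>R z)\<bar> powr p) \<partial>lborel) \<partial>lborel)
     = (\<integral>\<^sup>+z. (\<integral>\<^sup>+x. ennreal (\<bar>f x - f (x + r *\<^sub>R z)\<bar> powr p) * indicator (cball 0 1) z \<partial>lborel) \<partial>lborel)"
    by (intro lborel_pair.Fubini') measurable
  also have "\<dots> \<le> (\<integral>\<^sup>+z. ennreal (r powr p) * Lp_energy p g * indicator (cball 0 1 :: 'a set) z \<partial>lborel)"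
  proof (intro nn_integral_mono)
    fix z :: 'a
    have "(\<integral>\<^sup>+x. ennreal (\<bar>f x - f (x + r *\<^sub>R z)\<bar> powr p) \<partial>lborel) \<le> ennreal (r powr p) * Lp_energy p g" if z: "z \<in> cball 0 1"
    proof -
      have "(\<integral>\<^sup>+x. ennreal (\<bar>f x - f (x + r *\<^sub>R z)\<bar> powr p) \<partial>lborel) \<le> ennreal (norm (r *\<^sub>R z) powr p) * Lp_energy p g"
        using C1_translation[OF f p, of "r *\<^sub>R z"] by (simp add: abs_minus_commute)
      also have "\<dots> \<le> ennreal (r powr p) * Lp_energy p g"
        using z r p by (intro mult_right_mono ennreal_leI powr_mono2) (auto simp: mult_left_le)
      finally show ?thesis .
    qed
    then show "(\<integral>\<^sup>+x. ennreal (\<bar>f x - f (x + r *\<^sub>R z)\<bar> powr p) * indicator (cball 0 1) z \<partial>lborel)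
      \<le> ennreal (r powr p) * Lp_energy p g * indicator (cball 0 1 :: 'a set) z"
      by (cases "z \<in> cball 0 1") auto
  qed
  also have "\<dots> = ennreal (r powr p) * Lp_energy p g * ennreal V"
    by (subst nn_integral_cmult_indicator) (auto simp: V_def unit_vol_def emeasure_cball content_cball)
  also have "ennreal (1 / V) * (ennreal (r powr p) * Lp_energy p g * ennreal V) = ennreal (1 / V * V) * (ennreal (r powr p) * Lp_energy p g)"
    using V by (subst ennreal_mult) (auto simp: mult_ac)
  also have "\<dots> = ennreal (r powr p) * Lp_energy p g" using V by simp
  finally show ?thesis by (auto simp: mult_left_mono)
qed

text \<open>The point \<open>x + (2 * r) *\<^sub>R z\<close> is \<open>x + r *\<^sub>R z\<close>
  moved by \<open>r *\<^sub>R z\<close>, so the gradient is evaluated at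
  \<open>x + (r * (1 + t)) *\<^sub>R z\<close>. The dilation factor stays above \<open>r\<close>,
  and rescaling costs at most \<open>(1 / r) ^ DIM('a)\<close>. Comparing with the value at
  \<open>x\<close> itself would bring in dilations close to 0 and a divergent integral in
  \<open>t\<close>.\<close>

lemma C1_ball_avg_double:
  fixes f :: "'a::euclidean_space \<Rightarrow> real"
  assumes f: "C1_compact f g" and p: "1 < p" and r: "r > 0"
  shows "ennreal (\<bar>ball_avg f r x - ball_avg f (2 * r) x\<bar> powr p)
    \<le> ennreal (r powr (p - real DIM('a)) / unit_vol TYPE('a)) * Lp_energy p g"
proof -
  note [measurable] = C1_compactD(4,5)[OF f]
  define V where "V = unit_vol TYPE('a)"
  have V: "V > 0" unfolding V_def by (rule unit_vol_pos)
  have cf: "continuous_on UNIV (\<lambda>z. f (x + s *\<^sub>R z))" for s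
    by (intro continuous_on_compose2[OF C1_compactD(2)[OF f]] continuous_intros) auto
  have "ennreal (\<bar>ball_avg f r x - ball_avg f (2 * r) x\<bar> powr p)
    \<le> ennreal (1 / V) * (\<integral>\<^sup>+z\<in>cball 0 1. ennreal (\<bar>f (x + r *\<^sub>R z) - f (x + (2 * r) *\<^sub>R z)\<bar> powr p) \<partial>lborel)"
    using ball_avg_diff_le[OF p cf cf V_def, of r "2 * r"] by (simp add: V_def ball_avg_def)
  also have "\<dots> \<le> ennreal (1 / V) * (\<integral>\<^sup>+z. ennreal (r powr p) *
      (\<integral>\<^sup>+t\<in>{0..1}. ennreal (norm (g (x + (r * (1 + t)) *\<^sub>R z)) powr p) \<partial>lborel) \<partial>lborel)"
  proof (intro mult_left_mono nn_integral_mono)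
    fix z :: 'a
    have "ennreal (\<bar>f (x + r *\<^sub>R z) - f (x + (2 * r) *\<^sub>R z)\<bar> powr p) \<le>
      ennreal (r powr p) * (\<integral>\<^sup>+t\<in>{0..1}. ennreal (norm (g (x + (r * (1 + t)) *\<^sub>R z)) powr p) \<partial>lborel)"
      if z: "z \<in> cball 0 1"
    proof -
      have e: "x + r *\<^sub>R z + r *\<^sub>R z = x + (2 * r) *\<^sub>R z" by (simp add: scaleR_2 flip: scaleR_scaleR) 
      have e2: "x + r *\<^sub>R z + t *\<^sub>R r *\<^sub>R z = x + (r * (1 + t)) *\<^sub>R z" for t by (simp add: algebra_simps)
      have "ennreal (\<bar>f (x + r *\<^sub>R z) - f (x + (2 * r) *\<^sub>R z)\<bar> powr p) \<le>
        ennreal (norm (r *\<^sub>R z) powr p) * (\<integral>\<^sup>+t\<in>{0..1}. ennreal (norm (g (x + (r * (1 + t)) *\<^sub>R z)) powr p) \<partial>lborel)"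
        using C1_increment[OF f p, of "x + r *\<^sub>R z" "r *\<^sub>R z"] unfolding e e2 by (simp add: abs_minus_commute)
      also have "\<dots> \<le> ennreal (r powr p) * (\<integral>\<^sup>+t\<in>{0..1}. ennreal (norm (g (x + (r * (1 + t)) *\<^sub>R z)) powr p) \<partial>lborel)"
        using z r p by (intro mult_right_mono ennreal_leI powr_mono2) (auto simp: mult_left_le)
      finally show ?thesis .
    qed
    then show "ennreal (\<bar>f (x + r *\<^sub>R z) - f (x + (2 * r) *\<^sub>R z)\<bar> powr p) * indicator (cball 0 1) z \<le>
      ennreal (r powr p) * (\<integral>\<^sup>+t\<in>{0..1}. ennreal (norm (g (x + (r * (1 + t)) *\<^sub>R z)) powr p) \<partial>lborel)"
      by (cases "z \<in> cball 0 1") auto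
  qed auto
  also have "(\<integral>\<^sup>+z. ennreal (r powr p) *
      (\<integral>\<^sup>+t\<in>{0..1}. ennreal (norm (g (x + (r * (1 + t)) *\<^sub>R z)) powr p) \<partial>lborel) \<partial>lborel)
    = ennreal (r powr p) * (\<integral>\<^sup>+z. (\<integral>\<^sup>+t\<in>{0..1}. ennreal (norm (g (x + (r * (1 + t)) *\<^sub>R z)) powr p) \<partial>lborel) \<partial>lborel)"
    by (intro nn_integral_cmult) measurable
  also have "(\<integral>\<^sup>+z. (\<integral>\<^sup>+t\<in>{0..1::real}. ennreal (norm (g (x + (r * (1 + t)) *\<^sub>R z)) powr p) \<partial>lborel) \<partial>lborel)
    = (\<integral>\<^sup>+t. (\<integral>\<^sup>+z. ennreal (norm (g (x + (r * (1 + t)) *\<^sub>R z)) powr p) * indicator {0..1::real} t \<partial>lborel) \<partial>lborel)"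
    by (intro lborel_pair.Fubini') measurable
  also have "\<dots> \<le> (\<integral>\<^sup>+t. ennreal ((1 / r) ^ DIM('a)) * Lp_energy p g * indicator {0..1::real} t \<partial>lborel)"
  proof (intro nn_integral_mono)
    fix t :: real
    have "(\<integral>\<^sup>+z. ennreal (norm (g (x + (r * (1 + t)) *\<^sub>R z)) powr p) \<partial>lborel) \<le> ennreal ((1 / r) ^ DIM('a)) * Lp_energy p g"
      if t: "t \<in> {0..1}"
    proof -
      have "(\<integral>\<^sup>+z. ennreal (norm (g (x + (r * (1 + t)) *\<^sub>R z)) powr p) \<partial>lborel) = ennreal ((1 / (r * (1 + t))) ^ DIM('a)) * Lp_energy p g"
        unfolding Lp_energy_def using t r by (intro nn_integral_lborel_affine[of "\<lambda>x. ennreal (norm (g x) powr p)"]) auto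
      also have "\<dots> \<le> ennreal ((1 / r) ^ DIM('a)) * Lp_energy p g"
        using t r by (intro mult_right_mono ennreal_leI power_mono divide_left_mono) (auto simp: mult_le_cancel_left1)
      finally show ?thesis .
    qed
    then show "(\<integral>\<^sup>+z. ennreal (norm (g (x + (r * (1 + t)) *\<^sub>R z)) powr p) * indicator {0..1} t \<partial>lborel)
      \<le> ennreal ((1 / r) ^ DIM('a)) * Lp_energy p g * indicator {0..1::real} t"
      by (cases "t \<in> {0..1}") auto
  qed
  also have "\<dots> = ennreal ((1 / r) ^ DIM('a)) * Lp_energy p g"
    by (subst nn_integral_cmult_indicator) auto
  also have "ennreal (1 / V) * (ennreal (r powr p) * (ennreal ((1 / r) ^ DIM('a)) * Lp_energy p g))
    = ennreal (1 / V * (r powr p * (1 / r) ^ DIM('a))) * Lp_energy p g"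
  proof -
    have "ennreal (1 / V * (r powr p * (1 / r) ^ DIM('a))) = ennreal (1 / V) * (ennreal (r powr p) * ennreal ((1 / r) ^ DIM('a)))"
      using V r by (subst ennreal_mult, simp, simp, subst ennreal_mult) auto
    then show ?thesis by (simp only: mult.assoc)
  qed
  also have "1 / V * (r powr p * (1 / r) ^ DIM('a)) = r powr (p - real DIM('a)) / V"
    using r by (simp add: powr_diff powr_realpow power_one_over field_simps)
  finally show ?thesis by (auto simp: mult_left_mono V_def)
qed

section \<open>The Sobolev inequality for compactly supported functions\<close>

text \<open>Telescoping over the radii \<open>2 ^ m * r\<close>, written as monotonicity:
  \<open>b R\<close>, the average minus its claimed bound, does not decrease when \<open>R\<close>
  doubles, while its limit along these radii is at most 0. The exponent \<open>s\<close> is positive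
  because \<open>p\<close> is below the dimension.\<close>

lemma C1_ball_avg_le:
  fixes f :: "'a::euclidean_space \<Rightarrow> real"
  assumes f: "C1_compact f g" and p: "1 < p" "p < real DIM('a)" and r: "r > 0"
    and G: "0 \<le> G" "Lp_energy p g \<le> ennreal G"
    and s_def: "s = real DIM('a) / p - 1"
  shows "\<bar>ball_avg f r x\<bar> \<le> unit_vol TYPE('a) powr (- 1 / p) / (1 - 2 powr (- s)) * G powr (1 / p) * r powr (- s)"
proof -
  define V where "V = unit_vol TYPE('a)"
  have V: "V > 0" unfolding V_def by (rule unit_vol_pos)
  have s: "s > 0" using p by (simp add: s_def field_simps)
  define D where "D = V powr (- 1 / p) * G powr (1 / p)"
  \<comment> \<open>The sum of the geometric series with first term \<open>D\<close> and ratio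
    \<open>2 powr (- s)\<close>.\<close>
  define K where "K = D / (1 - 2 powr (- s))"
  have s2: "2 powr (- s) < 1" using s powr_less_mono[of "- s" 0 2] by simp
  define b where "b R = \<bar>ball_avg f R x\<bar> - K * R powr (- s)" for R
  have double: "\<bar>ball_avg f R x - ball_avg f (2 * R) x\<bar> \<le> D * R powr (- s)" if R: "R > 0" for R
  proof -
    have "ennreal (\<bar>ball_avg f R x - ball_avg f (2 * R) x\<bar> powr p) \<le> ennreal (R powr (p - real DIM('a)) / V) * ennreal G"
      using C1_ball_avg_double[OF f p(1) R, of x] G(2) unfolding V_def
      by (meson mult_left_mono order_trans zero_le)
    then have "\<bar>ball_avg f R x - ball_avg f (2 * R) x\<bar> powr p \<le> R powr (p - real DIM('a)) / V * G"
      using G V by (simp add: ennreal_le_iff flip: ennreal_mult)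
    then have "(\<bar>ball_avg f R x - ball_avg f (2 * R) x\<bar> powr p) powr (1 / p) \<le> (R powr (p - real DIM('a)) / V * G) powr (1 / p)"
      using p by (intro powr_mono2) auto
    then have "\<bar>ball_avg f R x - ball_avg f (2 * R) x\<bar> \<le> (R powr (p - real DIM('a)) / V * G) powr (1 / p)"
      using p by (simp add: powr_powr)
    also have "\<dots> = R powr ((p - real DIM('a)) / p) * (1 / V) powr (1 / p) * G powr (1 / p)"
      using V G R by (simp add: powr_mult powr_divide powr_powr)
    also have "(p - real DIM('a)) / p = - s" using p by (simp add: s_def field_simps)
    also have "(1 / V) powr (1 / p) = V powr (- 1 / p)" using V by (simp add: powr_divide powr_minus_divide)
    finally show ?thesis by (simp add: D_def mult_ac)
  qed
  have mono: "b R \<le> b (2 * R)" if R: "R > 0" for R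
  proof -
    have "K * R powr (- s) - K * (2 * R) powr (- s) = K * (1 - 2 powr (- s)) * R powr (- s)"
      using R by (simp add: powr_mult algebra_simps)
    also have "K * (1 - 2 powr (- s)) = D" using s2 s by (simp add: K_def)
    finally show ?thesis using double[OF R] unfolding b_def by linarith
  qed
  have iter: "b r \<le> b (2 ^ m * r)" for m
  proof (induction m)
    case (Suc m)
    have "b (2 ^ m * r) \<le> b (2 * (2 ^ m * r))" using r by (intro mono) simp
    with Suc show ?case by (simp add: mult.assoc)
  qed simp
  define I where "I = (LINT x|lborel. \<bar>f x\<bar>)"
  have I: "I \<ge> 0" by (simp add: I_def)
  note [measurable] = C1_compactD(4)[OF f]
  \<comment> \<open>A crude bound by the L^1 norm of \<open>f\<close>. It is not uniform in
    \<open>f\<close>, but only serves to let the averages vanish at infinity and leaves no trace in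
    the result.\<close>
  have decay: "\<bar>ball_avg f R x\<bar> \<le> I / V * (1 / R) ^ DIM('a)" if R: "R > 0" for R
  proof -
    have "ennreal \<bar>LINT z:cball 0 1|lborel. f (x + R *\<^sub>R z)\<bar> \<le> (\<integral>\<^sup>+z. ennreal (norm (indicator (cball 0 1) z *\<^sub>R f (x + R *\<^sub>R z))) \<partial>lborel)"
      unfolding set_lebesgue_integral_def
    proof (cases "integrable lborel (\<lambda>z. indicator (cball 0 1) z *\<^sub>R f (x + R *\<^sub>R z))")
      case True
      from integral_norm_bound_ennreal[OF this]
      show "ennreal \<bar>LINT z|lborel. indicator (cball 0 1) z *\<^sub>R f (x + R *\<^sub>R z)\<bar> \<le> (\<integral>\<^sup>+z. ennreal (norm (indicator (cball 0 1) z *\<^sub>R f (x + R *\<^sub>R z))) \<partial>lborel)"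
        by simp
    qed (simp add: not_integrable_integral_eq)
    also have "\<dots> \<le> (\<integral>\<^sup>+z. ennreal \<bar>f (x + R *\<^sub>R z)\<bar> \<partial>lborel)"
      by (intro nn_integral_mono) (auto split: split_indicator)
    also have "\<dots> = ennreal ((1 / R) ^ DIM('a)) * (\<integral>\<^sup>+x. ennreal \<bar>f x\<bar> \<partial>lborel)"
      by (rule nn_integral_lborel_affine[OF _ R, of "\<lambda>x. ennreal \<bar>f x\<bar>"]) measurable
    also have "(\<integral>\<^sup>+x. ennreal \<bar>f x\<bar> \<partial>lborel) = ennreal I"
      unfolding I_def using C1_compact_integrable(1)[OF f, of 1] by (intro nn_integral_eq_integral) auto
    finally have "\<bar>LINT z:cball 0 1|lborel. f (x + R *\<^sub>R z)\<bar> \<le> (1 / R) ^ DIM('a) * I"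
      using I R by (simp flip: ennreal_mult)
    then have "\<bar>LINT z:cball 0 1|lborel. f (x + R *\<^sub>R z)\<bar> / V \<le> (1 / R) ^ DIM('a) * I / V"
      using V by (intro divide_right_mono) auto
    then show ?thesis unfolding ball_avg_def V_def[symmetric] using V by (simp add: abs_divide mult_ac)
  qed
  have K: "K \<ge> 0" unfolding K_def D_def using s2 by simp
  have "b r \<le> I / V * (1 / r) ^ DIM('a) * (1 / 2 ^ DIM('a)) ^ m" for m
  proof -
    have "0 \<le> K * (2 ^ m * r) powr (- s)" using K by simp
    then have "b r \<le> \<bar>ball_avg f (2 ^ m * r) x\<bar>" using iter[of m] unfolding b_def by linarith
    also have "\<dots> \<le> I / V * (1 / (2 ^ m * r)) ^ DIM('a)" using r by (intro decay) auto
    also have "\<dots> = I / V * (1 / r) ^ DIM('a) * (1 / 2 ^ DIM('a)) ^ m"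
      by (simp add: power_mult_distrib power_one_over mult.commute flip: power_mult)
    finally show ?thesis .
  qed
  moreover have "(\<lambda>m. I / V * (1 / r) ^ DIM('a) * (1 / 2 ^ DIM('a)) ^ m) \<longlonglongrightarrow> I / V * (1 / r) ^ DIM('a) * 0"
    by (intro tendsto_mult tendsto_const LIMSEQ_power_zero) (auto simp: power_one_over[symmetric] power_less_one_iff)
  ultimately have "b r \<le> 0" by (intro LIMSEQ_le_const) auto
  then show ?thesis by (simp add: b_def K_def D_def V_def)
qed

text \<open>At a suitable radius the average stays below \<open>lam / 2\<close>, so on the level set
  \<open>f\<close> differs from it by at least \<open>lam / 2\<close>, and Markov's inequality
  applies to \<open>C1_ball_avg_approx\<close>.\<close>

lemma C1_weak_type:
  fixes p :: real
  assumes p: "1 < p" "p < real DIM('a::euclidean_space)"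
    and q_def: "q = p * real DIM('a) / (real DIM('a) - p)"
  obtains C where "C > 0"
    "\<And>(f :: 'a \<Rightarrow> real) g G lam. C1_compact f g \<Longrightarrow> G > 0 \<Longrightarrow> Lp_energy p g \<le> ennreal G \<Longrightarrow> lam > 0 \<Longrightarrow>
      emeasure lborel {x. lam \<le> \<bar>f x\<bar>} \<le> ennreal (C * lam powr (- q) * G powr (q / p))"
proof -
  define s where "s = real DIM('a) / p - 1"
  have s: "s > 0" using p by (simp add: s_def field_simps)
  define K where "K = unit_vol TYPE('a) powr (- 1 / p) / (1 - 2 powr (- s))"
  have s2: "2 powr (- s) < 1" using s powr_less_mono[of "- s" 0 2] by simp
  have K: "K > 0" unfolding K_def using unit_vol_pos[where 'a='a] s2 by simp
  define C where "C = 2 powr p * (2 * K) powr (p / s)"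
  \<comment> \<open>The origin of the critical exponent: inserting the chosen radius yields the
    powers \<open>p + p / s\<close> of \<open>1 / lam\<close> and \<open>1 + 1 / s\<close> of
    \<open>G\<close>.\<close>
  have ex: "1 + 1 / s = q / p" "p + p / s = q"
    using p by (auto simp: s_def q_def field_simps)
  show ?thesis
  proof (rule that[of C])
    show "C > 0" using K by (simp add: C_def)
    fix f :: "'a \<Rightarrow> real" and g G and lam :: real
    assume f: "C1_compact f g" and G: "G > 0" "Lp_energy p g \<le> ennreal G" and l: "lam > 0"
    note [measurable] = C1_compactD(4,5)[OF f]
    \<comment> \<open>The solution of
      \<open>K * G powr (1 / p) * r powr (- s) = lam / 2\<close>.\<close>
    define r where "r = (2 * K * G powr (1 / p) / lam) powr (1 / s)"
    have b: "2 * K * G powr (1 / p) / lam > 0" using K G l by simp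
    have r: "r > 0" unfolding r_def using b by (simp only: powr_gt_zero)
    have rs: "r powr (- s) = lam / (2 * K * G powr (1 / p))"
      using b s K G l by (simp add: r_def powr_powr powr_minus_divide)
    have avg: "\<bar>ball_avg f r x\<bar> \<le> lam / 2" for x
    proof -
      have "\<bar>ball_avg f r x\<bar> \<le> K * G powr (1 / p) * r powr (- s)"
        unfolding K_def using C1_ball_avg_le[OF f p r _ G(2) s_def] G by simp
      also have "\<dots> = lam / 2" unfolding rs using K G by simp
      finally show ?thesis .
    qed
    have "emeasure lborel {x. lam \<le> \<bar>f x\<bar>} \<le> emeasure lborel {x \<in> space lborel. 1 \<le> ennreal ((2 / lam) powr p) * ennreal (\<bar>f x - ball_avg f r x\<bar> powr p)}"
    proof (intro emeasure_mono)
      show "{x. lam \<le> \<bar>f x\<bar>} \<subseteq> {x \<in> space lborel. 1 \<le> ennreal ((2 / lam) powr p) * ennreal (\<bar>f x - ball_avg f r x\<bar> powr p)}"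
      proof safe
        fix x assume "lam \<le> \<bar>f x\<bar>"
        then have "lam / 2 \<le> \<bar>f x - ball_avg f r x\<bar>" using avg[of x] by linarith
        then have "1 \<le> 2 / lam * \<bar>f x - ball_avg f r x\<bar>" using l by (simp add: field_simps)
        then have "1 powr p \<le> (2 / lam * \<bar>f x - ball_avg f r x\<bar>) powr p"
          using p by (intro powr_mono2) auto
        then show "1 \<le> ennreal ((2 / lam) powr p) * ennreal (\<bar>f x - ball_avg f r x\<bar> powr p)"
          unfolding powr_mult by (simp flip: ennreal_mult)
      qed simp
    qed measurable
    also have "\<dots> \<le> ennreal ((2 / lam) powr p) * (\<integral>\<^sup>+x\<in>space lborel. ennreal (\<bar>f x - ball_avg f r x\<bar> powr p) \<partial>lborel)"
      by (intro nn_integral_Markov_inequality) measurable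
    also have "\<dots> \<le> ennreal ((2 / lam) powr p) * (ennreal (r powr p) * ennreal G)"
      using order_trans[OF C1_ball_avg_approx[OF f p(1) r] mult_left_mono[OF G(2)]]
      by (intro mult_left_mono) auto
    also have "\<dots> = ennreal ((2 / lam) powr p * (r powr p * G))"
      using G by (subst ennreal_mult, simp, simp, subst ennreal_mult) auto
    also have "(2 / lam) powr p * (r powr p * G) = C * lam powr (- q) * G powr (q / p)"
    proof -
      have "r powr p = (2 * K) powr (p / s) * G powr (1 / s) / lam powr (p / s)"
        using K G l p by (simp add: r_def powr_powr powr_mult powr_divide)
      moreover have "G powr (q / p) = G * G powr (1 / s)" using G unfolding ex(1)[symmetric] by (simp add: powr_add)
      moreover have "lam powr (- q) = 1 / (lam powr p * lam powr (p / s))"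
        unfolding ex(2)[symmetric] powr_minus_divide powr_add ..
      ultimately show ?thesis using l by (simp add: C_def powr_divide)
    qed
    finally show "emeasure lborel {x. lam \<le> \<bar>f x\<bar>} \<le> ennreal (C * lam powr (- q) * G powr (q / p))" .
  qed
qed

section \<open>Truncation by a C1 step function\<close>

lemma max0_square_deriv:
  fixes t :: real
  shows "((\<lambda>t. (max 0 t)\<^sup>2) has_real_derivative 2 * max 0 t) (at t)"
proof -
  consider "t > 0" | "t < 0" | "t = 0" by linarith
  then show ?thesis
  proof cases
    case 1
    show ?thesis
    proof (rule has_field_derivative_transform_within_open)
      show "((\<lambda>t. t\<^sup>2) has_real_derivative 2 * max 0 t) (at t)" using 1 by (auto intro!: derivative_eq_intros)
      show "open {0::real<..}" "t \<in> {0<..}" using 1 by auto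
    qed auto
  next
    case 2
    show ?thesis
    proof (rule has_field_derivative_transform_within_open)
      show "((\<lambda>t. 0) has_real_derivative 2 * max 0 t) (at t)" using 2 by (auto intro!: derivative_eq_intros)
      show "open {..<0::real}" "t \<in> {..<0}" using 2 by auto
    qed auto
  next
    case 3
    have "((\<lambda>h. (max 0 h)\<^sup>2 / h) \<longlongrightarrow> 0) (at (0::real))"
    proof (rule tendsto_0_le[where K=1])
      show "((\<lambda>h. h) \<longlongrightarrow> 0) (at (0::real))" by simp
      show "\<forall>\<^sub>F h in at (0::real). norm ((max 0 h)\<^sup>2 / h) \<le> norm h * 1"
        by (intro always_eventually) (auto simp: max_def power2_eq_square)
    qed
    then show ?thesis using 3 by (simp add: DERIV_def)
  qed
qed

text \<open>The primitive of the hat function on the interval from 0 to 2 with peak value 2 at 1.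
  The area 2 under the hat is the value reached from 2 on.\<close>

definition smooth_step :: "real \<Rightarrow> real" where
  "smooth_step t = (max 0 t)\<^sup>2 - 2 * (max 0 (t - 1))\<^sup>2 + (max 0 (t - 2))\<^sup>2"

definition smooth_step' :: "real \<Rightarrow> real" where
  "smooth_step' t = 2 * max 0 t - 4 * max 0 (t - 1) + 2 * max 0 (t - 2)"

lemma smooth_step_deriv: "(smooth_step has_real_derivative smooth_step' t) (at t)"
proof -
  have 1: "((\<lambda>t. (max 0 (t - a))\<^sup>2) has_real_derivative 2 * max 0 (t - a)) (at t)" for a :: real
  proof -
    have "((\<lambda>t. t - a) has_real_derivative 1) (at t)" by (auto intro!: derivative_eq_intros)
    from DERIV_chain2[OF max0_square_deriv this] show ?thesis by simp
  qed
  from DERIV_add[OF DERIV_diff[OF max0_square_deriv DERIV_cmult[OF 1[of 1], of 2]] 1[of 2]]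
  show ?thesis unfolding smooth_step_def[abs_def] smooth_step'_def by simp
qed

lemma smooth_step_simps:
  "t \<le> 0 \<Longrightarrow> smooth_step t = 0" "2 \<le> t \<Longrightarrow> smooth_step t = 2"
  "t \<le> 0 \<Longrightarrow> smooth_step' t = 0" "2 \<le> t \<Longrightarrow> smooth_step' t = 0"
  "\<bar>smooth_step' t\<bar> \<le> 2"
  by (auto simp: smooth_step_def smooth_step'_def max_def power2_eq_square algebra_simps)

text \<open>The step is applied to \<open>\<tau>\<close>, a function of the square of
  \<open>f\<close>, so that the absolute value is not differentiated. Since \<open>\<tau>\<close> is
  at most 0 where \<open>\<bar>f x\<bar> \<le> l\<close> and at least 3 where
  \<open>2 * l \<le> \<bar>f x\<bar>\<close>, the new gradient lives on the strip in
  between.\<close>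

lemma C1_truncation:
  fixes f :: "'a::euclidean_space \<Rightarrow> real"
  assumes f: "C1_compact f g" and l: "l > 0" and p: "0 < p"
  obtains fl gl where "C1_compact fl gl" "\<And>x. 2 * l \<le> \<bar>f x\<bar> \<Longrightarrow> 1 \<le> \<bar>fl x\<bar>"
    "\<And>x. norm (gl x) powr p \<le> (8 / l) powr p * (norm (g x) powr p * indicator {x. l < \<bar>f x\<bar> \<and> \<bar>f x\<bar> < 2 * l} x)"
proof
  define \<tau> where "\<tau> x = (f x)\<^sup>2 / l\<^sup>2 - 1" for x
  define fl where "fl x = smooth_step (\<tau> x)" for x
  define gl where "gl x = (smooth_step' (\<tau> x) * (2 * f x / l\<^sup>2)) *\<^sub>R g x" for x
  note c = C1_compactD[OF f]
  have f0: "fl x = 0" if "f x = 0" for x using that by (simp add: fl_def \<tau>_def smooth_step_simps)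
  show "C1_compact fl gl" unfolding C1_compact_def
  proof safe
    fix x
    have "(\<tau> has_derivative (\<lambda>h. (2 * f x / l\<^sup>2) * (g x \<bullet> h))) (at x)"
    proof -
      have "((\<lambda>x. (1 / l\<^sup>2) * (f x)\<^sup>2 - 1) has_derivative (\<lambda>h. (2 * f x / l\<^sup>2) * (g x \<bullet> h))) (at x)"
      proof -
        have "((\<lambda>x. (f x)\<^sup>2) has_derivative (\<lambda>h. 2 * (g x \<bullet> h) * f x)) (at x)"
          by (auto intro!: derivative_eq_intros c(1))
        from has_derivative_diff[OF has_derivative_mult_right[OF this, of "1 / l\<^sup>2"] has_derivative_const[of 1]]
        show ?thesis by (simp add: mult_ac)
      qed
      then show ?thesis by (simp add: \<tau>_def[abs_def])
    qed
    from has_derivative_compose[OF this smooth_step_deriv[THEN has_field_derivative_imp_has_derivative]]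
    show "(fl has_derivative (\<lambda>h. gl x \<bullet> h)) (at x)"
      by (simp add: fl_def[abs_def] gl_def mult_ac)
  next
    have "continuous_on UNIV \<tau>" unfolding \<tau>_def[abs_def] using l by (intro continuous_intros c(2)) auto
    then show "continuous_on UNIV gl" unfolding gl_def[abs_def] smooth_step'_def
      using l by (intro continuous_intros c(2,3)) auto
    show "bounded {x. fl x \<noteq> 0}"
      using f f0 unfolding C1_compact_def by (auto elim: bounded_subset)
  qed
  have big: "2 \<le> \<tau> x" if "2 * l \<le> \<bar>f x\<bar>" for x
  proof -
    have "(2 * l)\<^sup>2 \<le> \<bar>f x\<bar>\<^sup>2" using that l by (intro power_mono) auto
    then have "4 * l\<^sup>2 \<le> (f x)\<^sup>2" by (simp add: power_mult_distrib)
    then have "3 * l\<^sup>2 \<le> (f x)\<^sup>2" using zero_le_power2[of l] by linarith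
    then show ?thesis using l by (simp add: \<tau>_def field_simps)
  qed
  show "1 \<le> \<bar>fl x\<bar>" if "2 * l \<le> \<bar>f x\<bar>" for x
    using big[OF that] by (simp add: fl_def smooth_step_simps)
  show "norm (gl x) powr p \<le> (8 / l) powr p * (norm (g x) powr p * indicator {x. l < \<bar>f x\<bar> \<and> \<bar>f x\<bar> < 2 * l} x)" for x
  proof (cases "l < \<bar>f x\<bar> \<and> \<bar>f x\<bar> < 2 * l")
    case True
    \<comment> \<open>The step function contributes the slope 2, and the factor
      \<open>2 * \<bar>f x\<bar> / l\<^sup>2\<close> is at most \<open>4 / l\<close> on the
      strip.\<close>
    have "norm (gl x) \<le> 2 * (2 * (2 * l) / l\<^sup>2) * norm (g x)"
      unfolding gl_def norm_scaleR abs_mult abs_divide using True l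
      by (intro mult_right_mono mult_mono smooth_step_simps divide_right_mono; simp add: divide_right_mono)
    also have "\<dots> = 8 / l * norm (g x)" using l by (simp add: power2_eq_square)
    finally have "norm (gl x) powr p \<le> (8 / l * norm (g x)) powr p" using p by (intro powr_mono2) auto
    then show ?thesis unfolding powr_mult using True by simp
  next
    case False
    have "\<tau> x \<le> 0 \<or> 2 \<le> \<tau> x"
    proof (cases "l < \<bar>f x\<bar>")
      case True
      then show ?thesis using False big by auto
    next
      case False
      then have "\<bar>f x\<bar>\<^sup>2 \<le> l\<^sup>2" using l by (intro power_mono) auto
      then show ?thesis using l by (simp add: \<tau>_def field_simps)
    qed
    then have "gl x = 0" by (auto simp: gl_def smooth_step_simps)
    then show ?thesis by simp
  qed
qed

lemma dyadic_level:
  fixes B t :: real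
  assumes "0 < t" "t \<le> B"
  obtains j :: nat where "2 * (B / 2 ^ j) \<le> t" "t < 4 * (B / 2 ^ j)"
proof -
  define P where "P j \<longleftrightarrow> 2 * (B / 2 ^ j) \<le> t" for j :: nat
  obtain n :: nat where "2 * B / t < 2 ^ n" using real_arch_pow[of 2 "2 * B / t"] by auto
  then have "P n" using assms by (simp add: P_def field_simps)
  then have PL: "P (LEAST j. P j)" by (rule LeastI)
  define j where "j = (LEAST j. P j)"
  have "P j" using PL by (simp add: j_def)
  \<comment> \<open>\<open>t \<le> B\<close> rules out level 0, so the least level has a
    predecessor; its failure is the upper bound.\<close>
  then have "j \<noteq> 0" using assms by (intro notI) (simp add: P_def)
  then obtain i where i: "j = Suc i" using not0_implies_Suc by blast
  then have "\<not> P i" using not_less_Least[of i P] by (simp add: j_def)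
  then have "t < 4 * (B / 2 ^ j)" by (simp add: P_def i)
  with PL show ?thesis using that[of j] by (simp add: j_def P_def)
qed

text \<open>A direct integration of the weak-type bound over all levels diverges logarithmically.
  Applied to truncations, the weak-type bound for one level involves only the energy in one strip,
  and the energies of disjoint strips add up to at most the total.\<close>

lemma C1_sobolev:
  fixes p :: real
  assumes p: "1 < p" "p < real DIM('a::euclidean_space)"
    and q_def: "q = p * real DIM('a) / (real DIM('a) - p)"
  obtains C where "C > 0"
    "\<And>(f :: 'a \<Rightarrow> real) g. C1_compact f g \<Longrightarrow>
      (LINT x|lborel. \<bar>f x\<bar> powr q) \<le> C * (LINT x|lborel. norm (g x) powr p) powr (q / p)"
proof -
  obtain C where C: "C > 0"
    "\<And>(f :: 'a \<Rightarrow> real) g G lam. C1_compact f g \<Longrightarrow> G > 0 \<Longrightarrow> Lp_energy p g \<le> ennreal G \<Longrightarrow> lam > 0 \<Longrightarrow>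
      emeasure lborel {x. lam \<le> \<bar>f x\<bar>} \<le> ennreal (C * lam powr (- q) * G powr (q / p))"
    using C1_weak_type[OF p q_def] by metis
  have q: "q \<ge> p" "q > 0" using p by (auto simp: q_def field_simps)
  \<comment> \<open>\<open>C\<close> was obtained for positive \<open>G\<close>; the limit from the
    right includes \<open>G = 0\<close>, as for truncations with zero gradient.\<close>
  have weak1: "emeasure lborel {x. 1 \<le> \<bar>f x\<bar>} \<le> ennreal (C * G powr (q / p))"
    if f: "C1_compact f g" and G: "G \<ge> 0" "Lp_energy p g \<le> ennreal G" for f :: "'a \<Rightarrow> real" and g G
  proof (rule tendsto_lowerbound)
    have "((\<lambda>e. C * (G + e) powr (q / p)) \<longlongrightarrow> C * (G + 0) powr (q / p)) (at_right 0)"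
      using p q G by (intro tendsto_intros tendsto_powr2)
        (auto simp: eventually_at_right_less eventually_at_filter)
    then show "((\<lambda>e. ennreal (C * (G + e) powr (q / p))) \<longlongrightarrow> ennreal (C * G powr (q / p))) (at_right 0)"
      by (intro tendsto_ennrealI) simp
    have "emeasure lborel {x. 1 \<le> \<bar>f x\<bar>} \<le> ennreal (C * (G + e) powr (q / p))" if "e > 0" for e
      using C(2)[OF f, of "G + e" 1] G that order_trans[OF G(2) ennreal_leI[of G "G + e"]] by simp
    then show "\<forall>\<^sub>F e in at_right 0. emeasure lborel {x. 1 \<le> \<bar>f x\<bar>} \<le> ennreal (C * (G + e) powr (q / p))"
      by (auto simp: eventually_at_right_less eventually_at_filter)
  qed auto
  show ?thesis
  proof (rule that[of "C * 32 powr q"])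
    show "C * 32 powr q > 0" using C by simp
    fix f :: "'a \<Rightarrow> real" and g
    assume f: "C1_compact f g"
    note [measurable] = C1_compactD(4,5)[OF f]
    define G where "G = (LINT x|lborel. norm (g x) powr p)"
    have G: "G \<ge> 0" by (simp add: G_def)
    have cG: "Lp_energy p g = ennreal G" unfolding Lp_energy_def G_def
      using C1_compact_integrable(4)[OF f] p by (intro nn_integral_eq_integral) auto
    obtain R where R: "\<And>x. norm x > R \<Longrightarrow> f x = 0" using C1_compact_support[OF f] by metis
    have "bounded (f ` cball 0 R)"
      by (intro compact_imp_bounded compact_continuous_image continuous_on_subset[OF C1_compactD(2)[OF f]]) auto
    then obtain B where B: "B > 0" "\<And>x. x \<in> cball 0 R \<Longrightarrow> \<bar>f x\<bar> \<le> B"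
      unfolding bounded_pos by (auto simp: image_iff)
    have fB: "\<bar>f x\<bar> \<le> B" for x using R[of x] B(2)[of x] B(1) by (cases "norm x > R") auto
    define l where "l j = B / 2 ^ j" for j :: nat
    have l: "l j > 0" for j using B by (simp add: l_def)
    define A where "A j = {x. l j < \<bar>f x\<bar> \<and> \<bar>f x\<bar> < 2 * l j}" for j
    have A [measurable]: "A j \<in> sets borel" for j unfolding A_def by measurable
    define m where "m j = (\<integral>\<^sup>+x\<in>A j. ennreal (norm (g x) powr p) \<partial>lborel)" for j
    have mG: "m j \<le> ennreal G" for j
      unfolding m_def cG[symmetric] Lp_energy_def by (intro nn_integral_mono) (auto split: split_indicator)
    have "disjoint_family A"
    proof -
      have "A i \<inter> A j = {}" if "i < j" for i j
      proof -
        have "(2::real) ^ Suc i \<le> 2 ^ j" using that by (intro power_increasing) auto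
        then have "2 * l j \<le> l i" using B by (simp add: l_def field_simps)
        then show ?thesis by (auto simp: A_def)
      qed
      then show ?thesis unfolding disjoint_family_on_def by (metis Int_commute linorder_neqE_nat)
    qed
    then have "(\<Sum>j. m j) = (\<integral>\<^sup>+x\<in>(\<Union>j. A j). ennreal (norm (g x) powr p) \<partial>lborel)"
      unfolding m_def by (intro nn_integral_disjoint_family[symmetric]) auto
    also have "\<dots> \<le> ennreal G"
      unfolding cG[symmetric] Lp_energy_def by (intro nn_integral_mono) (auto split: split_indicator)
    finally have sum_m: "(\<Sum>j. m j) \<le> ennreal G" .
    have level: "emeasure lborel {x. 2 * l j \<le> \<bar>f x\<bar>} \<le> ennreal (C * (8 / l j) powr q * G powr (q / p - 1)) * m j" for j
    proof -
      obtain fl gl where fl: "C1_compact fl gl" "\<And>x. 2 * l j \<le> \<bar>f x\<bar> \<Longrightarrow> 1 \<le> \<bar>fl x\<bar>"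
        "\<And>x. norm (gl x) powr p \<le> (8 / l j) powr p * (norm (g x) powr p * indicator (A j) x)"
        using C1_truncation[OF f l, of p j] p unfolding A_def by auto
      note [measurable] = C1_compactD(4,5)[OF fl(1)]
      obtain m' where m': "m j = ennreal m'" "m' \<ge> 0" "m' \<le> G"
        using mG[of j] G by (cases "m j") (auto simp: top_unique)
      have "Lp_energy p gl \<le> (\<integral>\<^sup>+x. ennreal ((8 / l j) powr p) * (ennreal (norm (g x) powr p) * indicator (A j) x) \<partial>lborel)"
        unfolding Lp_energy_def
      proof (intro nn_integral_mono)
        fix x
        show "ennreal (norm (gl x) powr p) \<le> ennreal ((8 / l j) powr p) * (ennreal (norm (g x) powr p) * indicator (A j) x)"
          using ennreal_leI[OF fl(3)[of x]] by (cases "x \<in> A j") (auto simp: ennreal_mult)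
      qed
      also have "\<dots> = ennreal ((8 / l j) powr p) * m j" unfolding m_def by (intro nn_integral_cmult) measurable
      also have "\<dots> = ennreal ((8 / l j) powr p * m')" using m' by (simp add: ennreal_mult)
      finally have cg: "Lp_energy p gl \<le> ennreal ((8 / l j) powr p * m')" .
      have "emeasure lborel {x. 2 * l j \<le> \<bar>f x\<bar>} \<le> emeasure lborel {x. 1 \<le> \<bar>fl x\<bar>}"
        using fl(2) by (intro emeasure_mono) auto
      also have "\<dots> \<le> ennreal (C * ((8 / l j) powr p * m') powr (q / p))"
        using m' by (intro weak1[OF fl(1) _ cg]) auto
      also have "\<dots> \<le> ennreal (C * (8 / l j) powr q * G powr (q / p - 1) * m')"
      proof (intro ennreal_leI)
        \<comment> \<open>As \<open>q \<ge> p\<close>, all but one factor \<open>m'\<close> can be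
          estimated by the total energy. The remaining linear factor is what can be summed over the
          strips.\<close>
        have "m' powr (q / p) \<le> G powr (q / p - 1) * m'"
        proof (cases "m' = 0")
          case False
          have "m' powr (q / p) = m' powr (q / p - 1) * m'" using False m' by (simp add: powr_diff)
          also have "\<dots> \<le> G powr (q / p - 1) * m'"
            using m' p q by (intro mult_right_mono powr_mono2) (auto simp: field_simps)
          finally show ?thesis .
        qed simp
        then have "C * (8 / l j) powr q * m' powr (q / p) \<le> C * (8 / l j) powr q * (G powr (q / p - 1) * m')"
          using C by (intro mult_left_mono) auto
        then show "C * ((8 / l j) powr p * m') powr (q / p) \<le> C * (8 / l j) powr q * G powr (q / p - 1) * m'"
          using p l[of j] m' by (simp add: powr_mult powr_powr mult.assoc)
      qed
      also have "\<dots> = ennreal (C * (8 / l j) powr q * G powr (q / p - 1)) * m j"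
        using m' C by (simp add: ennreal_mult)
      finally show ?thesis .
    qed
    have "(\<integral>\<^sup>+x. ennreal (\<bar>f x\<bar> powr q) \<partial>lborel) \<le> (\<integral>\<^sup>+x. (\<Sum>j. ennreal ((4 * l j) powr q) * indicator {x. 2 * l j \<le> \<bar>f x\<bar>} x) \<partial>lborel)"
    proof (intro nn_integral_mono)
      fix x
      show "ennreal (\<bar>f x\<bar> powr q) \<le> (\<Sum>j. ennreal ((4 * l j) powr q) * indicator {x. 2 * l j \<le> \<bar>f x\<bar>} x)"
      proof (cases "f x = 0")
        case False
        then obtain j where j: "2 * l j \<le> \<bar>f x\<bar>" "\<bar>f x\<bar> < 4 * l j"
          using dyadic_level[of "\<bar>f x\<bar>" B] fB[of x] unfolding l_def by (metis zero_less_abs_iff)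
        have "ennreal (\<bar>f x\<bar> powr q) \<le> ennreal ((4 * l j) powr q)"
          using j q by (intro ennreal_leI powr_mono2) auto
        also have "\<dots> = (\<Sum>j\<in>{j}. ennreal ((4 * l j) powr q) * indicator {x. 2 * l j \<le> \<bar>f x\<bar>} x)"
          using j by simp
        also have "\<dots> \<le> (\<Sum>j. ennreal ((4 * l j) powr q) * indicator {x. 2 * l j \<le> \<bar>f x\<bar>} x)"
          by (intro sum_le_suminf) auto
        finally show ?thesis .
      qed simp
    qed
    also have "\<dots> = (\<Sum>j. \<integral>\<^sup>+x. ennreal ((4 * l j) powr q) * indicator {x. 2 * l j \<le> \<bar>f x\<bar>} x \<partial>lborel)"
      by (intro nn_integral_suminf) measurable
    also have "\<dots> = (\<Sum>j. ennreal ((4 * l j) powr q) * emeasure lborel {x. 2 * l j \<le> \<bar>f x\<bar>})"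
      by (intro suminf_cong nn_integral_cmult_indicator) measurable
    also have "\<dots> \<le> (\<Sum>j. ennreal (C * 32 powr q * G powr (q / p - 1)) * m j)"
    proof (intro suminf_le)
      fix j
      have "ennreal ((4 * l j) powr q) * emeasure lborel {x. 2 * l j \<le> \<bar>f x\<bar>}
        \<le> ennreal ((4 * l j) powr q) * (ennreal (C * (8 / l j) powr q * G powr (q / p - 1)) * m j)"
        by (intro mult_left_mono level) auto
      also have "\<dots> = ennreal ((4 * l j) powr q * (C * (8 / l j) powr q * G powr (q / p - 1))) * m j"
        using C by (subst ennreal_mult[of "(4 * l j) powr q"]) (auto simp: mult.assoc)
      \<comment> \<open>The upper end \<open>4 * l j\<close> of the level meets the gradient factor
        \<open>8 / l j\<close> of the truncation; the level drops out, and 32 remains.\<close>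
      also have "(4 * l j) powr q * (C * (8 / l j) powr q * G powr (q / p - 1)) = C * ((4 * l j) * (8 / l j)) powr q * G powr (q / p - 1)"
        using l[of j] by (simp only: powr_mult) (simp add: mult_ac)
      also have "(4 * l j) * (8 / l j) = 32" using l[of j] by simp
      finally show "ennreal ((4 * l j) powr q) * emeasure lborel {x. 2 * l j \<le> \<bar>f x\<bar>}
        \<le> ennreal (C * 32 powr q * G powr (q / p - 1)) * m j" .
    qed auto
    also have "\<dots> = ennreal (C * 32 powr q * G powr (q / p - 1)) * (\<Sum>j. m j)" by simp
    also have "\<dots> \<le> ennreal (C * 32 powr q * G powr (q / p - 1)) * ennreal G"
      by (intro mult_left_mono sum_m) auto
    also have "\<dots> = ennreal (C * 32 powr q * G powr (q / p))"
    proof -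
      have "G powr (q / p - 1) * G = G powr (q / p)" using G by (cases "G = 0") (auto simp: powr_diff)
      then show ?thesis using G C by (simp add: mult.assoc flip: ennreal_mult)
    qed
    finally have "(\<integral>\<^sup>+x. ennreal (\<bar>f x\<bar> powr q) \<partial>lborel) \<le> ennreal (C * 32 powr q * G powr (q / p))" .
    moreover have "(\<integral>\<^sup>+x. ennreal (\<bar>f x\<bar> powr q) \<partial>lborel) = ennreal (LINT x|lborel. \<bar>f x\<bar> powr q)"
      using C1_compact_integrable(3)[OF f] q by (intro nn_integral_eq_integral) auto
    ultimately show "(LINT x|lborel. \<bar>f x\<bar> powr q) \<le> C * 32 powr q * (LINT x|lborel. norm (g x) powr p) powr (q / p)"
      using C by (simp add: G_def)
  qed
qed

section \<open>Test functions and the fundamental lemma of the calculus of variations\<close>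

lemma C_k_SucI:
  assumes "\<And>x. (f has_derivative f' x) (at x)" "\<And>i. i \<in> Basis \<Longrightarrow> C_k k (\<lambda>x. f' x i)"
  shows "C_k (Suc k) f"
proof -
  have "frechet_derivative f (at x) = f' x" for x
    using frechet_derivative_at[OF assms(1)] by simp
  then show ?thesis using assms by (auto simp: differentiable_def)
qed

lemma C_k_Suc_derivative:
  "C_k (Suc k) f \<Longrightarrow> (f has_derivative frechet_derivative f (at x)) (at x)"
  by (simp add: frechet_derivative_works)

lemma C_k_SucD: "C_k (Suc k) f \<Longrightarrow> C_k k f"
proof (induction k arbitrary: f)
  case 0
  then show ?case by (auto intro!: continuous_at_imp_continuous_on differentiable_imp_continuous_within)
next
  case (Suc k)
  then have "C_k k (\<lambda>x. frechet_derivative f (at x) i)" if "i \<in> Basis" for i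
    using that Suc.IH by (metis C_k.simps(2))
  then show ?case using Suc.prems by simp
qed

lemma C_k_const: "C_k k (\<lambda>x. c)"
proof (induction k arbitrary: c)
  case (Suc k)
  show ?case by (rule C_k_SucI[where f'="\<lambda>x h. 0"]) (auto intro: Suc)
qed simp

lemma C_k_add: "C_k k f \<Longrightarrow> C_k k g \<Longrightarrow> C_k k (\<lambda>x. f x + g x)"
proof (induction k arbitrary: f g)
  case (Suc k)
  show ?case
    by (rule C_k_SucI[OF has_derivative_add[OF C_k_Suc_derivative[OF Suc.prems(1)] C_k_Suc_derivative[OF Suc.prems(2)]]])
       (use Suc in auto)
qed (auto intro: continuous_on_add)

lemma C_k_mult: "C_k k f \<Longrightarrow> C_k k g \<Longrightarrow> C_k k (\<lambda>x. f x * g x)"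
proof (induction k arbitrary: f g)
  case (Suc k)
  show ?case
  proof (rule C_k_SucI[OF has_derivative_mult[OF C_k_Suc_derivative[OF Suc.prems(1)] C_k_Suc_derivative[OF Suc.prems(2)]]])
    fix i :: 'a assume "i \<in> Basis"
    then show "C_k k (\<lambda>x. f x * frechet_derivative g (at x) i + frechet_derivative f (at x) i * g x)"
      using Suc C_k_SucD by (intro C_k_add Suc.IH) auto
  qed
qed (auto intro: continuous_on_mult)

lemma C_k_prod: "finite A \<Longrightarrow> (\<And>i. i \<in> A \<Longrightarrow> C_k k (f i)) \<Longrightarrow> C_k k (\<lambda>x. \<Prod>i\<in>A. f i x)"
  by (induction A rule: finite_induct) (auto intro: C_k_const C_k_mult)

text \<open>\<open>flat 0\<close> is the classical smooth function that vanishes to infinite order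
  at 0. The powers of \<open>1 / t\<close> close the family under differentiation up to linear
  combinations, so a single induction gives smoothness of every member.\<close>

definition flat :: "nat \<Rightarrow> real \<Rightarrow> real" where
  "flat n t = (if t > 0 then (1 / t) ^ n * exp (- (1 / t)) else 0)"

lemma flat_tendsto_0: "(flat n \<longlongrightarrow> 0) (at 0)"
proof (rule filterlim_split_at)
  have "((\<lambda>y. y ^ n / exp y) \<longlongrightarrow> 0) (at_top :: real filter)" by (rule tendsto_power_div_exp_0)
  then have "((\<lambda>t. inverse t ^ n / exp (inverse t)) \<longlongrightarrow> 0) (at_right (0::real))"
    by (rule filterlim_compose[OF _ filterlim_inverse_at_top_right])
  then show "(flat n \<longlongrightarrow> 0) (at_right 0)"
  proof (rule Lim_transform_eventually)
    show "\<forall>\<^sub>F t in at_right 0. inverse t ^ n / exp (inverse t) = flat n t"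
      by (auto simp: flat_def eventually_at_filter exp_minus divide_inverse)
  qed
  show "(flat n \<longlongrightarrow> 0) (at_left 0)"
    by (rule Lim_transform_eventually[OF tendsto_const]) (auto simp: flat_def eventually_at_filter)
qed

lemma flat_deriv: "(flat n has_real_derivative (flat (n + 2) t - real n * flat (n + 1) t)) (at t)"
proof -
  consider "t > 0" | "t < 0" | "t = 0" by linarith
  then show ?thesis
  proof cases
    case 1
    show ?thesis
    proof (rule has_field_derivative_transform_within_open)
      show "open {0::real<..}" "t \<in> {0<..}" using 1 by auto
      have n: "real n * (1 / t) ^ (n - 1) / t\<^sup>2 = real n * (1 / t) ^ (n + 1)"
        using 1 by (cases n) (auto simp: power2_eq_square field_simps)
      have "((\<lambda>t. (1 / t) ^ n * exp (- (1 / t))) has_real_derivative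
          real n * (1 / t) ^ (n - 1) * (- (1 / t\<^sup>2)) * exp (- (1 / t)) + (1 / t) ^ n * (exp (- (1 / t)) * (1 / t\<^sup>2))) (at t)"
        using 1 by (auto intro!: derivative_eq_intros simp: power2_eq_square)
      also have "real n * (1 / t) ^ (n - 1) * (- (1 / t\<^sup>2)) * exp (- (1 / t)) + (1 / t) ^ n * (exp (- (1 / t)) * (1 / t\<^sup>2))
        = flat (n + 2) t - real n * flat (n + 1) t"
        using 1 arg_cong[OF n, of "\<lambda>y. y * exp (- (1 / t))"] by (simp add: flat_def power2_eq_square)
      finally show "((\<lambda>t. (1 / t) ^ n * exp (- (1 / t))) has_real_derivative
        (flat (n + 2) t - real n * flat (n + 1) t)) (at t)" .
    qed (auto simp: flat_def)
  next
    case 2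
    show ?thesis
    proof (rule has_field_derivative_transform_within_open)
      show "open {..<0::real}" "t \<in> {..<0}" using 2 by auto
      show "((\<lambda>t. 0) has_real_derivative (flat (n + 2) t - real n * flat (n + 1) t)) (at t)"
        using 2 by (simp add: flat_def)
    qed (auto simp: flat_def)
  next
    case 3
    \<comment> \<open>The difference quotient at 0 is \<open>flat (Suc n)\<close>, whose limit is
      already known.\<close>
    have "((\<lambda>h. flat n h / h) \<longlongrightarrow> 0) (at 0)"
      by (rule Lim_transform_eventually[OF flat_tendsto_0[of "Suc n"]])
         (auto simp: flat_def eventually_at_filter)
    then show ?thesis using 3 by (simp add: DERIV_def flat_def)
  qed
qed

lemma C_k_flat_affine: "C_k k (\<lambda>x. flat n (x \<bullet> v + c))"
proof (induction k arbitrary: n)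
  case 0
  have "continuous_on UNIV (flat n)"
    by (intro continuous_at_imp_continuous_on ballI DERIV_isCont[OF flat_deriv])
  then show ?case by (auto intro!: continuous_on_compose2[where f="\<lambda>x. x \<bullet> v + c"] continuous_intros)
next
  case (Suc k)
  let ?f' = "\<lambda>x h. (flat (n + 2) (x \<bullet> v + c) - real n * flat (n + 1) (x \<bullet> v + c)) * (h \<bullet> v)"
  show ?case
  proof (rule C_k_SucI[where f'="?f'"])
    fix x :: 'a
    have "((\<lambda>x. x \<bullet> v + c) has_derivative (\<lambda>h. h \<bullet> v)) (at x)" by (auto intro!: derivative_eq_intros)
    from has_derivative_compose[OF this flat_deriv[THEN has_field_derivative_imp_has_derivative]]
    show "((\<lambda>x. flat n (x \<bullet> v + c)) has_derivative ?f' x) (at x)" .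
  next
    fix i :: 'a
    have "C_k k (\<lambda>x. (flat (n + 2) (x \<bullet> v + c) + (- real n) * flat (n + 1) (x \<bullet> v + c)) * (i \<bullet> v))"
      by (intro C_k_mult C_k_add C_k_const Suc)
    then show "C_k k (\<lambda>x. ?f' x i)" by simp
  qed
qed

text \<open>For \<open>m > 0\<close> this is positive exactly on \<open>box a b\<close>, and it
  tends to the indicator of that box as \<open>m\<close> grows. The factors are written with inner
  products to match \<open>C_k_flat_affine\<close>.\<close>

definition bump :: "real \<Rightarrow> 'a::euclidean_space \<Rightarrow> 'a \<Rightarrow> 'a \<Rightarrow> real" where
  "bump m a b x = (\<Prod>e\<in>Basis. flat 0 (x \<bullet> (m *\<^sub>R e) + - (m * (a \<bullet> e))) * flat 0 (x \<bullet> (- (m *\<^sub>R e)) + m * (b \<bullet> e)))"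

lemma flat_0_bounds: "0 \<le> flat 0 t" "flat 0 t \<le> 1"
  by (auto simp: flat_def)

lemma bump_bounds: "0 \<le> bump m a b x" "bump m a b x \<le> 1"
  unfolding bump_def by (auto intro!: prod_nonneg prod_le_1 mult_nonneg_nonneg mult_le_one flat_0_bounds)

lemma bump_outside:
  assumes "m > 0" "x \<notin> box a b"
  shows "bump m a b x = 0"
proof -
  obtain e where e: "e \<in> Basis" "x \<bullet> e \<le> a \<bullet> e \<or> b \<bullet> e \<le> x \<bullet> e"
    using assms(2) by (auto simp: mem_box not_less)
  then have "m * (x \<bullet> e) \<le> m * (a \<bullet> e) \<or> m * (b \<bullet> e) \<le> m * (x \<bullet> e)" using assms by auto
  then have "flat 0 (x \<bullet> (m *\<^sub>R e) + - (m * (a \<bullet> e))) * flat 0 (x \<bullet> (- (m *\<^sub>R e)) + m * (b \<bullet> e)) = 0"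
    by (auto simp: flat_def)
  then show ?thesis unfolding bump_def using e(1) by (auto intro!: prod_zero bexI[of _ e])
qed

lemma flat_0_tendsto:
  assumes "t > 0"
  shows "(\<lambda>n. flat 0 (real (Suc n) * t)) \<longlonglongrightarrow> 1"
proof -
  have "(\<lambda>n. exp (- (inverse (real (Suc n)) / t))) \<longlonglongrightarrow> exp (- (0 / t))"
    using assms by (intro tendsto_intros LIMSEQ_inverse_real_of_nat) auto
  moreover have "flat 0 (real (Suc n) * t) = exp (- (inverse (real (Suc n)) / t))" for n
  proof -
    have "0 < real (Suc n) * t" using assms by simp
    then have "flat 0 (real (Suc n) * t) = exp (- (1 / (real (Suc n) * t)))" by (simp only: flat_def if_True power_0 mult_1)
    also have "1 / (real (Suc n) * t) = inverse (real (Suc n)) / t" by (simp add: field_simps)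
    finally show ?thesis .
  qed
  ultimately show ?thesis by simp
qed

lemma bump_tendsto: "(\<lambda>n. bump (real (Suc n)) a b x) \<longlonglongrightarrow> indicator (box a b) x"
proof (cases "x \<in> box a b")
  case True
  have "(\<lambda>n. bump (real (Suc n)) a b x) \<longlonglongrightarrow> (\<Prod>e\<in>(Basis::'a set). 1 * 1)"
    unfolding bump_def
  proof (intro tendsto_prod tendsto_mult)
    fix e :: 'a assume "e \<in> Basis"
    then have "0 < x \<bullet> e - a \<bullet> e" "0 < b \<bullet> e - x \<bullet> e" using True by (auto simp: mem_box)
    from this[THEN flat_0_tendsto]
    show "(\<lambda>n. flat 0 (x \<bullet> (real (Suc n) *\<^sub>R e) + - (real (Suc n) * (a \<bullet> e)))) \<longlonglongrightarrow> 1"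
      "(\<lambda>n. flat 0 (x \<bullet> (- (real (Suc n) *\<^sub>R e)) + real (Suc n) * (b \<bullet> e))) \<longlonglongrightarrow> 1"
      by (simp_all add: algebra_simps)
  qed
  then show ?thesis using True by simp
next
  case False
  then show ?thesis by (simp add: bump_outside)
qed

lemma bump_test_function:
  assumes m: "m > 0" and ab: "cbox a b \<subseteq> \<Omega>"
  shows "bump m a b \<in> test_functions \<Omega>"
proof -
  have "smooth (bump m a b)"
    unfolding smooth_def bump_def[abs_def] by (intro allI C_k_prod C_k_mult C_k_flat_affine) auto
  moreover have sub: "closure {x. bump m a b x \<noteq> 0} \<subseteq> cbox a b"
    using bump_outside[OF m] box_subset_cbox by (intro closure_minimal) (auto, blast)
  moreover have "compact (closure {x. bump m a b x \<noteq> 0})"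
    using sub bounded_subset[OF bounded_cbox sub] by (simp add: compact_eq_bounded_closed)
  ultimately show ?thesis using ab by (auto simp: test_functions_def)
qed

lemma test_functions_add:
  assumes "\<phi> \<in> test_functions \<Omega>" "\<psi> \<in> test_functions \<Omega>"
  shows "(\<lambda>x. \<phi> x + \<psi> x) \<in> test_functions \<Omega>"
proof -
  have sub: "closure {x. \<phi> x + \<psi> x \<noteq> 0} \<subseteq> closure {x. \<phi> x \<noteq> 0} \<union> closure {x. \<psi> x \<noteq> 0}"
    using closure_subset[of "{x. \<phi> x \<noteq> 0}"] closure_subset[of "{x. \<psi> x \<noteq> 0}"]
    by (intro closure_minimal closed_Un closed_closure) force
  have "bounded (closure {x. \<phi> x + \<psi> x \<noteq> 0})"
    by (rule bounded_subset[OF _ sub]) (use assms in \<open>auto simp: test_functions_def compact_eq_bounded_closed\<close>)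
  then show ?thesis
    using assms sub unfolding test_functions_def smooth_def
    by (auto intro!: C_k_add simp: compact_eq_bounded_closed)
qed

lemma test_functions_cmult:
  assumes "\<phi> \<in> test_functions \<Omega>"
  shows "(\<lambda>x. c * \<phi> x) \<in> test_functions \<Omega>"
proof -
  have sub: "closure {x. c * \<phi> x \<noteq> 0} \<subseteq> closure {x. \<phi> x \<noteq> 0}"
    by (intro closure_mono) auto
  have "bounded (closure {x. c * \<phi> x \<noteq> 0})"
    by (rule bounded_subset[OF _ sub]) (use assms in \<open>auto simp: test_functions_def compact_eq_bounded_closed\<close>)
  then show ?thesis
    using assms sub unfolding test_functions_def smooth_def
    by (auto intro!: C_k_mult C_k_const simp: compact_eq_bounded_closed)
qed

section \<open>Test functions as compactly supported C1 functions\<close>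

definition test_grad :: "('a::euclidean_space \<Rightarrow> real) \<Rightarrow> 'a \<Rightarrow> 'a" where
  "test_grad \<phi> x = (\<Sum>i\<in>Basis. frechet_derivative \<phi> (at x) i *\<^sub>R i)"

lemma test_grad_inner: "i \<in> Basis \<Longrightarrow> test_grad \<phi> x \<bullet> i = frechet_derivative \<phi> (at x) i"
  by (simp add: test_grad_def inner_sum_left inner_Basis if_distrib sum.delta cong: if_cong)

lemma test_function_C1:
  assumes "\<phi> \<in> test_functions \<Omega>"
  shows "C1_compact \<phi> (test_grad \<phi>)"
proof -
  have C: "C_k (Suc 0) \<phi>" using assms by (auto simp: test_functions_def smooth_def)
  show ?thesis unfolding C1_compact_def
  proof safe
    fix x
    let ?D = "frechet_derivative \<phi> (at x)"
    have D: "(\<phi> has_derivative ?D) (at x)" by (rule C_k_Suc_derivative[OF C])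
    then have lin: "linear ?D" by (simp add: bounded_linear.linear has_derivative_bounded_linear)
    have "?D h = test_grad \<phi> x \<bullet> h" for h
    proof -
      have "?D h = ?D (\<Sum>i\<in>Basis. (h \<bullet> i) *\<^sub>R i)" by (simp add: euclidean_representation)
      also have "\<dots> = (\<Sum>i\<in>Basis. (h \<bullet> i) * ?D i)" by (simp add: linear_sum[OF lin] linear_cmul[OF lin])
      also have "\<dots> = test_grad \<phi> x \<bullet> h"         unfolding test_grad_def inner_sum_left by (intro sum.cong refl) (simp add: inner_commute[of h] mult.commute)
      finally show ?thesis .
    qed
    then have "?D = (\<lambda>h. test_grad \<phi> x \<bullet> h)" by (rule ext)
    with D show "(\<phi> has_derivative (\<lambda>h. test_grad \<phi> x \<bullet> h)) (at x)" by (simp only:)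
  next
    show "continuous_on UNIV (test_grad \<phi>)"
      unfolding test_grad_def using C by (intro continuous_intros) simp
    show "bounded {x. \<phi> x \<noteq> 0}"
      using assms by (auto simp: test_functions_def compact_eq_bounded_closed intro: bounded_subset[OF _ closure_subset])
  qed
qed

text \<open>The set may be arbitrary. With the closed support of \<open>\<phi>\<close> in the role
  of \<open>\<Omega>\<close> it shows that function and gradient vanish off a compact set.\<close>

lemma test_function_outside:
  assumes "\<phi> \<in> test_functions \<Omega>" "x \<notin> \<Omega>"
  shows "\<phi> x = 0" "test_grad \<phi> x = 0"
proof -
  have x: "x \<notin> closure {x. \<phi> x \<noteq> 0}" using assms by (auto simp: test_functions_def)
  then show "\<phi> x = 0" using closure_subset[of "{x. \<phi> x \<noteq> 0}"] by auto
  have "(\<phi> has_derivative (\<lambda>h. 0)) (at x)"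
  proof (rule has_derivative_transform_within_open)
    show "((\<lambda>x. 0) has_derivative (\<lambda>h. 0)) (at x)" by simp
    show "open (- closure {x. \<phi> x \<noteq> 0})" "x \<in> - closure {x. \<phi> x \<noteq> 0}" using x by auto
    show "0 = \<phi> y" if "y \<in> - closure {x. \<phi> x \<noteq> 0}" for y
      using that closure_subset[of "{x. \<phi> x \<noteq> 0}"] by auto
  qed
  then have "(\<lambda>h. test_grad \<phi> x \<bullet> h) = (\<lambda>h. 0)"
    by (rule has_derivative_unique[OF C1_compactD(1)[OF test_function_C1[OF assms(1)]]])
  then have "test_grad \<phi> x \<bullet> test_grad \<phi> x = 0" by (rule fun_cong)
  then show "test_grad \<phi> x = 0" by simp
qed

lemma C1_compact_mult:
  assumes f: "C1_compact f g" and h: "C1_compact h k"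
  shows "C1_compact (\<lambda>x. f x * h x) (\<lambda>x. f x *\<^sub>R k x + h x *\<^sub>R g x)"
  unfolding C1_compact_def
proof safe
  fix x
  from has_derivative_mult[OF C1_compactD(1)[OF f] C1_compactD(1)[OF h]]
  show "((\<lambda>x. f x * h x) has_derivative (\<bullet>) (f x *\<^sub>R k x + h x *\<^sub>R g x)) (at x)"
    by (rule has_derivative_eq_rhs) (auto simp: inner_simps algebra_simps)
next
  show "continuous_on UNIV (\<lambda>x. f x *\<^sub>R k x + h x *\<^sub>R g x)"
    by (intro continuous_intros C1_compactD[OF f] C1_compactD[OF h])
  show "bounded {x. f x * h x \<noteq> 0}"
    using f by (auto simp: C1_compact_def elim: bounded_subset)
qed

text \<open>The integral of every difference quotient of \<open>f\<close> is 0 by translation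
  invariance. The quotients converge to the partial derivative and are dominated because a bounded
  gradient makes \<open>f\<close> Lipschitz.\<close>

lemma C1_integral_gradient_zero:
  fixes f :: "'a::euclidean_space \<Rightarrow> real"
  assumes f: "C1_compact f g" and i: "i \<in> Basis"
  shows "(LINT x|lborel. g x \<bullet> i) = 0"
proof -
  note [measurable] = C1_compactD(4,5)[OF f]
  obtain R where R: "R > 0" "\<And>x. norm x > R \<Longrightarrow> f x = 0" "\<And>x. norm x > R \<Longrightarrow> g x = 0"
    using C1_compact_support[OF f] by metis
  have "bounded (g ` cball 0 R)"
    by (intro compact_imp_bounded compact_continuous_image continuous_on_subset[OF C1_compactD(3)[OF f]]) auto
  then obtain B where B: "B > 0" "\<And>x. x \<in> cball 0 R \<Longrightarrow> norm (g x) \<le> B"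
    unfolding bounded_pos by auto
  have gB: "norm (g x) \<le> B" for x using R(3)[of x] B(2)[of x] B(1) by (cases "norm x > R") auto
  have lip: "\<bar>f y - f x\<bar> \<le> B * norm (y - x)" for x y
  proof -
    have "norm (f y - f x) \<le> B * norm (y - x)"
    proof (rule differentiable_bound[of UNIV f "\<lambda>x h. g x \<bullet> h"])
      show "onorm (\<lambda>h. g x \<bullet> h) \<le> B" for x
      proof (rule onorm_bound)
        show "norm (g x \<bullet> h) \<le> B * norm h" for h
          using Cauchy_Schwarz_ineq2[of "g x" h] mult_right_mono[OF gB norm_ge_zero, of x h] by simp
      qed (use B in simp)
    qed (use C1_compactD(1)[OF f] in auto)
    then show ?thesis by simp
  qed
  define d where "d n x = (f (x + inverse (real (Suc n)) *\<^sub>R i) - f x) / inverse (real (Suc n))" for n x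
  have tr: "(LINT x|lborel. f (x + z)) = (LINT x|lborel. f x)" for z
  proof -
    have "(LINT x|lborel. f x) = (LINT x|distr lborel borel ((+) z). f x)" by (simp add: lborel_distr_plus)
    also have "\<dots> = (LINT x|lborel. f (z + x))" by (intro integral_distr) measurable
    finally show ?thesis by (simp add: add.commute)
  qed
  have tri: "integrable lborel (\<lambda>x. f (x + z))" for z
  proof (rule continuous_compact_support_integrable[of _ "R + norm z"])
    show "continuous_on UNIV (\<lambda>x. f (x + z))"
      by (intro continuous_on_compose2[OF C1_compactD(2)[OF f]] continuous_intros) auto
    show "f (x + z) = 0" if "norm x > R + norm z" for x
      using that norm_diff_ineq[of x z] by (intro R(2)) linarith
  qed
  have "(\<lambda>n. LINT x|lborel. d n x) \<longlonglongrightarrow> (LINT x|lborel. g x \<bullet> i)"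
  proof (rule integral_dominated_convergence)
    \<comment> \<open>The radius is enlarged by 1 since all shifts have length at most 1.\<close>
    show "integrable lborel (\<lambda>x. B * indicator (cball 0 (R + 1)) x :: real)"
      using emeasure_lborel_cball_finite[of 0 "R + 1"] by (intro integrable_mult_right integrable_real_indicator) auto
    show "AE x in lborel. (\<lambda>n. d n x) \<longlonglongrightarrow> g x \<bullet> i"
    proof (intro AE_I2)
      fix x
      have "((\<lambda>t. x + t *\<^sub>R i) has_derivative (\<lambda>t. t *\<^sub>R i)) (at 0)" by (auto intro!: derivative_eq_intros)
      from has_derivative_compose[OF this C1_compactD(1)[OF f]]
      have "((\<lambda>t. f (x + t *\<^sub>R i)) has_derivative (\<lambda>t. (g x \<bullet> i) * t)) (at 0)" by (simp add: mult.commute)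
      then have "((\<lambda>t. f (x + t *\<^sub>R i)) has_real_derivative g x \<bullet> i) (at 0)"
        by (simp add: has_field_derivative_def)
      then have "((\<lambda>t. (f (x + t *\<^sub>R i) - f x) / t) \<longlongrightarrow> g x \<bullet> i) (at 0)" by (simp add: DERIV_def)
      moreover have "filterlim (\<lambda>n. inverse (real (Suc n))) (at 0) sequentially"
        unfolding filterlim_at using LIMSEQ_inverse_real_of_nat by auto
      ultimately show "(\<lambda>n. d n x) \<longlonglongrightarrow> g x \<bullet> i"
        unfolding d_def by (rule filterlim_compose)
    qed
    show "AE x in lborel. norm (d n x) \<le> B * indicator (cball 0 (R + 1)) x" for n
    proof (intro AE_I2)
      fix x
      let ?t = "inverse (real (Suc n))"
      have t: "0 < ?t" "?t \<le> 1" by (auto simp: field_simps)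
      show "norm (d n x) \<le> B * indicator (cball 0 (R + 1)) x"
      proof (cases "x \<in> cball 0 (R + 1)")
        case True
        have "\<bar>f (x + ?t *\<^sub>R i) - f x\<bar> \<le> B * ?t" using lip[of "x + ?t *\<^sub>R i" x] t i by simp
        then have "\<bar>f (x + ?t *\<^sub>R i) - f x\<bar> / ?t \<le> B * ?t / ?t" using t by (intro divide_right_mono) auto
        moreover have "B * ?t / ?t = B" using t by (intro nonzero_mult_div_cancel_right) simp
        ultimately show ?thesis using True t unfolding d_def real_norm_def abs_divide by simp
      next
        case False
        then have nx: "norm x > R + 1" by simp
        have "norm (?t *\<^sub>R i) \<le> 1" using t i by simp
        then have "norm (x + ?t *\<^sub>R i) > R" using norm_diff_ineq[of x "?t *\<^sub>R i"] nx by linarith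
        then have "f (x + ?t *\<^sub>R i) = 0" by (rule R(2))
        moreover have "f x = 0" using nx by (intro R(2)) simp
        ultimately show ?thesis using False by (simp add: d_def)
      qed
    qed
    show "d n \<in> borel_measurable lborel" for n unfolding d_def[abs_def] by measurable
  qed measurable
  moreover have "(LINT x|lborel. d n x) = 0" for n
    unfolding d_def using tri[of "inverse (real (Suc n)) *\<^sub>R i"] tri[of 0] tr[of "inverse (real (Suc n)) *\<^sub>R i"] by simp
  ultimately show ?thesis by (simp add: LIMSEQ_const_iff)
qed

lemma C1_integration_by_parts:
  fixes f :: "'a::euclidean_space \<Rightarrow> real"
  assumes f: "C1_compact f g" and h: "C1_compact h k" and i: "i \<in> Basis"
  shows "(LINT x|lborel. f x * (k x \<bullet> i)) = - (LINT x|lborel. (g x \<bullet> i) * h x)"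
proof -
  obtain R where R: "\<And>x. norm x > R \<Longrightarrow> f x = 0" "\<And>x. norm x > R \<Longrightarrow> g x = 0"
    using C1_compact_support[OF f] by metis
  have int: "integrable lborel (\<lambda>x. f x * (k x \<bullet> i))" "integrable lborel (\<lambda>x. (g x \<bullet> i) * h x)"
    using R by (auto intro!: continuous_compact_support_integrable[of _ R] continuous_intros C1_compactD[OF f] C1_compactD[OF h])
  have "(LINT x|lborel. f x * (k x \<bullet> i) + (g x \<bullet> i) * h x) = 0"
    using C1_integral_gradient_zero[OF C1_compact_mult[OF f h] i] by (simp add: inner_simps mult.commute)
  then show ?thesis using int by simp
qed

text \<open>The Sobolev spaces use the completed measure on \<open>\<Omega>\<close>, the averages
  the Borel measure on the whole space. Extension by 0 carries test functions from one setting to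
  the other.\<close>

lemma lebesgue_on_lborel:
  fixes h :: "'a::euclidean_space \<Rightarrow> 'b::{banach, second_countable_topology}"
  assumes "open \<Omega>" "h \<in> borel_measurable borel" "\<And>x. x \<notin> \<Omega> \<Longrightarrow> h x = 0"
  shows "(LINT x|lebesgue_on \<Omega>. h x) = (LINT x|lborel. h x)"
    and "integrable (lebesgue_on \<Omega>) h \<longleftrightarrow> integrable lborel h"
proof -
  have 1: "(\<lambda>x. indicator \<Omega> x *\<^sub>R h x) = h" using assms(3) by (auto simp: indicator_def)
  have 2: "\<Omega> \<inter> space lebesgue \<in> sets lebesgue" using assms(1) by simp
  show "(LINT x|lebesgue_on \<Omega>. h x) = (LINT x|lborel. h x)"
    using integral_restrict_space[OF 2, of h] assms(2) unfolding 1 by (simp add: integral_completion)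
  show "integrable (lebesgue_on \<Omega>) h \<longleftrightarrow> integrable lborel h"
    using integrable_restrict_space[OF 2, of h] assms(2) unfolding 1 by (simp add: integrable_completion)
qed

lemma continuous_locally_integrable:
  fixes h :: "'a::euclidean_space \<Rightarrow> 'b::euclidean_space"
  assumes "continuous_on UNIV h"
  shows "locally_integrable \<Omega> h"
  unfolding locally_integrable_def
proof safe
  fix K :: "'a set" assume "compact K"
  then have "integrable lborel (\<lambda>x. indicator K x *\<^sub>R h x)"
    by (intro borel_integrable_compact continuous_on_subset[OF assms]) auto
  then show "h absolutely_integrable_on K"
    unfolding set_integrable_def by (subst integrable_completion) (auto dest: borel_measurable_integrable)
qed

lemma test_function_weak_gradient:
  assumes "open \<Omega>" "\<phi> \<in> test_functions \<Omega>"
  shows "is_weak_gradient \<Omega> \<phi> (test_grad \<phi>)"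
  unfolding is_weak_gradient_def
proof safe
  note f = test_function_C1[OF assms(2)]
  show "locally_integrable \<Omega> \<phi>" "locally_integrable \<Omega> (test_grad \<phi>)"
    by (intro continuous_locally_integrable C1_compactD[OF f])+
  fix \<psi> and i :: 'a assume \<psi>: "\<psi> \<in> test_functions \<Omega>" and i: "i \<in> Basis"
  note h = test_function_C1[OF \<psi>]
  note [measurable] = C1_compactD(4,5)[OF f] C1_compactD(4,5)[OF h]
  have "(LINT x|lebesgue_on \<Omega>. \<phi> x * (test_grad \<psi> x \<bullet> i)) = (LINT x|lborel. \<phi> x * (test_grad \<psi> x \<bullet> i))"
    using test_function_outside[OF assms(2)] by (intro lebesgue_on_lborel(1)[OF assms(1)]) auto
  moreover have "(LINT x|lebesgue_on \<Omega>. (test_grad \<phi> x \<bullet> i) * \<psi> x) = (LINT x|lborel. (test_grad \<phi> x \<bullet> i) * \<psi> x)"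
    using test_function_outside[OF assms(2)] by (intro lebesgue_on_lborel(1)[OF assms(1)]) auto
  ultimately show "(LINT x|lebesgue_on \<Omega>. \<phi> x * frechet_derivative \<psi> (at x) i) = - (LINT x|lebesgue_on \<Omega>. (test_grad \<phi> x \<bullet> i) * \<psi> x)"
    using C1_integration_by_parts[OF f h i] i by (simp add: test_grad_inner)
qed

lemma locally_integrable_mult_test:
  fixes w k :: "'a::euclidean_space \<Rightarrow> real"
  assumes \<Omega>: "open \<Omega>" and w: "locally_integrable \<Omega> w" and k: "continuous_on UNIV k"
    and K: "compact K" "K \<subseteq> \<Omega>" "\<And>x. x \<notin> K \<Longrightarrow> k x = 0"
  shows "integrable (lebesgue_on \<Omega>) (\<lambda>x. w x * k x)"
proof -
  have "(\<lambda>x. k x * w x) absolutely_integrable_on K"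
  proof (rule absolutely_integrable_bounded_measurable_product[OF bilinear_times])
    show "k \<in> borel_measurable (lebesgue_on K)"
      using k by (intro continuous_imp_measurable_on_sets_lebesgue continuous_on_subset[OF k]) (auto simp: K lmeasurable_compact fmeasurableD)
    show "K \<in> sets lebesgue" by (simp add: K lmeasurable_compact fmeasurableD)
    show "bounded (k ` K)"
      by (intro compact_imp_bounded compact_continuous_image continuous_on_subset[OF k] K) auto
    show "w absolutely_integrable_on K" using w K by (auto simp: locally_integrable_def)
  qed
  then have "integrable lebesgue (\<lambda>x. indicator K x *\<^sub>R (k x * w x))" by (simp add: set_integrable_def)
  also have "(\<lambda>x. indicator K x *\<^sub>R (k x * w x)) = (\<lambda>x. indicator \<Omega> x *\<^sub>R (w x * k x))"
    using K by (auto simp: indicator_def fun_eq_iff)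
  finally show ?thesis using \<Omega> by (subst integrable_restrict_space) auto
qed

text \<open>A Borel representative \<open>k\<close> of \<open>h\<close> is compared with 0 on all
  Borel sets: the open boxes generate them and are stable under intersection, so Dynkin's induction
  applies.\<close>

lemma integral_boxes_zero_AE:
  fixes h :: "'a::euclidean_space \<Rightarrow> real"
  assumes h: "integrable lebesgue h" and z: "\<And>a b. (LINT x:box a b|lebesgue. h x) = 0"
  shows "AE x in lebesgue. h x = 0"
proof -
  obtain k where k [measurable]: "k \<in> borel_measurable lborel" and hk: "AE x in lborel. h x = k x"
    using completion_ex_borel_measurable_real[OF borel_measurable_integrable[OF h]] by auto
  have hk': "AE x in lebesgue. h x = k x" using hk by (rule AE_completion)
  have mk: "k \<in> borel_measurable lebesgue" by (intro measurable_completion) simp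
  have "integrable lebesgue k"
    using integrable_cong_AE[OF borel_measurable_integrable[OF h] mk hk'] h by simp
  then have ik: "integrable lborel k" by (simp add: integrable_completion)
  have sk: "set_integrable lborel A k" if "A \<in> sets borel" for A
    using that ik unfolding set_integrable_def by (intro integrable_mult_indicator) auto
  have zk: "(LINT x:box a b|lborel. k x) = 0" for a b
  proof -
    have "(LINT x:box a b|lborel. k x) = (LINT x:box a b|lebesgue. k x)"
      unfolding set_lebesgue_integral_def by (subst integral_completion) auto
    also have "\<dots> = (LINT x:box a b|lebesgue. h x)"
      unfolding set_lebesgue_integral_def using h mk hk'
      by (intro integral_cong_AE borel_measurable_scaleR borel_measurable_indicator) (auto dest: borel_measurable_integrable)
    finally show ?thesis by (simp add: z)
  qed
  \<comment> \<open>The total integral, needed for complements in the induction, comes from boxes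
    that exhaust the space.\<close>
  have tot: "(LINT x:UNIV|lborel. k x) = 0"
  proof -
    let ?A = "\<lambda>n::nat. box (- (real n *\<^sub>R One)) (real n *\<^sub>R One) :: 'a set"
    have "(\<lambda>n. LINT x:?A n|lborel. k x) \<longlonglongrightarrow> (LINT x:(\<Union>n. ?A n)|lborel. k x)"
    proof (rule set_integral_cont_up)
      show "incseq ?A" by (auto simp: incseq_def mem_box inner_Basis) (smt (verit) of_nat_mono)+
    qed (auto intro: sk)
    then show ?thesis unfolding UN_box_eq_UNIV zk by (simp add: LIMSEQ_const_iff)
  qed
  have all: "(LINT x:A|lborel. k x) = 0" if "A \<in> sigma_sets UNIV (range (\<lambda>(a, b). box a b :: 'a set))" for A
  proof -
    have "Int_stable (range (\<lambda>(a, b). box a b :: 'a set))" "range (\<lambda>(a, b). box a b :: 'a set) \<subseteq> Pow UNIV"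
      by (auto simp: Int_stable_def box_Int_box)
    from this that show ?thesis
    proof (induction rule: sigma_sets_induct_disjoint)
      case (compl A)
      then have A: "A \<in> sets borel" unfolding borel_eq_box by simp
      have "(LINT x:UNIV|lborel. k x) = (LINT x:A \<union> (UNIV - A)|lborel. k x)" by (simp add: Un_absorb1)
      also have "\<dots> = (LINT x:A|lborel. k x) + (LINT x:UNIV - A|lborel. k x)"
        using A by (intro set_integral_Un sk) auto
      finally show ?case using compl tot by simp
    next
      case (union A)
      have A: "A n \<in> sets borel" for n using union(2) unfolding borel_eq_box by auto
      have "(LINT x:(\<Union>n. A n)|lborel. k x) = (\<Sum>n. LINT x:A n|lborel. k x)"
        using A union(1) by (intro lebesgue_integral_countable_add sk) (auto simp: disjoint_family_on_def)
      then show ?case using union(3) by simp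
    next
      case (basic A)
      then show ?case using zk by auto
    qed (simp add: set_lebesgue_integral_def)
  qed
  have "AE x in lborel. k x = 0"
  proof (rule density_unique_real)
    show "integrable lborel k" by (rule ik)
    show "integrable lborel (\<lambda>x. 0)" by simp
    fix A :: "'a set" assume "A \<in> sets lborel"
    then have "A \<in> sigma_sets UNIV (range (\<lambda>(a, b). box a b :: 'a set))" by (simp add: borel_eq_box)
    then show "(LINT x:A|lborel. k x) = (LINT x:A|lborel. 0)" by (simp add: all)
  qed
  with hk have "AE x in lborel. h x = 0" by eventually_elim simp
  then show ?thesis by (rule AE_completion)
qed

text \<open>Bumps approximate the indicator of a box, so by dominated convergence the integrals over
  small boxes vanish. This settles closed boxes inside \<open>\<Omega>\<close>, and countably many
  of those cover \<open>\<Omega>\<close>.\<close>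

lemma du_bois_reymond:
  fixes k :: "'a::euclidean_space \<Rightarrow> real"
  assumes \<Omega>: "open \<Omega>" and k: "locally_integrable \<Omega> k"
    and z: "\<And>\<phi>. \<phi> \<in> test_functions \<Omega> \<Longrightarrow> (LINT x|lebesgue_on \<Omega>. k x * \<phi> x) = 0"
  shows "AE x in lebesgue_on \<Omega>. k x = 0"
proof -
  have local: "AE x in lebesgue. indicator (cbox c d) x *\<^sub>R k x = 0" if cd: "cbox c d \<subseteq> \<Omega>" for c d :: 'a
  proof -
    define K where "K x = indicator (cbox c d) x *\<^sub>R k x" for x
    have "AE x in lebesgue. K x = 0"
    proof (rule integral_boxes_zero_AE)
      show int: "integrable lebesgue K"
        using k cd by (simp add: K_def[abs_def] locally_integrable_def set_integrable_def)
      have [measurable]: "K \<in> borel_measurable lebesgue" using int by (rule borel_measurable_integrable)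
      fix a b :: 'a
      \<comment> \<open>The corners of the intersection with \<open>box c d\<close>: a bump for an
        arbitrary box \<open>box a b\<close> need not be supported in
        \<open>\<Omega>\<close>.\<close>
      define a' b' where "a' = (\<Sum>i\<in>Basis. max (a \<bullet> i) (c \<bullet> i) *\<^sub>R i)" and "b' = (\<Sum>i\<in>Basis. min (b \<bullet> i) (d \<bullet> i) *\<^sub>R i)"
      have box: "box a b \<inter> box c d = box a' b'" by (simp add: a'_def b'_def box_Int_box)
      have cb: "cbox a' b' \<subseteq> cbox c d" by (auto simp: a'_def b'_def mem_box)
      have sub: "box a' b' \<subseteq> cbox c d" using box box_subset_cbox by blast
      have bm: "bump (real (Suc n)) a' b' \<in> test_functions \<Omega>" for n
        using cb cd by (intro bump_test_function) auto
      have bmeas [measurable]: "bump (real (Suc n)) a' b' \<in> borel_measurable lebesgue" for n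
        using C1_compactD(4)[OF test_function_C1[OF bm]] by (intro measurable_completion) simp
      have eq: "(LINT x|lebesgue. K x * bump (real (Suc n)) a' b' x) = 0" for n
      proof -
        have "(\<lambda>x. K x * bump (real (Suc n)) a' b' x) = (\<lambda>x. indicator \<Omega> x *\<^sub>R (k x * bump (real (Suc n)) a' b' x))"
        proof
          fix x
          show "K x * bump (real (Suc n)) a' b' x = indicator \<Omega> x *\<^sub>R (k x * bump (real (Suc n)) a' b' x)"
            using bump_outside[of "real (Suc n)" x a' b'] sub cd by (auto simp: indicator_def K_def)
        qed
        then show ?thesis using z[OF bm, of n] \<Omega> by (subst (asm) integral_restrict_space) auto
      qed
      have "(\<lambda>n. LINT x|lebesgue. K x * bump (real (Suc n)) a' b' x)
        \<longlonglongrightarrow> (LINT x|lebesgue. K x * indicator (box a' b') x)"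
      proof (rule integral_dominated_convergence[where w="\<lambda>x. norm (K x)"])
        show "integrable lebesgue (\<lambda>x. norm (K x))" using int by (rule integrable_norm)
        show "AE x in lebesgue. (\<lambda>n. K x * bump (real (Suc n)) a' b' x)
           \<longlonglongrightarrow> K x * indicator (box a' b') x"
          by (intro AE_I2 tendsto_mult tendsto_const bump_tendsto)
        show "AE x in lebesgue. norm (K x * bump (real (Suc n)) a' b' x) \<le> norm (K x)" for n
          using bump_bounds[of "real (Suc n)" a' b'] by (intro AE_I2) (simp add: abs_mult mult_left_le)
        show "(\<lambda>x. K x * bump (real (Suc n)) a' b' x) \<in> borel_measurable lebesgue" for n
          by (intro borel_measurable_times bmeas) measurable
        show "(\<lambda>x. K x * indicator (box a' b') x) \<in> borel_measurable lebesgue"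
          by (intro borel_measurable_times borel_measurable_indicator) (auto simp: lmeasurable_box fmeasurableD)
      qed
      then have lim: "(LINT x|lebesgue. K x * indicator (box a' b') x) = 0"
        unfolding eq by (simp add: LIMSEQ_const_iff)
      \<comment> \<open>\<open>K\<close> lives on the closed box, whereas the intersection is taken
        with the open one; the boundary is a null set.\<close>
      have fr: "AE x in lebesgue. x \<notin> cbox c d - box c d"
        by (rule AE_not_in) (use negligible_frontier_interval[of c d] in \<open>simp add: negligible_iff_null_sets\<close>)
      have "(LINT x:box a b|lebesgue. K x) = (LINT x|lebesgue. K x * indicator (box a' b') x)"
        unfolding set_lebesgue_integral_def
      proof (rule integral_cong_AE)
        show "AE x in lebesgue. indicator (box a b) x *\<^sub>R K x = K x * indicator (box a' b') x"
          using fr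
        proof eventually_elim
          case (elim x)
          then show ?case unfolding box[symmetric] by (auto simp: indicator_def K_def)
        qed
        show "(\<lambda>x. indicator (box a b) x *\<^sub>R K x) \<in> borel_measurable lebesgue"
          by (intro borel_measurable_scaleR borel_measurable_indicator) (auto simp: lmeasurable_box fmeasurableD)
        show "(\<lambda>x. K x * indicator (box a' b') x) \<in> borel_measurable lebesgue"
          by (intro borel_measurable_times borel_measurable_indicator) (auto simp: lmeasurable_box fmeasurableD)
      qed
      then show "(LINT x:box a b|lebesgue. K x) = 0" using lim by simp
    qed
    then show ?thesis by (simp add: K_def)
  qed
  obtain \<D> where D: "countable \<D>" "\<D> \<subseteq> Pow \<Omega>" "\<And>X. X \<in> \<D> \<Longrightarrow> \<exists>a b. X = cbox a b" "\<Union>\<D> = \<Omega>"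
    using open_countable_Union_open_cbox[OF \<Omega>] by metis
  have "AE x in lebesgue. \<forall>X\<in>\<D>. indicator X x *\<^sub>R k x = 0"
  proof (subst AE_ball_countable[OF D(1)], intro ballI)
    fix X assume X: "X \<in> \<D>"
    then obtain a b where "X = cbox a b" using D(3) by blast
    then show "AE x in lebesgue. indicator X x *\<^sub>R k x = 0" using local[of a b] X D(2) by auto
  qed
  then have "AE x in lebesgue. x \<in> \<Omega> \<longrightarrow> k x = 0"
  proof eventually_elim
    case (elim x)
    show ?case
    proof
      assume "x \<in> \<Omega>"
      then obtain X where "X \<in> \<D>" "x \<in> X" using D(4) by blast
      with elim show "k x = 0" by force
    qed
  qed
  then show ?thesis using \<Omega> by (subst AE_restrict_space_iff) auto
qed

section \<open>The space W01p\<close>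

lemma test_function_mult_integrable:
  assumes \<Omega>: "open \<Omega>" and w: "locally_integrable \<Omega> w" and \<phi>: "\<phi> \<in> test_functions \<Omega>"
  shows "integrable (lebesgue_on \<Omega>) (\<lambda>x. w x * \<phi> x)"
    and "i \<in> Basis \<Longrightarrow> integrable (lebesgue_on \<Omega>) (\<lambda>x. w x * frechet_derivative \<phi> (at x) i)"
proof -
  define K where "K = closure {x. \<phi> x \<noteq> 0}"
  have K: "compact K" "K \<subseteq> \<Omega>" and \<phi>K: "\<phi> \<in> test_functions K"
    using \<phi> by (auto simp: K_def test_functions_def)
  note f = test_function_C1[OF \<phi>]
  show "integrable (lebesgue_on \<Omega>) (\<lambda>x. w x * \<phi> x)"
    using test_function_outside[OF \<phi>K] by (intro locally_integrable_mult_test[OF \<Omega> w _ K] C1_compactD[OF f])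
  assume i: "i \<in> Basis"
  have "integrable (lebesgue_on \<Omega>) (\<lambda>x. w x * (test_grad \<phi> x \<bullet> i))"
    using test_function_outside[OF \<phi>K]
    by (intro locally_integrable_mult_test[OF \<Omega> w _ K] continuous_intros C1_compactD[OF f]) auto
  then show "integrable (lebesgue_on \<Omega>) (\<lambda>x. w x * frechet_derivative \<phi> (at x) i)"
    using i by (simp add: test_grad_inner)
qed

lemma locally_integrable_add:
  "locally_integrable \<Omega> u \<Longrightarrow> locally_integrable \<Omega> v \<Longrightarrow> locally_integrable \<Omega> (\<lambda>x. u x + v x)"
  by (auto simp: locally_integrable_def intro: set_integral_add(1))

lemma locally_integrable_scaleR:
  "locally_integrable \<Omega> u \<Longrightarrow> locally_integrable \<Omega> (\<lambda>x. c *\<^sub>R u x)"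
  by (auto simp: locally_integrable_def)

lemma locally_integrable_inner:
  "locally_integrable \<Omega> g \<Longrightarrow> locally_integrable \<Omega> (\<lambda>x. g x \<bullet> i)"
  by (auto simp: locally_integrable_def set_integrable_def inner_scaleR_left[symmetric]
      simp del: inner_scaleR_left intro: integrable_inner_left)

lemma is_weak_gradient_add:
  assumes \<Omega>: "open \<Omega>" and u: "is_weak_gradient \<Omega> u g" and v: "is_weak_gradient \<Omega> v h"
  shows "is_weak_gradient \<Omega> (\<lambda>x. u x + v x) (\<lambda>x. g x + h x)"
  unfolding is_weak_gradient_def
proof safe
  have li: "locally_integrable \<Omega> u" "locally_integrable \<Omega> g" "locally_integrable \<Omega> v" "locally_integrable \<Omega> h"
    using u v by (auto simp: is_weak_gradient_def)
  then show "locally_integrable \<Omega> (\<lambda>x. u x + v x)" "locally_integrable \<Omega> (\<lambda>x. g x + h x)"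
    by (auto intro: locally_integrable_add)
  fix \<phi> and i :: 'a assume \<phi>: "\<phi> \<in> test_functions \<Omega>" and i: "i \<in> Basis"
  note m = test_function_mult_integrable[OF \<Omega> _ \<phi>]
  show "(LINT x|lebesgue_on \<Omega>. (u x + v x) * frechet_derivative \<phi> (at x) i) = - (LINT x|lebesgue_on \<Omega>. ((g x + h x) \<bullet> i) * \<phi> x)"
    using u v \<phi> i m(1)[OF locally_integrable_inner[OF li(2)]] m(1)[OF locally_integrable_inner[OF li(4)]] m(2)[OF li(1) i] m(2)[OF li(3) i]
    by (simp add: is_weak_gradient_def distrib_right inner_add_left)
qed

lemma is_weak_gradient_cmult:
  assumes u: "is_weak_gradient \<Omega> u g"
  shows "is_weak_gradient \<Omega> (\<lambda>x. c * u x) (\<lambda>x. c *\<^sub>R g x)"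
  using u locally_integrable_scaleR[of \<Omega> u c] locally_integrable_scaleR[of \<Omega> g c]
  by (simp add: is_weak_gradient_def mult.assoc)

lemma weak_gradient_unique:
  fixes g h :: "'a::euclidean_space \<Rightarrow> 'a"
  assumes \<Omega>: "open \<Omega>" and g: "is_weak_gradient \<Omega> u g" and h: "is_weak_gradient \<Omega> u h"
  shows "AE x in lebesgue_on \<Omega>. g x = h x"
proof -
  have "AE x in lebesgue_on \<Omega>. g x \<bullet> i + (-1) *\<^sub>R (h x \<bullet> i) = 0" if i: "i \<in> Basis" for i
  proof (rule du_bois_reymond[OF \<Omega>])
    have li: "locally_integrable \<Omega> (\<lambda>x. g x \<bullet> i)" "locally_integrable \<Omega> (\<lambda>x. h x \<bullet> i)"
      using g h by (auto simp: is_weak_gradient_def intro: locally_integrable_inner)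
    then show "locally_integrable \<Omega> (\<lambda>x. g x \<bullet> i + (-1) *\<^sub>R (h x \<bullet> i))"
      by (intro locally_integrable_add locally_integrable_scaleR)
    fix \<phi> assume \<phi>: "\<phi> \<in> test_functions \<Omega>"
    have "(LINT x|lebesgue_on \<Omega>. u x * frechet_derivative \<phi> (at x) i) = - (LINT x|lebesgue_on \<Omega>. (g x \<bullet> i) * \<phi> x)"
      using g \<phi> i by (auto simp: is_weak_gradient_def)
    moreover have "(LINT x|lebesgue_on \<Omega>. u x * frechet_derivative \<phi> (at x) i) = - (LINT x|lebesgue_on \<Omega>. (h x \<bullet> i) * \<phi> x)"
      using h \<phi> i by (auto simp: is_weak_gradient_def)
    ultimately have "(LINT x|lebesgue_on \<Omega>. (g x \<bullet> i) * \<phi> x) = (LINT x|lebesgue_on \<Omega>. (h x \<bullet> i) * \<phi> x)"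
      by linarith
    then show "(LINT x|lebesgue_on \<Omega>. (g x \<bullet> i + (-1) *\<^sub>R (h x \<bullet> i)) * \<phi> x) = 0"
      using test_function_mult_integrable(1)[OF \<Omega> li(1) \<phi>] test_function_mult_integrable(1)[OF \<Omega> li(2) \<phi>]
      by (simp add: left_diff_distrib)
  qed
  then have "AE x in lebesgue_on \<Omega>. \<forall>i\<in>Basis. g x \<bullet> i + (-1) *\<^sub>R (h x \<bullet> i) = 0"
    by (intro AE_finite_allI) auto
  then show ?thesis
    by eventually_elim (auto intro: euclidean_eqI)
qed

text \<open>A consequence of the completeness of Lebesgue measure. Through
  \<open>Lp_space_AE\<close> it transfers membership in L^p to the gradient selected by
  \<open>weak_gradient\<close>.\<close>

lemma borel_measurable_lebesgue_on_AE:
  fixes f g :: "'a::euclidean_space \<Rightarrow> 'b::euclidean_space"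
  assumes \<Omega>: "open \<Omega>" and f: "f \<in> borel_measurable (lebesgue_on \<Omega>)" and ae: "AE x in lebesgue_on \<Omega>. f x = g x"
  shows "g \<in> borel_measurable (lebesgue_on \<Omega>)"
proof -
  have \<Omega>': "\<Omega> \<inter> space lebesgue \<in> sets lebesgue" using \<Omega> by simp
  have "(\<lambda>x. indicator \<Omega> x *\<^sub>R f x) \<in> borel_measurable lebesgue"
    using f borel_measurable_restrict_space_iff[OF \<Omega>', of f] by simp
  moreover have "AE x in lebesgue. indicator \<Omega> x *\<^sub>R f x = indicator \<Omega> x *\<^sub>R g x"
    using ae unfolding AE_restrict_space_iff[OF \<Omega>'] by eventually_elim (auto simp: indicator_def)
  ultimately have "(\<lambda>x. indicator \<Omega> x *\<^sub>R g x) \<in> borel_measurable lebesgue" by (rule borel_measurable_AE)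
  then show ?thesis using borel_measurable_restrict_space_iff[OF \<Omega>', of g] by simp
qed

lemma Lp_space_AE:
  assumes "open \<Omega>" "f \<in> Lp_space \<Omega> p" "AE x in lebesgue_on \<Omega>. f x = g x"
  shows "g \<in> Lp_space \<Omega> p"
proof -
  have g [measurable]: "g \<in> borel_measurable (lebesgue_on \<Omega>)"
    using assms by (intro borel_measurable_lebesgue_on_AE[OF assms(1) _ assms(3)]) (auto simp: Lp_space_def)
  have [measurable]: "f \<in> borel_measurable (lebesgue_on \<Omega>)" using assms by (auto simp: Lp_space_def)
  have "integrable (lebesgue_on \<Omega>) (\<lambda>x. norm (f x) powr p) = integrable (lebesgue_on \<Omega>) (\<lambda>x. norm (g x) powr p)"
    using assms(3) by (intro integrable_cong_AE) (auto elim: eventually_mono)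
  then show ?thesis using assms(2) g by (simp add: Lp_space_def)
qed

lemma Lp_space_add:
  assumes "f \<in> Lp_space \<Omega> p" "g \<in> Lp_space \<Omega> p" "0 \<le> p"
  shows "(\<lambda>x. f x + g x) \<in> Lp_space \<Omega> p"
proof -
  have [measurable]: "f \<in> borel_measurable (lebesgue_on \<Omega>)" "g \<in> borel_measurable (lebesgue_on \<Omega>)"
    using assms by (auto simp: Lp_space_def)
  have "integrable (lebesgue_on \<Omega>) (\<lambda>x. norm (f x + g x) powr p)"
  proof (rule Bochner_Integration.integrable_bound)
    show "integrable (lebesgue_on \<Omega>) (\<lambda>x. 2 powr p * (norm (f x) powr p + norm (g x) powr p))"
      using assms by (intro integrable_mult_right Bochner_Integration.integrable_add) (auto simp: Lp_space_def)
    show "AE x in lebesgue_on \<Omega>. norm (norm (f x + g x) powr p) \<le> norm (2 powr p * (norm (f x) powr p + norm (g x) powr p))"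
      using norm_add_powr_le[OF assms(3)] by (intro AE_I2) simp
  qed measurable
  then show ?thesis by (simp add: Lp_space_def)
qed

lemma Lp_space_scaleR:
  assumes "f \<in> Lp_space \<Omega> p"
  shows "(\<lambda>x. c *\<^sub>R f x) \<in> Lp_space \<Omega> p"
  using assms by (simp add: Lp_space_def powr_mult borel_measurable_scaleR)

text \<open>An explicit witness \<open>g\<close> is additive and homogeneous on the nose, whereas
  the choice in \<open>weak_gradient\<close> respects sums only almost everywhere.\<close>

definition W1p_grad :: "'a::euclidean_space set \<Rightarrow> real \<Rightarrow> ('a \<Rightarrow> real) \<Rightarrow> ('a \<Rightarrow> 'a) \<Rightarrow> bool" where
  "W1p_grad \<Omega> p u g \<longleftrightarrow> u \<in> Lp_space \<Omega> p \<and> g \<in> Lp_space \<Omega> p \<and> is_weak_gradient \<Omega> u g"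

lemma W1p_iff: "u \<in> W1p \<Omega> p \<longleftrightarrow> (\<exists>g. W1p_grad \<Omega> p u g)"
  by (auto simp: W1p_def W1p_grad_def)

lemma W1p_grad_weak_gradient:
  assumes "open \<Omega>" "W1p_grad \<Omega> p u g"
  shows "AE x in lebesgue_on \<Omega>. g x = weak_gradient \<Omega> u x" "W1p_grad \<Omega> p u (weak_gradient \<Omega> u)"
proof -
  have w: "is_weak_gradient \<Omega> u (weak_gradient \<Omega> u)"
    unfolding weak_gradient_def
    by (rule someI[of "is_weak_gradient \<Omega> u" g]) (use assms(2) in \<open>auto simp: W1p_grad_def\<close>)
  show ae: "AE x in lebesgue_on \<Omega>. g x = weak_gradient \<Omega> u x"
    using assms(2) by (intro weak_gradient_unique[OF assms(1) _ w]) (auto simp: W1p_grad_def)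
  show "W1p_grad \<Omega> p u (weak_gradient \<Omega> u)"
    using assms w Lp_space_AE[OF assms(1) _ ae] by (auto simp: W1p_grad_def)
qed

lemma W1p_grad_add:
  assumes "open \<Omega>" "0 \<le> p" "W1p_grad \<Omega> p u g" "W1p_grad \<Omega> p v h"
  shows "W1p_grad \<Omega> p (\<lambda>x. u x + v x) (\<lambda>x. g x + h x)"
  using assms by (auto simp: W1p_grad_def intro: Lp_space_add is_weak_gradient_add)

lemma W1p_grad_cmult:
  assumes "W1p_grad \<Omega> p u g"
  shows "W1p_grad \<Omega> p (\<lambda>x. c * u x) (\<lambda>x. c *\<^sub>R g x)"
  using assms Lp_space_scaleR[of u \<Omega> p c]
  by (auto simp: W1p_grad_def intro: Lp_space_scaleR is_weak_gradient_cmult)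

lemma W1p_grad_diff:
  assumes "open \<Omega>" "0 \<le> p" "W1p_grad \<Omega> p u g" "W1p_grad \<Omega> p v h"
  shows "W1p_grad \<Omega> p (\<lambda>x. u x - v x) (\<lambda>x. g x - h x)"
  using W1p_grad_add[OF assms(1-3) W1p_grad_cmult[OF assms(4), of "-1"]] by simp

lemma W1p_grad_test:
  assumes "open \<Omega>" "0 < p" "\<phi> \<in> test_functions \<Omega>"
  shows "W1p_grad \<Omega> p \<phi> (test_grad \<phi>)"
proof -
  note f = test_function_C1[OF assms(3)]
  note [measurable] = C1_compactD(4,5)[OF f]
  have m: "\<phi> \<in> borel_measurable (lebesgue_on \<Omega>)" "test_grad \<phi> \<in> borel_measurable (lebesgue_on \<Omega>)"
    by (auto intro!: measurable_restrict_space1 measurable_completion)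
  have "integrable (lebesgue_on \<Omega>) (\<lambda>x. norm (\<phi> x) powr p)"
    using C1_compact_integrable[OF f assms(2)] test_function_outside[OF assms(3)] assms(2)
    by (subst lebesgue_on_lborel(2)[OF assms(1)]) auto
  moreover have "integrable (lebesgue_on \<Omega>) (\<lambda>x. norm (test_grad \<phi> x) powr p)"
    using C1_compact_integrable[OF f assms(2)] test_function_outside[OF assms(3)] assms(2)
    by (subst lebesgue_on_lborel(2)[OF assms(1)]) auto
  ultimately show ?thesis
    using m test_function_weak_gradient[OF assms(1,3)] by (simp add: W1p_grad_def Lp_space_def)
qed

text \<open>The p-th power of the norm. It makes the integral estimates free of roots, and the crude
  quasi-triangle inequality \<open>Lp_int_add_le\<close> replaces Minkowski's inequality in limits
  and a priori bounds.\<close>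

definition Lp_int :: "'a::euclidean_space set \<Rightarrow> real \<Rightarrow> ('a \<Rightarrow> 'b::euclidean_space) \<Rightarrow> real" where
  "Lp_int \<Omega> p f = (LINT x|lebesgue_on \<Omega>. norm (f x) powr p)"

lemma Lp_int_nonneg [simp]: "0 \<le> Lp_int \<Omega> p f"
  by (simp add: Lp_int_def)

lemma Lp_norm_powr: "p \<noteq> 0 \<Longrightarrow> Lp_norm \<Omega> p f powr p = Lp_int \<Omega> p f"
  by (simp add: Lp_norm_def Lp_int_def[symmetric] powr_powr)

lemma Lp_int_AE:
  assumes "open \<Omega>" "f \<in> Lp_space \<Omega> p" "AE x in lebesgue_on \<Omega>. f x = g x"
  shows "Lp_int \<Omega> p f = Lp_int \<Omega> p g"
proof -
  have [measurable]: "f \<in> borel_measurable (lebesgue_on \<Omega>)" "g \<in> borel_measurable (lebesgue_on \<Omega>)"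
    using assms Lp_space_AE[OF assms] by (auto simp: Lp_space_def)
  show ?thesis unfolding Lp_int_def using assms(3)
    by (intro integral_cong_AE) (auto elim: eventually_mono)
qed

lemma Lp_int_add_le:
  assumes "f \<in> Lp_space \<Omega> p" "g \<in> Lp_space \<Omega> p" "0 \<le> p"
  shows "Lp_int \<Omega> p (\<lambda>x. f x + g x) \<le> 2 powr p * (Lp_int \<Omega> p f + Lp_int \<Omega> p g)"
proof -
  have i: "integrable (lebesgue_on \<Omega>) (\<lambda>x. norm (f x) powr p)" "integrable (lebesgue_on \<Omega>) (\<lambda>x. norm (g x) powr p)"
    "integrable (lebesgue_on \<Omega>) (\<lambda>x. norm (f x + g x) powr p)"
    using assms Lp_space_add[OF assms] by (auto simp: Lp_space_def)
  have "Lp_int \<Omega> p (\<lambda>x. f x + g x) \<le> (LINT x|lebesgue_on \<Omega>. 2 powr p * (norm (f x) powr p + norm (g x) powr p))"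
    unfolding Lp_int_def using i norm_add_powr_le[OF assms(3)]
    by (intro integral_mono integrable_mult_right Bochner_Integration.integrable_add) auto
  also have "\<dots> = 2 powr p * (Lp_int \<Omega> p f + Lp_int \<Omega> p g)" using i by (simp add: Lp_int_def)
  finally show ?thesis .
qed

lemma Lp_int_scaleR: "Lp_int \<Omega> p (\<lambda>x. c *\<^sub>R f x) = \<bar>c\<bar> powr p * Lp_int \<Omega> p f"
  by (simp add: Lp_int_def powr_mult)

lemma grad_norm_powr:
  assumes "open \<Omega>" "W1p_grad \<Omega> p u g" "p \<noteq> 0"
  shows "grad_norm \<Omega> p u powr p = Lp_int \<Omega> p g"
  unfolding grad_norm_def Lp_norm_powr[OF assms(3)]
  using Lp_int_AE[OF assms(1) _ W1p_grad_weak_gradient(1)[OF assms(1,2)]] assms(2) by (simp add: W1p_grad_def)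

lemma grad_norm_eq:
  assumes "open \<Omega>" "W1p_grad \<Omega> p u g" "p \<noteq> 0"
  shows "grad_norm \<Omega> p u = Lp_int \<Omega> p g powr (1 / p)"
  using grad_norm_powr[OF assms] assms(3) by (simp add: grad_norm_def Lp_norm_def powr_powr flip: grad_norm_powr[OF assms])

lemma W1p_norm_tendsto_iff:
  assumes \<Omega>: "open \<Omega>" and p: "0 < p" and u: "W1p_grad \<Omega> p u g" and \<phi>: "\<And>n. \<phi> n \<in> test_functions \<Omega>"
  shows "(\<lambda>n. W1p_norm \<Omega> p (\<lambda>x. \<phi> n x - u x)) \<longlonglongrightarrow> 0 \<longleftrightarrow>
    (\<lambda>n. Lp_int \<Omega> p (\<lambda>x. \<phi> n x - u x)) \<longlonglongrightarrow> 0 \<and> (\<lambda>n. Lp_int \<Omega> p (\<lambda>x. test_grad (\<phi> n) x - g x)) \<longlonglongrightarrow> 0"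
    (is "?l \<longleftrightarrow> ?A \<longlonglongrightarrow> 0 \<and> ?B \<longlonglongrightarrow> 0")
proof -
  have d: "W1p_grad \<Omega> p (\<lambda>x. \<phi> n x - u x) (\<lambda>x. test_grad (\<phi> n) x - g x)" for n
    using p by (intro W1p_grad_diff[OF \<Omega> _ W1p_grad_test[OF \<Omega> p \<phi>] u]) simp
  have eq: "W1p_norm \<Omega> p (\<lambda>x. \<phi> n x - u x) = (?A n + ?B n) powr (1 / p)" for n
    unfolding W1p_norm_def using grad_norm_powr[OF \<Omega> d] p by (simp add: Lp_norm_powr)
  show ?thesis
  proof
    assume ?l
    then have "(\<lambda>n. ((?A n + ?B n) powr (1 / p)) powr p) \<longlonglongrightarrow> 0 powr p"
      unfolding eq using p by (intro tendsto_powr2) (auto intro: always_eventually)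
    then have s: "(\<lambda>n. ?A n + ?B n) \<longlonglongrightarrow> 0" using p by (simp add: powr_powr)
    have "?A \<longlonglongrightarrow> 0" by (rule tendsto_sandwich[OF _ _ tendsto_const s]) auto
    moreover have "?B \<longlonglongrightarrow> 0" by (rule tendsto_sandwich[OF _ _ tendsto_const s]) auto
    ultimately show "?A \<longlonglongrightarrow> 0 \<and> ?B \<longlonglongrightarrow> 0" ..
  next
    assume "?A \<longlonglongrightarrow> 0 \<and> ?B \<longlonglongrightarrow> 0"
    then have "(\<lambda>n. (?A n + ?B n) powr (1 / p)) \<longlonglongrightarrow> (0 + 0) powr (1 / p)"
      using p by (intro tendsto_powr2 tendsto_add) (auto intro: always_eventually)
    then show ?l unfolding eq by simp
  qed
qed

lemma W01pE:
  assumes \<Omega>: "open \<Omega>" and p: "0 < p" and u: "u \<in> W01p \<Omega> p"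
  obtains \<phi> where "W1p_grad \<Omega> p u (weak_gradient \<Omega> u)" "\<And>n::nat. \<phi> n \<in> test_functions \<Omega>"
    "(\<lambda>n. Lp_int \<Omega> p (\<lambda>x. \<phi> n x - u x)) \<longlonglongrightarrow> 0"
    "(\<lambda>n. Lp_int \<Omega> p (\<lambda>x. test_grad (\<phi> n) x - weak_gradient \<Omega> u x)) \<longlonglongrightarrow> 0"
proof -
  obtain \<phi> where \<phi>: "\<And>n::nat. \<phi> n \<in> test_functions \<Omega>" "(\<lambda>n. W1p_norm \<Omega> p (\<lambda>x. \<phi> n x - u x)) \<longlonglongrightarrow> 0"
    using u by (auto simp: W01p_def)
  have "W1p_grad \<Omega> p u (weak_gradient \<Omega> u)"
    using u W1p_grad_weak_gradient(2)[OF \<Omega>] by (auto simp: W01p_def W1p_iff)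
  with \<phi> show ?thesis using that W1p_norm_tendsto_iff[OF \<Omega> p] by blast
qed

lemma W01pI:
  assumes \<Omega>: "open \<Omega>" and p: "0 < p" and u: "W1p_grad \<Omega> p u g" and \<phi>: "\<And>n::nat. \<phi> n \<in> test_functions \<Omega>"
    "(\<lambda>n. Lp_int \<Omega> p (\<lambda>x. \<phi> n x - u x)) \<longlonglongrightarrow> 0"
    "(\<lambda>n. Lp_int \<Omega> p (\<lambda>x. test_grad (\<phi> n) x - g x)) \<longlonglongrightarrow> 0"
  shows "u \<in> W01p \<Omega> p"
  using W1p_norm_tendsto_iff[OF \<Omega> p u, of \<phi>] \<phi> u by (auto simp: W01p_def W1p_iff)

section \<open>W01p is a linear space\<close>

lemma test_grad_add:
  assumes "\<phi> \<in> test_functions \<Omega>" "\<psi> \<in> test_functions \<Omega>"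
  shows "test_grad (\<lambda>x. \<phi> x + \<psi> x) x = test_grad \<phi> x + test_grad \<psi> x"
proof -
  have "(\<lambda>h. test_grad (\<lambda>x. \<phi> x + \<psi> x) x \<bullet> h) = (\<lambda>h. test_grad \<phi> x \<bullet> h + test_grad \<psi> x \<bullet> h)"
    by (rule has_derivative_unique[OF C1_compactD(1)[OF test_function_C1[OF test_functions_add[OF assms]]]])
       (rule has_derivative_add[OF C1_compactD(1)[OF test_function_C1[OF assms(1)]] C1_compactD(1)[OF test_function_C1[OF assms(2)]]])
  then show ?thesis
    by (metis (no_types, lifting) inner_add_left vector_eq_rdot)
qed

lemma test_grad_cmult:
  assumes "\<phi> \<in> test_functions \<Omega>"
  shows "test_grad (\<lambda>x. c * \<phi> x) x = c *\<^sub>R test_grad \<phi> x"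
proof -
  have "(\<lambda>h. test_grad (\<lambda>x. c * \<phi> x) x \<bullet> h) = (\<lambda>h. c * (test_grad \<phi> x \<bullet> h))"
    by (rule has_derivative_unique[OF C1_compactD(1)[OF test_function_C1[OF test_functions_cmult[OF assms]]]])
       (rule has_derivative_mult_right[OF C1_compactD(1)[OF test_function_C1[OF assms]]])
  then show ?thesis
    by (metis (no_types, lifting) inner_scaleR_left vector_eq_rdot)
qed

lemma W01p_test:
  assumes "open \<Omega>" "0 < p" "\<phi> \<in> test_functions \<Omega>"
  shows "\<phi> \<in> W01p \<Omega> p"
  by (rule W01pI[OF assms(1,2) W1p_grad_test[OF assms], of "\<lambda>_. \<phi>"]) (use assms in \<open>auto simp: Lp_int_def\<close>)

lemma W01p_add:
  assumes \<Omega>: "open \<Omega>" and p: "0 < p" and u: "u \<in> W01p \<Omega> p" and v: "v \<in> W01p \<Omega> p"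
  shows "(\<lambda>x. u x + v x) \<in> W01p \<Omega> p"
proof -
  obtain \<phi> where \<phi>: "W1p_grad \<Omega> p u (weak_gradient \<Omega> u)" "\<And>n::nat. \<phi> n \<in> test_functions \<Omega>"
    "(\<lambda>n. Lp_int \<Omega> p (\<lambda>x. \<phi> n x - u x)) \<longlonglongrightarrow> 0"
    "(\<lambda>n. Lp_int \<Omega> p (\<lambda>x. test_grad (\<phi> n) x - weak_gradient \<Omega> u x)) \<longlonglongrightarrow> 0"
    by (rule W01pE[OF \<Omega> p u]) (rule that)
  obtain \<psi> where \<psi>: "W1p_grad \<Omega> p v (weak_gradient \<Omega> v)" "\<And>n::nat. \<psi> n \<in> test_functions \<Omega>"
    "(\<lambda>n. Lp_int \<Omega> p (\<lambda>x. \<psi> n x - v x)) \<longlonglongrightarrow> 0"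
    "(\<lambda>n. Lp_int \<Omega> p (\<lambda>x. test_grad (\<psi> n) x - weak_gradient \<Omega> v x)) \<longlonglongrightarrow> 0"
    by (rule W01pE[OF \<Omega> p v]) (rule that)
  have d1: "W1p_grad \<Omega> p (\<lambda>x. \<phi> n x - u x) (\<lambda>x. test_grad (\<phi> n) x - weak_gradient \<Omega> u x)" for n
    using p by (intro W1p_grad_diff[OF \<Omega> _ W1p_grad_test[OF \<Omega> p \<phi>(2)] \<phi>(1)]) simp
  have d2: "W1p_grad \<Omega> p (\<lambda>x. \<psi> n x - v x) (\<lambda>x. test_grad (\<psi> n) x - weak_gradient \<Omega> v x)" for n
    using p by (intro W1p_grad_diff[OF \<Omega> _ W1p_grad_test[OF \<Omega> p \<psi>(2)] \<psi>(1)]) simp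
  show ?thesis
  proof (rule W01pI[OF \<Omega> p W1p_grad_add[OF \<Omega> _ \<phi>(1) \<psi>(1)]])
    show "(\<lambda>x. \<phi> n x + \<psi> n x) \<in> test_functions \<Omega>" for n by (intro test_functions_add \<phi> \<psi>)
    have lim: "(\<lambda>n. 2 powr p * (a n + b n)) \<longlonglongrightarrow> 0" if "a \<longlonglongrightarrow> 0" "b \<longlonglongrightarrow> 0" for a b :: "nat \<Rightarrow> real"
      using tendsto_mult[OF tendsto_const[of "2 powr p"] tendsto_add[OF that]] by simp
    have "Lp_int \<Omega> p (\<lambda>x. \<phi> n x + \<psi> n x - (u x + v x)) \<le> 2 powr p * (Lp_int \<Omega> p (\<lambda>x. \<phi> n x - u x) + Lp_int \<Omega> p (\<lambda>x. \<psi> n x - v x))" for n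
      using Lp_int_add_le[of "\<lambda>x. \<phi> n x - u x" \<Omega> p "\<lambda>x. \<psi> n x - v x"] d1 d2 p
      by (simp add: W1p_grad_def add_diff_add)
    then show "(\<lambda>n. Lp_int \<Omega> p (\<lambda>x. \<phi> n x + \<psi> n x - (u x + v x))) \<longlonglongrightarrow> 0"
      by (intro tendsto_sandwich[OF _ _ tendsto_const lim[OF \<phi>(3) \<psi>(3)]] always_eventually) auto
    have "Lp_int \<Omega> p (\<lambda>x. test_grad (\<lambda>x. \<phi> n x + \<psi> n x) x - (weak_gradient \<Omega> u x + weak_gradient \<Omega> v x))
      \<le> 2 powr p * (Lp_int \<Omega> p (\<lambda>x. test_grad (\<phi> n) x - weak_gradient \<Omega> u x) + Lp_int \<Omega> p (\<lambda>x. test_grad (\<psi> n) x - weak_gradient \<Omega> v x))" for n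
      unfolding test_grad_add[OF \<phi>(2) \<psi>(2)]
      using Lp_int_add_le[of "\<lambda>x. test_grad (\<phi> n) x - weak_gradient \<Omega> u x" \<Omega> p "\<lambda>x. test_grad (\<psi> n) x - weak_gradient \<Omega> v x"] d1 d2 p
      by (simp add: W1p_grad_def add_diff_add)
    then show "(\<lambda>n. Lp_int \<Omega> p (\<lambda>x. test_grad (\<lambda>x. \<phi> n x + \<psi> n x) x - (weak_gradient \<Omega> u x + weak_gradient \<Omega> v x))) \<longlonglongrightarrow> 0"
      by (intro tendsto_sandwich[OF _ _ tendsto_const lim[OF \<phi>(4) \<psi>(4)]] always_eventually) auto
  qed (use p in simp)
qed

lemma W01p_cmult:
  assumes \<Omega>: "open \<Omega>" and p: "0 < p" and u: "u \<in> W01p \<Omega> p"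
  shows "(\<lambda>x. c * u x) \<in> W01p \<Omega> p"
proof -
  obtain \<phi> where \<phi>: "W1p_grad \<Omega> p u (weak_gradient \<Omega> u)" "\<And>n::nat. \<phi> n \<in> test_functions \<Omega>"
    "(\<lambda>n. Lp_int \<Omega> p (\<lambda>x. \<phi> n x - u x)) \<longlonglongrightarrow> 0"
    "(\<lambda>n. Lp_int \<Omega> p (\<lambda>x. test_grad (\<phi> n) x - weak_gradient \<Omega> u x)) \<longlonglongrightarrow> 0"
    by (rule W01pE[OF \<Omega> p u]) (rule that)
  show ?thesis
  proof (rule W01pI[OF \<Omega> p W1p_grad_cmult[OF \<phi>(1)]])
    show "(\<lambda>x. c * \<phi> n x) \<in> test_functions \<Omega>" for n by (intro test_functions_cmult \<phi>)
    show "(\<lambda>n. Lp_int \<Omega> p (\<lambda>x. c * \<phi> n x - c * u x)) \<longlonglongrightarrow> 0"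
      using tendsto_mult[OF tendsto_const[of "\<bar>c\<bar> powr p"] \<phi>(3)] Lp_int_scaleR[of \<Omega> p c "\<lambda>x. \<phi> _ x - u x"]
      by (simp add: right_diff_distrib)
    show "(\<lambda>n. Lp_int \<Omega> p (\<lambda>x. test_grad (\<lambda>x. c * \<phi> n x) x - c *\<^sub>R weak_gradient \<Omega> u x)) \<longlonglongrightarrow> 0"
      unfolding test_grad_cmult[OF \<phi>(2)] scaleR_diff_right[symmetric] Lp_int_scaleR
      using tendsto_mult[OF tendsto_const[of "\<bar>c\<bar> powr p"] \<phi>(4)] by simp
  qed
qed

lemma W01p_diff:
  assumes \<Omega>: "open \<Omega>" and p: "0 < p" and u: "u \<in> W01p \<Omega> p" and v: "v \<in> W01p \<Omega> p"
  shows "(\<lambda>x. u x - v x) \<in> W01p \<Omega> p"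
  using W01p_add[OF \<Omega> p u W01p_cmult[OF \<Omega> p v, of "-1"]] by simp

lemma W01p_grad:
  assumes \<Omega>: "open \<Omega>" and u: "u \<in> W01p \<Omega> p"
  shows "W1p_grad \<Omega> p u (weak_gradient \<Omega> u)"
  using u W1p_grad_weak_gradient(2)[OF \<Omega>] by (auto simp: W01p_def W1p_iff)

text \<open>Test functions approximate \<open>u\<close>; their bounds pass to the limit by Fatou's
  lemma. The factor \<open>2 powr p\<close> comes from \<open>Lp_int_add_le\<close> and is harmless,
  because the sharp constant is recovered in \<open>best_embedding_constant_bound\<close>.\<close>

lemma W01p_sobolev:
  fixes p :: real
  assumes p: "1 < p" "p < real DIM('a::euclidean_space)"
    and q_def: "q = p * real DIM('a) / (real DIM('a) - p)"
  obtains C where "C > 0" "\<And>(\<Omega> :: 'a set) u. open \<Omega> \<Longrightarrow> u \<in> W01p \<Omega> p \<Longrightarrow>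
    u \<in> Lp_space \<Omega> q \<and> Lp_int \<Omega> q u \<le> C * Lp_int \<Omega> p (weak_gradient \<Omega> u) powr (q / p)"
proof -
  have q: "q \<ge> p" "q > 0" using p by (auto simp: q_def field_simps)
  obtain C where C: "C > 0" "\<And>(f :: 'a \<Rightarrow> real) g. C1_compact f g \<Longrightarrow>
      (LINT x|lborel. \<bar>f x\<bar> powr q) \<le> C * (LINT x|lborel. norm (g x) powr p) powr (q / p)"
    by (rule C1_sobolev[OF p q_def]) (rule that)
  show ?thesis
  proof (rule that[of "C * (2 powr p) powr (q / p)"])
    show "C * (2 powr p) powr (q / p) > 0" using C by simp
    fix \<Omega> :: "'a set" and u assume \<Omega>: "open \<Omega>" and u: "u \<in> W01p \<Omega> p"
    have p0: "0 < p" using p by simp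
    let ?g = "weak_gradient \<Omega> u"
    obtain \<phi> where \<phi>: "W1p_grad \<Omega> p u ?g" "\<And>n::nat. \<phi> n \<in> test_functions \<Omega>"
      "(\<lambda>n. Lp_int \<Omega> p (\<lambda>x. \<phi> n x - u x)) \<longlonglongrightarrow> 0"
      "(\<lambda>n. Lp_int \<Omega> p (\<lambda>x. test_grad (\<phi> n) x - ?g x)) \<longlonglongrightarrow> 0"
      by (rule W01pE[OF \<Omega> p0 u]) (rule that)
    have d: "W1p_grad \<Omega> p (\<lambda>x. \<phi> n x - u x) (\<lambda>x. test_grad (\<phi> n) x - ?g x)" for n
      using p by (intro W1p_grad_diff[OF \<Omega> _ W1p_grad_test[OF \<Omega> p0 \<phi>(2)] \<phi>(1)]) simp
    have um [measurable]: "u \<in> borel_measurable (lebesgue_on \<Omega>)" using \<phi>(1) by (auto simp: W1p_grad_def Lp_space_def)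
    have [measurable]: "\<phi> n \<in> borel_measurable (lebesgue_on \<Omega>)" for n
      using W1p_grad_test[OF \<Omega> p0 \<phi>(2)] by (auto simp: W1p_grad_def Lp_space_def)
    \<comment> \<open>Convergence in L^p is convergence of the p-th powers in L^1, which yields an
      almost everywhere convergent subsequence for Fatou's lemma.\<close>
    have "\<exists>r::nat\<Rightarrow>nat. strict_mono r \<and> (AE x in lebesgue_on \<Omega>. (\<lambda>n. \<bar>\<phi> (r n) x - u x\<bar> powr p) \<longlonglongrightarrow> 0)"
    proof (rule tendsto_L1_AE_subseq)
      show "integrable (lebesgue_on \<Omega>) (\<lambda>x. \<bar>\<phi> n x - u x\<bar> powr p)" for n
        using d[of n] by (simp add: W1p_grad_def Lp_space_def)
      show "(\<lambda>n. LINT x|lebesgue_on \<Omega>. norm (\<bar>\<phi> n x - u x\<bar> powr p)) \<longlonglongrightarrow> 0"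
        using \<phi>(3) by (simp add: Lp_int_def)
    qed
    then obtain r :: "nat \<Rightarrow> nat" where r: "strict_mono r"
      and ae: "AE x in lebesgue_on \<Omega>. (\<lambda>n. \<bar>\<phi> (r n) x - u x\<bar> powr p) \<longlonglongrightarrow> 0" by blast
    have ae': "AE x in lebesgue_on \<Omega>. ennreal (\<bar>u x\<bar> powr q) = liminf (\<lambda>n. ennreal (\<bar>\<phi> (r n) x\<bar> powr q))"
      using ae
    proof eventually_elim
      case (elim x)
      have "(\<lambda>n. (\<bar>\<phi> (r n) x - u x\<bar> powr p) powr (1 / p)) \<longlonglongrightarrow> 0 powr (1 / p)"
        using p by (intro tendsto_powr2 elim) (auto intro: always_eventually)
      then have "(\<lambda>n. \<bar>\<phi> (r n) x - u x\<bar>) \<longlonglongrightarrow> 0" using p by (simp add: powr_powr)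
      then have "(\<lambda>n. \<phi> (r n) x) \<longlonglongrightarrow> u x" by (simp add: LIM_zero_iff tendsto_rabs_zero_iff)
      then have "(\<lambda>n. \<bar>\<phi> (r n) x\<bar> powr q) \<longlonglongrightarrow> \<bar>u x\<bar> powr q"
        using q by (intro tendsto_powr2 tendsto_rabs) (auto intro: always_eventually)
      then have "(\<lambda>n. ennreal (\<bar>\<phi> (r n) x\<bar> powr q)) \<longlonglongrightarrow> ennreal (\<bar>u x\<bar> powr q)" by (rule tendsto_ennrealI)
      then show ?case by (intro lim_imp_Liminf[symmetric]) auto
    qed
    define G where "G = Lp_int \<Omega> p ?g"
    define B where "B n = Lp_int \<Omega> p (\<lambda>x. test_grad (\<phi> n) x - ?g x)" for n
    have bound: "(\<integral>\<^sup>+x. ennreal (\<bar>\<phi> n x\<bar> powr q) \<partial>lebesgue_on \<Omega>) \<le> ennreal (C * (2 powr p * (G + B n)) powr (q / p))" for n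
    proof -
      note f = test_function_C1[OF \<phi>(2)[of n]]
      note [measurable] = C1_compactD(4,5)[OF f]
      have iq: "integrable (lebesgue_on \<Omega>) (\<lambda>x. \<bar>\<phi> n x\<bar> powr q)"
        using C1_compact_integrable[OF f q(2)] test_function_outside[OF \<phi>(2)] q
        by (subst lebesgue_on_lborel(2)[OF \<Omega>]) auto
      have "(\<integral>\<^sup>+x. ennreal (\<bar>\<phi> n x\<bar> powr q) \<partial>lebesgue_on \<Omega>) = ennreal (LINT x|lebesgue_on \<Omega>. \<bar>\<phi> n x\<bar> powr q)"
        using iq by (intro nn_integral_eq_integral) auto
      also have "(LINT x|lebesgue_on \<Omega>. \<bar>\<phi> n x\<bar> powr q) = (LINT x|lborel. \<bar>\<phi> n x\<bar> powr q)"
        using test_function_outside[OF \<phi>(2)] q by (intro lebesgue_on_lborel(1)[OF \<Omega>]) auto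
      also have "ennreal \<dots> \<le> ennreal (C * (LINT x|lborel. norm (test_grad (\<phi> n) x) powr p) powr (q / p))"
        by (intro ennreal_leI C(2)[OF f])
      also have "(LINT x|lborel. norm (test_grad (\<phi> n) x) powr p) = Lp_int \<Omega> p (test_grad (\<phi> n))"
        unfolding Lp_int_def using test_function_outside[OF \<phi>(2)] p by (intro lebesgue_on_lborel(1)[OF \<Omega>, symmetric]) auto
      also have "ennreal (C * Lp_int \<Omega> p (test_grad (\<phi> n)) powr (q / p)) \<le> ennreal (C * (2 powr p * (G + B n)) powr (q / p))"
      proof (intro ennreal_leI mult_left_mono powr_mono2)
        show "Lp_int \<Omega> p (test_grad (\<phi> n)) \<le> 2 powr p * (G + B n)"
          using Lp_int_add_le[of ?g \<Omega> p "\<lambda>x. test_grad (\<phi> n) x - ?g x"] d[of n] \<phi>(1) p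
          by (simp add: G_def B_def W1p_grad_def)
      qed (use C q p in auto)
      finally show ?thesis .
    qed
    have GB: "0 \<le> G" "0 \<le> B n" for n by (simp_all add: G_def B_def)
    have "B \<longlonglongrightarrow> 0" using \<phi>(4) by (simp add: B_def[abs_def])
    then have "(\<lambda>n. C * (2 powr p * (G + B n)) powr (q / p)) \<longlonglongrightarrow> C * (2 powr p * (G + 0)) powr (q / p)"
      using p q GB by (intro tendsto_intros tendsto_powr2) (auto intro!: always_eventually)
    then have lim: "(\<lambda>n. ennreal (C * (2 powr p * (G + B n)) powr (q / p))) \<longlonglongrightarrow> ennreal (C * (2 powr p * G) powr (q / p))"
      by (intro tendsto_ennrealI) simp
    have "(\<integral>\<^sup>+x. ennreal (\<bar>u x\<bar> powr q) \<partial>lebesgue_on \<Omega>) = (\<integral>\<^sup>+x. liminf (\<lambda>n. ennreal (\<bar>\<phi> (r n) x\<bar> powr q)) \<partial>lebesgue_on \<Omega>)"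
      using ae' by (rule nn_integral_cong_AE)
    also have "\<dots> \<le> liminf (\<lambda>n. \<integral>\<^sup>+x. ennreal (\<bar>\<phi> (r n) x\<bar> powr q) \<partial>lebesgue_on \<Omega>)"
      by (intro nn_integral_liminf) measurable
    also have "\<dots> \<le> liminf (\<lambda>n. ennreal (C * (2 powr p * (G + B (r n))) powr (q / p)))"
      by (intro Liminf_mono always_eventually allI bound)
    also have "\<dots> = ennreal (C * (2 powr p * G) powr (q / p))"
      using LIMSEQ_subseq_LIMSEQ[OF lim r] by (intro lim_imp_Liminf) (auto simp: o_def)
    finally have fin: "(\<integral>\<^sup>+x. ennreal (\<bar>u x\<bar> powr q) \<partial>lebesgue_on \<Omega>) \<le> ennreal (C * (2 powr p * G) powr (q / p))" .
    have int: "integrable (lebesgue_on \<Omega>) (\<lambda>x. \<bar>u x\<bar> powr q)"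
      unfolding integrable_iff_bounded using order.strict_trans1[OF fin ennreal_less_top] by simp
    have "ennreal (Lp_int \<Omega> q u) = (\<integral>\<^sup>+x. ennreal (\<bar>u x\<bar> powr q) \<partial>lebesgue_on \<Omega>)"
      unfolding Lp_int_def using int by (subst nn_integral_eq_integral) auto
    with fin have "ennreal (Lp_int \<Omega> q u) \<le> ennreal (C * (2 powr p * G) powr (q / p))" by (simp only:)
    then have "Lp_int \<Omega> q u \<le> C * (2 powr p * G) powr (q / p)"
      using C(1) by (subst (asm) ennreal_le_iff) auto
    then show "u \<in> Lp_space \<Omega> q \<and> Lp_int \<Omega> q u \<le> C * (2 powr p) powr (q / p) * Lp_int \<Omega> p ?g powr (q / p)"
      using int um by (simp add: Lp_space_def G_def powr_mult)
  qed
qed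

text \<open>\<open>GREATEST\<close> is meaningful only if the admissible constants have a maximum.
  They exist by \<open>W01p_sobolev\<close>, and if they are bounded above, their supremum is again
  admissible, because for each \<open>u\<close> the condition is a closed inequality.\<close>

lemma best_embedding_constant_bound:
  fixes \<Omega> :: "'a::euclidean_space set"
  assumes \<Omega>: "open \<Omega>" and p: "1 < p" "p < real DIM('a)"
    and q_def: "q = p * real DIM('a) / (real DIM('a) - p)" and u: "u \<in> W01p \<Omega> p"
  shows "Lp_int \<Omega> q u \<le> best_embedding_constant \<Omega> p q powr (- (q / p)) * Lp_int \<Omega> p (weak_gradient \<Omega> u) powr (q / p)"
proof -
  define S where "S = best_embedding_constant \<Omega> p q"
  have q: "q \<ge> p" "q > 0" using p by (auto simp: q_def field_simps)
  define a where "a u = Lp_int \<Omega> q u powr (p / q)" for u :: "'a \<Rightarrow> real"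
  define b where "b u = Lp_int \<Omega> p (weak_gradient \<Omega> u)" for u
  define P where "P s \<longleftrightarrow> s > 0 \<and> (\<forall>u\<in>W01p \<Omega> p. u \<in> Lp_space \<Omega> q \<and> Lp_norm \<Omega> q u powr p \<le> inverse s * grad_norm \<Omega> p u powr p)" for s
  have ab: "a u \<ge> 0" "b u \<ge> 0" for u by (auto simp: a_def b_def)
  have ne: "Lp_norm \<Omega> q u powr p = a u" for u
    by (simp add: Lp_norm_def a_def Lp_int_def powr_powr)
  have ge: "grad_norm \<Omega> p u powr p = b u" for u
    unfolding grad_norm_def b_def using p by (simp add: Lp_norm_powr)
  obtain C where C: "C > 0" "\<And>u. u \<in> W01p \<Omega> p \<Longrightarrow> u \<in> Lp_space \<Omega> q \<and> Lp_int \<Omega> q u \<le> C * b u powr (q / p)"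
    using W01p_sobolev[OF p q_def] \<Omega> unfolding b_def by metis
  have Pi: "P s \<longleftrightarrow> s > 0 \<and> (\<forall>u\<in>W01p \<Omega> p. s * a u \<le> b u)" for s
    unfolding P_def ne ge using C(2) by (auto simp: field_simps)
  have P0: "P (C powr - (p / q))"
  proof -
    have "C powr - (p / q) * a u \<le> b u" if "u \<in> W01p \<Omega> p" for u
    proof -
      have "a u \<le> (C * b u powr (q / p)) powr (p / q)"
        unfolding a_def using C(2)[OF that] p q by (intro powr_mono2) auto
      also have "\<dots> = C powr (p / q) * b u" using ab p q C by (simp add: powr_mult powr_powr)
      finally show ?thesis using C by (simp add: powr_minus field_simps)
    qed
    then show ?thesis using C by (auto simp: Pi)
  qed
  have claim: "a u \<le> inverse S * b u \<and> 0 < S \<or> a u = 0"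
  proof (cases "bdd_above {s. P s}")
    case True
    define s where "s = Sup {s. P s}"
    have le: "t \<le> s" if "P t" for t unfolding s_def using True that by (intro cSup_upper) auto
    have s0: "s > 0" using le[OF P0] C by (smt (verit) powr_gt_zero)
    have Ps: "P s" unfolding Pi
    proof safe
      show "s > 0" by (rule s0)
      fix u assume u: "u \<in> W01p \<Omega> p"
      show "s * a u \<le> b u"
      proof (cases "a u = 0")
        case False
        then have au: "a u > 0" using ab(1)[of u] by simp
        have "s \<le> b u / a u" unfolding s_def
        proof (rule cSup_least)
          show "{s. P s} \<noteq> {}" using P0 by auto
          show "t \<le> b u / a u" if "t \<in> {s. P s}" for t using that u au by (auto simp: Pi field_simps)
        qed
        then show ?thesis using au by (simp add: field_simps)
      qed (use ab in simp)
    qed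
    have "S = s" unfolding S_def best_embedding_constant_def P_def[symmetric]
      by (rule Greatest_equality) (auto intro: Ps le)
    then show ?thesis using Ps u s0 by (auto simp: Pi field_simps)
  next
    case False
    \<comment> \<open>Arbitrarily large admissible constants force the L^q norm to vanish; the claim
      then holds whatever value \<open>GREATEST\<close> takes.\<close>
    have "a u = 0"
    proof (rule ccontr)
      assume "a u \<noteq> 0"
      then have au: "a u > 0" using ab(1)[of u] by simp
      obtain s where "P s" "s > b u / a u" using False unfolding bdd_above_def by (meson mem_Collect_eq not_less)
      then show False using u au by (auto simp: Pi field_simps)
    qed
    then show ?thesis ..
  qed
  then show ?thesis
  proof
    assume h: "a u \<le> inverse S * b u \<and> 0 < S"
    have "Lp_int \<Omega> q u = a u powr (q / p)" using p q by (simp add: a_def powr_powr)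
    also have "\<dots> \<le> (inverse S * b u) powr (q / p)" using h ab p q by (intro powr_mono2) auto
    also have "\<dots> = S powr (- (q / p)) * b u powr (q / p)"
      using h by (simp add: powr_mult powr_minus inverse_powr)
    finally show ?thesis by (simp add: S_def b_def)
  next
    assume "a u = 0"
    then have "Lp_int \<Omega> q u = 0" by (simp add: a_def)
    then show ?thesis by simp
  qed
qed

section \<open>Bounded functionals and weakly null sequences\<close>

text \<open>Hoelder's inequality for \<open>norm (a x) powr (p - 1)\<close>, which lies in the space
  with the dual exponent \<open>p / (p - 1)\<close>, and \<open>norm (b x)\<close>.\<close>

lemma Lp_pairing:
  fixes a b :: "'a::euclidean_space \<Rightarrow> 'b::euclidean_space"
  assumes p: "1 < p" and a: "a \<in> Lp_space \<Omega> p" and b: "b \<in> Lp_space \<Omega> p"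
  shows "integrable (lebesgue_on \<Omega>) (\<lambda>x. norm (a x) powr (p - 2) * (a x \<bullet> b x))"
    and "\<bar>LINT x|lebesgue_on \<Omega>. norm (a x) powr (p - 2) * (a x \<bullet> b x)\<bar>
      \<le> Lp_int \<Omega> p a powr (1 - 1 / p) * Lp_int \<Omega> p b powr (1 / p)"
proof -
  let ?M = "lebesgue_on \<Omega>"
  have [measurable]: "a \<in> borel_measurable ?M" "b \<in> borel_measurable ?M"
    using a b by (auto simp: Lp_space_def)
  define q where "q = p / (p - 1)"
  have q: "1 < q" "1 / q + 1 / p = 1" "1 / q = 1 - 1 / p" using p by (auto simp: q_def field_simps)
  let ?f = "\<lambda>x. norm (a x) powr (p - 1)" and ?g = "\<lambda>x. norm (b x)"
  have fq: "\<bar>?f x\<bar> powr q = norm (a x) powr p" for x using p by (simp add: powr_powr q_def)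
  have if': "integrable ?M (\<lambda>x. \<bar>?f x\<bar> powr q)" using a unfolding fq by (simp add: Lp_space_def)
  have ig: "integrable ?M (\<lambda>x. \<bar>?g x\<bar> powr p)" using b by (simp add: Lp_space_def)
  have fg: "integrable ?M (\<lambda>x. ?f x * ?g x)"
    by (rule holder_inequality(1)[OF q(1) p q(2) _ _ if' ig]) measurable
  have pw: "\<bar>norm (a x) powr (p - 2) * (a x \<bullet> b x)\<bar> \<le> \<bar>?f x * ?g x\<bar>" for x
  proof (cases "a x = 0")
    case False
    have "\<bar>norm (a x) powr (p - 2) * (a x \<bullet> b x)\<bar> \<le> norm (a x) powr (p - 2) * (norm (a x) * norm (b x))"
      unfolding abs_mult by (intro mult_mono Cauchy_Schwarz_ineq2) auto
    also have "\<dots> = ?f x * ?g x" using False by (simp add: powr_diff powr_numeral power2_eq_square)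
    finally show ?thesis by simp
  qed simp
  show int: "integrable ?M (\<lambda>x. norm (a x) powr (p - 2) * (a x \<bullet> b x))"
    by (rule Bochner_Integration.integrable_bound[OF fg]) (use pw in auto)
  have "\<bar>LINT x|?M. norm (a x) powr (p - 2) * (a x \<bullet> b x)\<bar> \<le> (LINT x|?M. \<bar>norm (a x) powr (p - 2) * (a x \<bullet> b x)\<bar>)"
    by (rule integral_abs_bound)
  also have "\<dots> \<le> (LINT x|?M. \<bar>?f x * ?g x\<bar>)"
    by (intro integral_mono integrable_abs int fg pw)
  also have "\<dots> \<le> (LINT x|?M. \<bar>?f x\<bar> powr q) powr (1 / q) * (LINT x|?M. \<bar>?g x\<bar> powr p) powr (1 / p)"
    by (rule holder_inequality(2)[OF q(1) p q(2) _ _ if' ig]) measurable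
  also have "\<dots> = Lp_int \<Omega> p a powr (1 - 1 / p) * Lp_int \<Omega> p b powr (1 / p)"
    unfolding fq q(3) Lp_int_def by simp
  finally show "\<bar>LINT x|?M. norm (a x) powr (p - 2) * (a x \<bullet> b x)\<bar>
      \<le> Lp_int \<Omega> p a powr (1 - 1 / p) * Lp_int \<Omega> p b powr (1 / p)" .
qed

text \<open>The weak p-Laplacian of \<open>u\<close> tested with \<open>v\<close>. It has two roles:
  times \<open>p\<close> it is the linear term of Lindqvist's inequality, and normalised it is a
  norming functional for \<open>u\<close>.\<close>

definition gradient_pairing :: "'a::euclidean_space set \<Rightarrow> real \<Rightarrow> ('a \<Rightarrow> real) \<Rightarrow> ('a \<Rightarrow> real) \<Rightarrow> real" where
  "gradient_pairing \<Omega> p u v = (LINT x|lebesgue_on \<Omega>. norm (weak_gradient \<Omega> u x) powr (p - 2) *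
     (weak_gradient \<Omega> u x \<bullet> weak_gradient \<Omega> v x))"

lemma gradient_pairing_eq:
  assumes \<Omega>: "open \<Omega>" and u: "u \<in> W01p \<Omega> p" and v: "W1p_grad \<Omega> p v g"
  shows "gradient_pairing \<Omega> p u v = (LINT x|lebesgue_on \<Omega>. norm (weak_gradient \<Omega> u x) powr (p - 2) * (weak_gradient \<Omega> u x \<bullet> g x))"
proof -
  have [measurable]: "weak_gradient \<Omega> u \<in> borel_measurable (lebesgue_on \<Omega>)"
    "weak_gradient \<Omega> v \<in> borel_measurable (lebesgue_on \<Omega>)" "g \<in> borel_measurable (lebesgue_on \<Omega>)"
    using W01p_grad[OF \<Omega> u] v W1p_grad_weak_gradient(2)[OF \<Omega> v] by (auto simp: W1p_grad_def Lp_space_def)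
  show ?thesis unfolding gradient_pairing_def
    using W1p_grad_weak_gradient(1)[OF \<Omega> v] by (intro integral_cong_AE) (measurable, auto elim: eventually_mono)
qed

lemma grad_norm_Lp_int: "p \<noteq> 0 \<Longrightarrow> grad_norm \<Omega> p u powr p = Lp_int \<Omega> p (weak_gradient \<Omega> u)"
  unfolding grad_norm_def by (rule Lp_norm_powr)

lemma grad_norm_eq_Lp_int: "grad_norm \<Omega> p u = Lp_int \<Omega> p (weak_gradient \<Omega> u) powr (1 / p)"
  by (simp add: grad_norm_def Lp_norm_def Lp_int_def)

lemma gradient_pairing_linear:
  assumes \<Omega>: "open \<Omega>" and p: "1 < p" and u: "u \<in> W01p \<Omega> p" and v: "v \<in> W01p \<Omega> p" and w: "w \<in> W01p \<Omega> p"
  shows "gradient_pairing \<Omega> p u (\<lambda>x. v x + w x) = gradient_pairing \<Omega> p u v + gradient_pairing \<Omega> p u w"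
    and "gradient_pairing \<Omega> p u (\<lambda>x. c * v x) = c * gradient_pairing \<Omega> p u v"
    and "\<bar>gradient_pairing \<Omega> p u v\<bar> \<le> Lp_int \<Omega> p (weak_gradient \<Omega> u) powr (1 - 1 / p) * grad_norm \<Omega> p v"
proof -
  have g: "weak_gradient \<Omega> u \<in> Lp_space \<Omega> p" "weak_gradient \<Omega> v \<in> Lp_space \<Omega> p" "weak_gradient \<Omega> w \<in> Lp_space \<Omega> p"
    using W01p_grad[OF \<Omega>] u v w by (auto simp: W1p_grad_def)
  have p0: "0 \<le> p" using p by simp
  show "gradient_pairing \<Omega> p u (\<lambda>x. v x + w x) = gradient_pairing \<Omega> p u v + gradient_pairing \<Omega> p u w"
    unfolding gradient_pairing_eq[OF \<Omega> u W1p_grad_add[OF \<Omega> p0 W01p_grad[OF \<Omega> v] W01p_grad[OF \<Omega> w]]]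
    using Lp_pairing(1)[OF p g(1,2)] Lp_pairing(1)[OF p g(1,3)]
    by (simp add: gradient_pairing_def inner_add_right distrib_left)
  show "gradient_pairing \<Omega> p u (\<lambda>x. c * v x) = c * gradient_pairing \<Omega> p u v"
    unfolding gradient_pairing_eq[OF \<Omega> u W1p_grad_cmult[OF W01p_grad[OF \<Omega> v]]]
    by (simp add: gradient_pairing_def mult.left_commute[of _ c])
  show "\<bar>gradient_pairing \<Omega> p u v\<bar> \<le> Lp_int \<Omega> p (weak_gradient \<Omega> u) powr (1 - 1 / p) * grad_norm \<Omega> p v"
    using Lp_pairing(2)[OF p g(1,2)] by (simp add: gradient_pairing_def grad_norm_eq_Lp_int)
qed

lemma gradient_pairing_self:
  assumes "1 < p"
  shows "gradient_pairing \<Omega> p u u = Lp_int \<Omega> p (weak_gradient \<Omega> u)"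
proof -
  have "norm a powr (p - 2) * (a \<bullet> a) = norm a powr p" for a :: 'a
    using assms by (cases "a = 0") (auto simp: dot_square_norm powr_diff powr_numeral power2_eq_square)
  then show ?thesis by (simp add: gradient_pairing_def Lp_int_def)
qed

text \<open>
  The gliding hump proof of the uniform boundedness principle: with suitable signs, the series of the
  functionals \<open>(1/3) ^ k * F (n k)\<close> is unbounded along a subsequence on which the norms exceed \<open>4 ^ k\<close>.
\<close>

lemma gliding_hump:
  fixes F :: "nat \<Rightarrow> ('a \<Rightarrow> real) \<Rightarrow> real"
  assumes nrm: "\<And>v. v \<in> V \<Longrightarrow> 0 \<le> nrm v"
    and add: "\<And>n u v. u \<in> V \<Longrightarrow> v \<in> V \<Longrightarrow> F n (\<lambda>x. u x + v x) = F n u + F n v"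
    and cmult: "\<And>n u c. u \<in> V \<Longrightarrow> F n (\<lambda>x. c * u x) = c * F n u"
    and bound: "\<And>n v. v \<in> V \<Longrightarrow> \<bar>F n v\<bar> \<le> nrm v"
    and V: "\<And>n. w n \<in> V" and norming: "\<And>n. F n (w n) = nrm (w n)"
    and weak: "\<And>T. bounded_functional V nrm T \<Longrightarrow> Bseq (\<lambda>n. T (w n))"
  obtains B where "\<And>n. nrm (w n) \<le> B"
proof (rule ccontr)
  assume "\<not> thesis"
  then have "\<exists>n. nrm (w n) > B" for B using that by (meson not_le)
  then have "\<forall>k. \<exists>n. nrm (w n) > 4 ^ k" by blast
  from choice[OF this] obtain n where n: "nrm (w (n k)) > 4 ^ k" for k :: nat by blast
  define sg :: "real \<Rightarrow> real" where "sg a = (if a \<ge> 0 then 1 else -1)" for a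
  \<comment> \<open>Partial sums of the series. Each new sign is that of the partial sum at
    \<open>w (n k)\<close>, so the new term cannot cancel against the earlier ones there.\<close>
  define T where "T = rec_nat (\<lambda>_. 0) (\<lambda>k Tk v. Tk v + sg (Tk (w (n k))) * (1/3) ^ k * F (n k) v)"
  define a where "a k v = sg (T k (w (n k))) * (1/3) ^ k * F (n k) v" for k v
  have T0: "T 0 v = 0" and TSuc: "T (Suc k) v = T k v + a k v" for k v by (simp_all add: T_def a_def)
  have Tsum: "T k v = (\<Sum>j<k. a j v)" for k v by (induction k) (simp_all add: T0 TSuc)
  have abs_a: "\<bar>a k v\<bar> \<le> (1/3) ^ k * nrm v" if "v \<in> V" for k v
  proof -
    have "\<bar>a k v\<bar> = (1/3) ^ k * \<bar>F (n k) v\<bar>" by (simp add: a_def sg_def abs_mult)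
    also have "\<dots> \<le> (1/3) ^ k * nrm v" using bound[OF that] by (intro mult_left_mono) auto
    finally show ?thesis .
  qed
  have geo: "summable (\<lambda>k. (1/3::real) ^ k * c)" for c by (intro summable_mult2 summable_geometric) simp
  have sum_a: "summable (\<lambda>k. a k v)" if "v \<in> V" for v
    by (rule summable_comparison_test'[OF geo, of 0]) (use abs_a[OF that] in simp)
  define L where "L v = (\<Sum>k. a k v)" for v
  have L: "bounded_functional V nrm L" unfolding bounded_functional_def
  proof safe
    fix u v assume uv: "u \<in> V" "v \<in> V"
    show "L (\<lambda>x. u x + v x) = L u + L v"
      unfolding L_def suminf_add[OF sum_a[OF uv(1)] sum_a[OF uv(2)]]
      by (simp add: a_def add[OF uv] distrib_left)
  next
    fix u c assume u: "u \<in> V"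
    show "L (\<lambda>x. c * u x) = c * L u"
      unfolding L_def suminf_mult[OF sum_a[OF u], symmetric] by (simp add: a_def cmult[OF u] mult_ac)
  next
    have "\<bar>L v\<bar> \<le> (\<Sum>k. (1/3) ^ k * 1) * nrm v" if v: "v \<in> V" for v
    proof -
      have "norm (L v) \<le> (\<Sum>k. (1/3) ^ k * nrm v)"
        unfolding L_def by (rule norm_suminf_le[OF _ geo]) (use abs_a[OF v] in simp)
      also have "\<dots> = (\<Sum>k. (1/3) ^ k * 1) * nrm v"
        using suminf_mult2[OF geo[of 1], of "nrm v"] by simp
      finally show ?thesis by simp
    qed
    then show "\<exists>C. \<forall>u\<in>V. \<bar>L u\<bar> \<le> C * nrm u" by blast
  qed
  then obtain B where B: "\<And>k. \<bar>L (w k)\<bar> \<le> B" using weak[OF L] by (auto simp: Bseq_def)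
  have low: "(4/3) ^ k / 2 \<le> B" for k
  proof -
    let ?v = "w (n k)"
    have v: "?v \<in> V" by (rule V)
    \<comment> \<open>The terms after \<open>k\<close> sum to at most half of the k-th hump, since
      the powers of \<open>1/3\<close> beyond \<open>k\<close> add up to
      \<open>(1/3) ^ k / 2\<close>. Half of the hump survives.\<close>
    have tail: "\<bar>L ?v - T (Suc k) ?v\<bar> \<le> (1/3) ^ k / 2 * nrm ?v"
    proof -
      have "L ?v - T (Suc k) ?v = (\<Sum>j. a (j + Suc k) ?v)"
        unfolding L_def Tsum using suminf_minus_initial_segment[OF sum_a[OF v], of "Suc k"] by simp
      also have "norm \<dots> \<le> (\<Sum>j. (1/3) ^ j * ((1/3) ^ Suc k * nrm ?v))"
      proof (rule norm_suminf_le[OF _ geo])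
        fix j show "norm (a (j + Suc k) ?v) \<le> (1/3) ^ j * ((1/3) ^ Suc k * nrm ?v)"
          using abs_a[OF v, of "j + Suc k"] by (simp add: power_add mult_ac)
      qed
      also have "\<dots> = (\<Sum>j. (1/3) ^ j) * ((1/3) ^ Suc k * nrm ?v)"
        using suminf_mult2[OF geo[of 1], of "(1/3) ^ Suc k * nrm ?v"] by simp
      also have "(\<Sum>j. (1/3::real) ^ j) = 3 / 2" by (subst suminf_geometric) auto
      finally show ?thesis by (simp add: mult.commute)
    qed
    have "\<bar>T (Suc k) ?v\<bar> = \<bar>T k ?v\<bar> + (1/3) ^ k * nrm ?v"
    proof -
      define m where "m = (1/3) ^ k * nrm ?v"
      have "m \<ge> 0" using nrm[OF v] by (simp add: m_def)
      moreover have "T (Suc k) ?v = T k ?v + sg (T k ?v) * m"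
        by (simp add: TSuc a_def norming m_def)
      ultimately show ?thesis unfolding m_def[symmetric] by (auto simp: sg_def)
    qed
    then have "(1/3) ^ k / 2 * nrm ?v \<le> \<bar>L ?v\<bar>" using tail by linarith
    moreover have "(1/3) ^ k / 2 * 4 ^ k \<le> (1/3) ^ k / 2 * nrm ?v" using n[of k] by (intro mult_left_mono) auto
    moreover have "(1/3::real) ^ k / 2 * 4 ^ k = (4/3) ^ k / 2" by (simp add: power_divide)
    ultimately show ?thesis using B[of "n k"] by linarith
  qed
  obtain k where "2 * B < (4/3) ^ k" using real_arch_pow[of "4/3" "2 * B"] by auto
  with low[of k] show False by simp
qed

text \<open>The normalised pairings with \<open>w n\<close> have norm at most 1 and attain the norm
  at \<open>w n\<close>; they supply explicitly what the Hahn--Banach theorem provides in the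
  abstract uniform boundedness argument.\<close>

lemma weakly_bounded_grad_norm:
  assumes \<Omega>: "open \<Omega>" and p: "1 < p" and w: "\<And>n. w n \<in> W01p \<Omega> p"
    and weak: "\<And>T. bounded_functional (W01p \<Omega> p) (grad_norm \<Omega> p) T \<Longrightarrow> Bseq (\<lambda>n. T (w n))"
  obtains B where "B > 0" "\<And>n. Lp_int \<Omega> p (weak_gradient \<Omega> (w n)) \<le> B"
proof -
  define I where "I n = Lp_int \<Omega> p (weak_gradient \<Omega> (w n))" for n
  have I: "I n \<ge> 0" for n by (simp add: I_def)
  \<comment> \<open>If \<open>I n = 0\<close>, division by zero makes \<open>F n\<close> vanish, in
    agreement with the vanishing seminorm of \<open>w n\<close>.\<close>
  define F where "F n v = gradient_pairing \<Omega> p (w n) v / I n powr (1 - 1 / p)" for n v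
  obtain B where B: "\<And>n. grad_norm \<Omega> p (w n) \<le> B"
  proof (rule gliding_hump[of "W01p \<Omega> p" "grad_norm \<Omega> p" F w])
    fix u v n c assume u: "u \<in> W01p \<Omega> p"
    show "0 \<le> grad_norm \<Omega> p u" by (simp add: grad_norm_eq_Lp_int)
    show "F n (\<lambda>x. c * u x) = c * F n u"
      using gradient_pairing_linear(2)[OF \<Omega> p w u u] by (simp add: F_def)
    show "\<bar>F n u\<bar> \<le> grad_norm \<Omega> p u"
    proof (cases "I n = 0")
      case False
      then have pos: "I n powr (1 - 1 / p) > 0" using I[of n] by simp
      have "\<bar>gradient_pairing \<Omega> p (w n) u\<bar> \<le> I n powr (1 - 1 / p) * grad_norm \<Omega> p u"
        using gradient_pairing_linear(3)[OF \<Omega> p w u u] by (simp add: I_def)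
      then show ?thesis using pos by (simp add: F_def abs_divide field_simps)
    qed (simp add: F_def grad_norm_eq_Lp_int)
    assume v: "v \<in> W01p \<Omega> p"
    show "F n (\<lambda>x. u x + v x) = F n u + F n v"
      using gradient_pairing_linear(1)[OF \<Omega> p w u v] by (simp add: F_def add_divide_distrib)
  next
    fix n
    show "F n (w n) = grad_norm \<Omega> p (w n)"
    proof (cases "I n = 0")
      case True
      then show ?thesis by (simp add: F_def grad_norm_eq_Lp_int I_def)
    next
      case False
      have "I n = I n powr (1 - 1 / p) * I n powr (1 / p)" using I[of n] False by (simp flip: powr_add)
      then have "I n / I n powr (1 - 1 / p) = I n powr (1 / p)" using False by (simp add: field_simps)
      then show ?thesis unfolding F_def gradient_pairing_self[OF p] by (simp add: grad_norm_eq_Lp_int I_def)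
    qed
  qed (use w weak in auto)
  show ?thesis
  proof (rule that[of "\<bar>B\<bar> powr p + 1"])
    fix n
    have "Lp_int \<Omega> p (weak_gradient \<Omega> (w n)) = grad_norm \<Omega> p (w n) powr p" using p by (simp add: grad_norm_Lp_int)
    also have "\<dots> \<le> \<bar>B\<bar> powr p" using B[of n] p by (intro powr_mono2) (auto simp: grad_norm_eq_Lp_int)
    finally show "Lp_int \<Omega> p (weak_gradient \<Omega> (w n)) \<le> \<bar>B\<bar> powr p + 1" by simp
  qed (simp add: add_nonneg_pos)
qed

section \<open>Local convergence of weakly null sequences\<close>

lemma Lp_space_set_integrable:
  assumes q: "1 < q" and \<Omega>: "open \<Omega>" and v: "v \<in> Lp_space \<Omega> q"
  shows "integrable (lebesgue_on \<Omega>) (\<lambda>y. indicator (cball x r) y * v y)"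
    and "\<bar>LINT y|lebesgue_on \<Omega>. indicator (cball x r) y * v y\<bar> powr q
      \<le> measure lebesgue (\<Omega> \<inter> cball x r) powr (q - 1) * Lp_int \<Omega> q v"
proof -
  let ?M = "lebesgue_on \<Omega>"
  define A where "A = \<Omega> \<inter> cball x r"
  have AL: "A \<in> sets lebesgue" using \<Omega> by (auto simp: A_def)
  have A: "A \<in> sets ?M" using AL \<Omega> by (auto simp: sets_restrict_space A_def)
  have eA: "emeasure ?M A = emeasure lebesgue A" using \<Omega> by (intro emeasure_restrict_space) (auto simp: A_def)
  have "emeasure lebesgue A \<le> emeasure lebesgue (cball x r)" by (intro emeasure_mono) (auto simp: A_def)
  also have "\<dots> < \<infinity>" using emeasure_bounded_finite[OF bounded_cball, of x r] by simp
  finally have fin: "emeasure ?M A < \<infinity>" using eA by simp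
  have vm [measurable]: "v \<in> borel_measurable ?M" and vi: "integrable ?M (\<lambda>y. \<bar>v y\<bar> powr q)"
    using v by (auto simp: Lp_space_def)
  have si: "set_integrable ?M A (\<lambda>y. \<bar>v y\<bar> powr q)"
    unfolding set_integrable_def by (intro integrable_mult_indicator A vi)
  have ind: "indicator A y *\<^sub>R v y = indicator (cball x r) y * v y" if "y \<in> space ?M" for y
    using that by (auto simp: A_def indicator_def)
  note s = set_integral_powr_le[OF q A fin vm si]
  show "integrable ?M (\<lambda>y. indicator (cball x r) y * v y)"
    using s(1) unfolding set_integrable_def by (subst Bochner_Integration.integrable_cong[OF refl ind, symmetric])
  have "\<bar>LINT y|?M. indicator (cball x r) y * v y\<bar> powr q = \<bar>LINT y:A|?M. v y\<bar> powr q"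
    unfolding set_lebesgue_integral_def by (subst Bochner_Integration.integral_cong[OF refl ind]) auto
  also have "\<dots> \<le> measure ?M A powr (q - 1) * (LINT y:A|?M. \<bar>v y\<bar> powr q)" by (rule s(2))
  also have "\<dots> \<le> measure ?M A powr (q - 1) * Lp_int \<Omega> q v"
  proof (intro mult_left_mono)
    show "(LINT y:A|?M. \<bar>v y\<bar> powr q) \<le> Lp_int \<Omega> q v"
      unfolding set_lebesgue_integral_def Lp_int_def real_norm_def
      using si vi by (intro integral_mono) (auto simp: set_integrable_def split: split_indicator)
  qed simp
  also have "measure ?M A = measure lebesgue A" using eA by (simp add: measure_def)
  finally show "\<bar>LINT y|lebesgue_on \<Omega>. indicator (cball x r) y * v y\<bar> powr q
      \<le> measure lebesgue (\<Omega> \<inter> cball x r) powr (q - 1) * Lp_int \<Omega> q v" by (simp add: A_def)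
qed

text \<open>Hoelder's inequality on the ball is used with the critical exponent, which the gradient
  controls by the Sobolev inequality; on an unbounded domain the gradient need not control the L^p
  norm.\<close>

lemma ball_integral_bounded_functional:
  fixes \<Omega> :: "'a::euclidean_space set"
  assumes \<Omega>: "open \<Omega>" and p: "1 < p" "p < real DIM('a)"
  shows "bounded_functional (W01p \<Omega> p) (grad_norm \<Omega> p) (\<lambda>v. LINT y|lebesgue_on \<Omega>. indicator (cball x r) y * v y)"
  unfolding bounded_functional_def
proof (intro conjI ballI allI)
  define q where "q = p * real DIM('a) / (real DIM('a) - p)"
  have "q \<ge> p" using p by (auto simp: q_def field_simps)
  then have q: "q \<ge> p" "q > 1" using p by auto
  obtain C where C: "C > 0" "\<And>u. u \<in> W01p \<Omega> p \<Longrightarrow> u \<in> Lp_space \<Omega> q \<and> Lp_int \<Omega> q u \<le> C * Lp_int \<Omega> p (weak_gradient \<Omega> u) powr (q / p)"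
    using W01p_sobolev[OF p q_def] \<Omega> by metis
  have int: "integrable (lebesgue_on \<Omega>) (\<lambda>y. indicator (cball x r) y * v y)" if "v \<in> W01p \<Omega> p" for v
    using C(2)[OF that] by (intro Lp_space_set_integrable(1)[OF q(2) \<Omega>]) auto
  show "(LINT y|lebesgue_on \<Omega>. indicator (cball x r) y * (u y + v y)) =
    (LINT y|lebesgue_on \<Omega>. indicator (cball x r) y * u y) + (LINT y|lebesgue_on \<Omega>. indicator (cball x r) y * v y)"
    if "u \<in> W01p \<Omega> p" "v \<in> W01p \<Omega> p" for u v
    using int[OF that(1)] int[OF that(2)] by (simp add: distrib_left)
  show "(LINT y|lebesgue_on \<Omega>. indicator (cball x r) y * (c * u y)) = c * (LINT y|lebesgue_on \<Omega>. indicator (cball x r) y * u y)" for u and c :: real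
    by (simp add: mult.left_commute[of _ c])
  define D where "D = (measure lebesgue (\<Omega> \<inter> cball x r) powr (q - 1) * C) powr (1 / q)"
  have "\<bar>LINT y|lebesgue_on \<Omega>. indicator (cball x r) y * v y\<bar> \<le> D * grad_norm \<Omega> p v" if v: "v \<in> W01p \<Omega> p" for v
  proof -
    let ?I = "LINT y|lebesgue_on \<Omega>. indicator (cball x r) y * v y"
    let ?m = "measure lebesgue (\<Omega> \<inter> cball x r) powr (q - 1)"
    have "\<bar>?I\<bar> powr q \<le> ?m * Lp_int \<Omega> q v"
      using C(2)[OF v] by (intro Lp_space_set_integrable(2)[OF q(2) \<Omega>]) auto
    also have "\<dots> \<le> ?m * (C * Lp_int \<Omega> p (weak_gradient \<Omega> v) powr (q / p))"
      using C(2)[OF v] by (intro mult_left_mono) auto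
    finally have "(\<bar>?I\<bar> powr q) powr (1 / q) \<le> (?m * (C * Lp_int \<Omega> p (weak_gradient \<Omega> v) powr (q / p))) powr (1 / q)"
      using q by (intro powr_mono2) auto
    also have "\<dots> = D * grad_norm \<Omega> p v"
      using q C p by (simp add: D_def grad_norm_eq_Lp_int powr_mult powr_powr)
    finally show ?thesis using q by (simp add: powr_powr)
  qed
  then show "\<exists>C. \<forall>u\<in>W01p \<Omega> p. \<bar>LINT y|lebesgue_on \<Omega>. indicator (cball x r) y * u y\<bar> \<le> C * grad_norm \<Omega> p u"
    by blast
qed

text \<open>Identifies an average with a multiple of the functional of
  \<open>ball_integral_bounded_functional\<close>, to which weak convergence applies.\<close>

lemma ball_avg_eq:
  fixes f :: "'a::euclidean_space \<Rightarrow> real"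
  assumes [measurable]: "f \<in> borel_measurable borel" and r: "r > 0"
  shows "ball_avg f r x = (LINT y|lborel. indicator (cball x r) y * f y) / (unit_vol TYPE('a) * r ^ DIM('a))"
proof -
  have ind: "indicator (cball x r) (x + r *\<^sub>R z) = (indicator (cball 0 1) z :: real)" for z
    using r by (auto simp: indicator_def dist_norm)
  have "(LINT y|lborel. indicator (cball x r) y * f y) =
    (LINT y|density (distr lborel borel (\<lambda>z. x + r *\<^sub>R z)) (\<lambda>_. ennreal (r ^ DIM('a))). indicator (cball x r) y * f y)"
    using lborel_affine[of r x] r by simp
  also have "\<dots> = (LINT y|distr lborel borel (\<lambda>z. x + r *\<^sub>R z). r ^ DIM('a) *\<^sub>R (indicator (cball x r) y * f y))"
    using r by (intro integral_density) auto
  also have "\<dots> = (LINT z|lborel. r ^ DIM('a) *\<^sub>R (indicator (cball x r) (x + r *\<^sub>R z) * f (x + r *\<^sub>R z)))"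
    by (intro integral_distr) auto
  also have "\<dots> = r ^ DIM('a) * (LINT z:cball 0 1|lborel. f (x + r *\<^sub>R z))"
    unfolding ind set_lebesgue_integral_def by simp
  finally show ?thesis using r by (simp add: ball_avg_def)
qed

text \<open>Beyond \<open>d\<close>, \<open>s\<close> is at most
  \<open>d powr (1 - p) * s powr p\<close>. Integrated over a ball, this bounds an L^1 norm by an
  L^p integral plus an error \<open>d\<close> times the volume.\<close>

lemma le_add_powr:
  fixes d s p :: real
  assumes "1 < p" "0 < d" "0 \<le> s"
  shows "s \<le> d + d powr (1 - p) * s powr p"
proof (cases "s \<le> d")
  case False
  then have s: "s > 0" using assms by simp
  have "s = s powr (1 - p) * s powr p" using s by (simp flip: powr_add)
  also have "\<dots> \<le> d powr (1 - p) * s powr p"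
    using assms False by (intro mult_right_mono powr_mono2') auto
  finally show ?thesis using assms by simp
qed (simp add: add_increasing2)

lemma bounded_functional_add:
  assumes "bounded_functional V nrm T" "u \<in> V" "v \<in> V"
  shows "T (\<lambda>x. u x + v x) = T u + T v"
  using assms by (simp add: bounded_functional_def)

lemma bounded_functional_cmult:
  assumes "bounded_functional V nrm T" "u \<in> V"
  shows "T (\<lambda>x. c * u x) = c * T u"
  using assms by (simp add: bounded_functional_def)

text \<open>Averages need functions that are C1 on the whole space, which test functions are.
  Replacing \<open>w n\<close> by a test function whose gradient is ever closer preserves weak
  nullity, because the functionals are bounded by the gradient seminorm.\<close>

lemma weak_null_test_approx:
  fixes \<Omega> :: "'a::euclidean_space set"
  assumes \<Omega>: "open \<Omega>" and p: "1 < p" and w: "\<And>n. w n \<in> W01p \<Omega> p"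
    and weak: "\<And>T. bounded_functional (W01p \<Omega> p) (grad_norm \<Omega> p) T \<Longrightarrow> (\<lambda>n. T (w n)) \<longlonglongrightarrow> 0"
  obtains \<phi> G where "\<And>n::nat. \<phi> n \<in> test_functions \<Omega>" "G > 0"
    "\<And>n. Lp_int \<Omega> p (\<lambda>x. \<phi> n x - w n x) \<le> inverse (real (Suc n))"
    "\<And>n. Lp_energy p (test_grad (\<phi> n)) \<le> ennreal G"
    "\<And>T. bounded_functional (W01p \<Omega> p) (grad_norm \<Omega> p) T \<Longrightarrow> (\<lambda>n. T (\<phi> n)) \<longlonglongrightarrow> 0"
proof -
  have p0: "0 < p" using p by simp
  let ?D = "\<lambda>n x. weak_gradient \<Omega> (w n) x"
  obtain B where B: "B > 0" "\<And>n. Lp_int \<Omega> p (?D n) \<le> B"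
  proof (rule weakly_bounded_grad_norm[OF \<Omega> p w])
    show "Bseq (\<lambda>n. T (w n))" if "bounded_functional (W01p \<Omega> p) (grad_norm \<Omega> p) T" for T
      using weak[OF that] by (intro convergent_imp_Bseq) (auto simp: convergent_def)
  qed (rule that)
  have "\<exists>\<phi>\<in>test_functions \<Omega>. Lp_int \<Omega> p (\<lambda>x. \<phi> x - w n x) < inverse (real (Suc n)) \<and>
      Lp_int \<Omega> p (\<lambda>x. test_grad \<phi> x - ?D n x) < inverse (real (Suc n))" for n
  proof -
    obtain \<psi> where \<psi>: "W1p_grad \<Omega> p (w n) (?D n)" "\<And>k::nat. \<psi> k \<in> test_functions \<Omega>"
      "(\<lambda>k. Lp_int \<Omega> p (\<lambda>x. \<psi> k x - w n x)) \<longlonglongrightarrow> 0"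
      "(\<lambda>k. Lp_int \<Omega> p (\<lambda>x. test_grad (\<psi> k) x - ?D n x)) \<longlonglongrightarrow> 0"
      by (rule W01pE[OF \<Omega> p0 w]) (rule that)
    have i: "0 < inverse (real (Suc n))" by simp
    have "eventually (\<lambda>k. Lp_int \<Omega> p (\<lambda>x. \<psi> k x - w n x) < inverse (real (Suc n)) \<and>
        Lp_int \<Omega> p (\<lambda>x. test_grad (\<psi> k) x - ?D n x) < inverse (real (Suc n))) sequentially"
      using order_tendstoD(2)[OF \<psi>(3) i] order_tendstoD(2)[OF \<psi>(4) i] by eventually_elim simp
    then obtain k where "Lp_int \<Omega> p (\<lambda>x. \<psi> k x - w n x) < inverse (real (Suc n)) \<and>
        Lp_int \<Omega> p (\<lambda>x. test_grad (\<psi> k) x - ?D n x) < inverse (real (Suc n))"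
      by (auto simp: eventually_sequentially)
    then show ?thesis using \<psi>(2) by blast
  qed
  then obtain \<phi> where \<phi>: "\<And>n. \<phi> n \<in> test_functions \<Omega>"
    "\<And>n. Lp_int \<Omega> p (\<lambda>x. \<phi> n x - w n x) < inverse (real (Suc n))"
    "\<And>n. Lp_int \<Omega> p (\<lambda>x. test_grad (\<phi> n) x - ?D n x) < inverse (real (Suc n))"
    by metis
  have d: "W1p_grad \<Omega> p (\<lambda>x. \<phi> n x - w n x) (\<lambda>x. test_grad (\<phi> n) x - ?D n x)" for n
    using p by (intro W1p_grad_diff[OF \<Omega> _ W1p_grad_test[OF \<Omega> p0 \<phi>(1)] W01p_grad[OF \<Omega> w]]) simp
  define G where "G = 2 powr p * (B + 1)"
  show ?thesis
  proof (rule that[of \<phi> G])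
    show "\<phi> n \<in> test_functions \<Omega>" for n by (rule \<phi>(1))
    show "G > 0" using B by (simp add: G_def)
    show "Lp_int \<Omega> p (\<lambda>x. \<phi> n x - w n x) \<le> inverse (real (Suc n))" for n using \<phi>(2)[of n] by simp
    show "Lp_energy p (test_grad (\<phi> n)) \<le> ennreal G" for n
    proof -
      note f = test_function_C1[OF \<phi>(1)[of n]]
      note [measurable] = C1_compactD(5)[OF f]
      have "Lp_energy p (test_grad (\<phi> n)) = ennreal (LINT x|lborel. norm (test_grad (\<phi> n) x) powr p)"
        unfolding Lp_energy_def using C1_compact_integrable(4)[OF f p0] by (intro nn_integral_eq_integral) auto
      also have "(LINT x|lborel. norm (test_grad (\<phi> n) x) powr p) = Lp_int \<Omega> p (test_grad (\<phi> n))"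
        unfolding Lp_int_def using test_function_outside[OF \<phi>(1)] p by (intro lebesgue_on_lborel(1)[OF \<Omega>, symmetric]) auto
      also have "\<dots> \<le> 2 powr p * (Lp_int \<Omega> p (?D n) + Lp_int \<Omega> p (\<lambda>x. test_grad (\<phi> n) x - ?D n x))"
        using Lp_int_add_le[of "?D n" \<Omega> p "\<lambda>x. test_grad (\<phi> n) x - ?D n x"] d[of n] W01p_grad[OF \<Omega> w[of n]] p
        by (simp add: W1p_grad_def)
      also have "\<dots> \<le> G" unfolding G_def
      proof (intro mult_left_mono add_mono B(2))
        have "inverse (real (Suc n)) \<le> 1" by (simp add: field_simps)
        then show "Lp_int \<Omega> p (\<lambda>x. test_grad (\<phi> n) x - ?D n x) \<le> 1" using \<phi>(3)[of n] by linarith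
      qed simp
      finally show ?thesis by (simp add: ennreal_leI)
    qed
    fix T assume T: "bounded_functional (W01p \<Omega> p) (grad_norm \<Omega> p) T"
    obtain C where "\<forall>v\<in>W01p \<Omega> p. \<bar>T v\<bar> \<le> C * grad_norm \<Omega> p v"
      using T unfolding bounded_functional_def by blast
    then have C: "\<bar>T v\<bar> \<le> C * grad_norm \<Omega> p v" if "v \<in> W01p \<Omega> p" for v using that by blast
    have dV: "(\<lambda>x. \<phi> n x - w n x) \<in> W01p \<Omega> p" for n by (intro W01p_diff[OF \<Omega> p0] W01p_test[OF \<Omega> p0] \<phi> w)
    have "(\<lambda>n. T (\<lambda>x. \<phi> n x - w n x)) \<longlonglongrightarrow> 0"
    proof (rule tendsto_rabs_zero_cancel, rule tendsto_sandwich[OF _ _ tendsto_const])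
      show "\<forall>\<^sub>F n in sequentially. \<bar>T (\<lambda>x. \<phi> n x - w n x)\<bar> \<le> \<bar>C\<bar> * inverse (real (Suc n)) powr (1 / p)"
      proof (intro always_eventually allI)
        fix n
        have "grad_norm \<Omega> p (\<lambda>x. \<phi> n x - w n x) \<le> inverse (real (Suc n)) powr (1 / p)"
          unfolding grad_norm_eq[OF \<Omega> d p0[THEN less_imp_neq, symmetric]]
          using \<phi>(3)[of n] p by (intro powr_mono2) auto
        then have "\<bar>C\<bar> * grad_norm \<Omega> p (\<lambda>x. \<phi> n x - w n x) \<le> \<bar>C\<bar> * inverse (real (Suc n)) powr (1 / p)"
          by (intro mult_left_mono) auto
        moreover have "C * grad_norm \<Omega> p (\<lambda>x. \<phi> n x - w n x) \<le> \<bar>C\<bar> * grad_norm \<Omega> p (\<lambda>x. \<phi> n x - w n x)"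
          by (intro mult_right_mono) (auto simp: grad_norm_eq_Lp_int)
        ultimately show "\<bar>T (\<lambda>x. \<phi> n x - w n x)\<bar> \<le> \<bar>C\<bar> * inverse (real (Suc n)) powr (1 / p)"
          using C[OF dV[of n]] by linarith
      qed
      have "(\<lambda>n. \<bar>C\<bar> * inverse (real (Suc n)) powr (1 / p)) \<longlonglongrightarrow> \<bar>C\<bar> * 0 powr (1 / p)"
        using p by (intro tendsto_mult tendsto_const tendsto_powr2 LIMSEQ_inverse_real_of_nat) (auto intro: always_eventually)
      then show "(\<lambda>n. \<bar>C\<bar> * inverse (real (Suc n)) powr (1 / p)) \<longlonglongrightarrow> 0" by simp
    qed auto
    from tendsto_add[OF this weak[OF T]]
    have "(\<lambda>n. T (\<lambda>x. \<phi> n x - w n x) + T (w n)) \<longlonglongrightarrow> 0" by simp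
    moreover have "T (\<phi> n) = T (\<lambda>x. \<phi> n x - w n x) + T (w n)" for n
    proof -
      have "T (\<lambda>x. (\<phi> n x - w n x) + w n x) = T (\<lambda>x. \<phi> n x - w n x) + T (w n)"
        by (rule bounded_functional_add[OF T dV w])
      then show ?thesis by simp
    qed
    ultimately show "(\<lambda>n. T (\<phi> n)) \<longlonglongrightarrow> 0" by simp
  qed
qed

text \<open>Compactness by averaging: the distance from \<open>\<phi> n\<close> to its average is
  small with \<open>r\<close>, uniformly in \<open>n\<close>. For fixed \<open>r\<close> the
  averages tend to 0 pointwise by weak convergence and are bounded uniformly by
  \<open>C1_ball_avg_le\<close>, so dominated convergence applies on the ball.\<close>

lemma weak_null_L1_loc:
  fixes \<Omega> :: "'a::euclidean_space set"
  assumes \<Omega>: "open \<Omega>" and p: "1 < p" "p < real DIM('a)" and w: "\<And>n. w n \<in> W01p \<Omega> p"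
    and weak: "\<And>T. bounded_functional (W01p \<Omega> p) (grad_norm \<Omega> p) T \<Longrightarrow> (\<lambda>n. T (w n)) \<longlonglongrightarrow> 0"
  shows "(\<lambda>n. LINT x|lebesgue_on \<Omega>. indicator (cball 0 R) x * \<bar>w n x\<bar>) \<longlonglongrightarrow> 0"
proof -
  have p0: "0 < p" using p by simp
  let ?M = "lebesgue_on \<Omega>" and ?i = "indicator (cball 0 R) :: 'a \<Rightarrow> real"
  obtain \<phi> G where \<phi>: "\<And>n::nat. \<phi> n \<in> test_functions \<Omega>" "G > 0"
    "\<And>n. Lp_int \<Omega> p (\<lambda>x. \<phi> n x - w n x) \<le> inverse (real (Suc n))"
    "\<And>n. Lp_energy p (test_grad (\<phi> n)) \<le> ennreal G"
    "\<And>T. bounded_functional (W01p \<Omega> p) (grad_norm \<Omega> p) T \<Longrightarrow> (\<lambda>n. T (\<phi> n)) \<longlonglongrightarrow> 0"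
    by (rule weak_null_test_approx[of \<Omega> p w, OF \<Omega> p(1) w weak]) (assumption, rule that)
  note f = test_function_C1[OF \<phi>(1)]
  have fm [measurable]: "\<phi> n \<in> borel_measurable borel" for n by (rule C1_compactD(4)[OF f])
  have avg_lim: "(\<lambda>n. ball_avg (\<phi> n) r x) \<longlonglongrightarrow> 0" if r: "r > 0" for r x
  proof -
    have "(\<lambda>n. (LINT y|?M. indicator (cball x r) y * \<phi> n y) / (unit_vol TYPE('a) * r ^ DIM('a))) \<longlonglongrightarrow> 0 / (unit_vol TYPE('a) * r ^ DIM('a))"
      using unit_vol_pos[where 'a='a] r
      by (intro tendsto_divide tendsto_const \<phi>(5) ball_integral_bounded_functional[OF \<Omega> p]) auto
    moreover have "(LINT y|?M. indicator (cball x r) y * \<phi> n y) = (LINT y|lborel. indicator (cball x r) y * \<phi> n y)" for n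
      using test_function_outside[OF \<phi>(1)] by (intro lebesgue_on_lborel(1)[OF \<Omega>]) auto
    ultimately show ?thesis using r by (simp add: ball_avg_eq)
  qed
  define \<mu> where "\<mu> = measure lborel (cball 0 R :: 'a set)"
  have \<mu>: "\<mu> \<ge> 0" by (simp add: \<mu>_def)
  have finc: "emeasure lborel (cball 0 R :: 'a set) < \<infinity>" by (rule emeasure_bounded_finite) simp
  have ii: "integrable lborel ?i" using finc by (intro integrable_real_indicator) auto
  have iM: "integrable ?M ?i" "(LINT x|?M. ?i x) \<le> \<mu>"
  proof -
    have 1: "integrable lebesgue (\<lambda>x. indicator \<Omega> x *\<^sub>R ?i x)"
      using \<Omega> ii by (intro integrable_mult_indicator) (auto simp: integrable_completion)
    then show "integrable ?M ?i" using \<Omega> by (subst integrable_restrict_space) auto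
    have "(LINT x|?M. ?i x) = (LINT x|lebesgue. indicator \<Omega> x *\<^sub>R ?i x)"
      using \<Omega> by (subst integral_restrict_space) auto
    also have "\<dots> \<le> (LINT x|lebesgue. ?i x)"
      using 1 ii by (intro integral_mono) (auto simp: integrable_completion split: split_indicator)
    also have "\<dots> = (LINT x|lborel. ?i x)" by (rule integral_completion) simp
    also have "\<dots> = \<mu>" by (simp add: \<mu>_def)
    finally show "(LINT x|?M. ?i x) \<le> \<mu>" .
  qed
  \<comment> \<open>The measure is a parameter because the estimate is applied both on
    \<open>\<Omega>\<close>, to \<open>\<phi> n - w n\<close>, and on the whole space, where the
    averages live.\<close>
  have loc: "integrable M (\<lambda>x. ?i x * \<bar>h x\<bar>) \<and>
      (LINT x|M. ?i x * \<bar>h x\<bar>) \<le> \<delta> * \<mu> + \<delta> powr (1 - p) * (LINT x|M. \<bar>h x\<bar> powr p)"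
    if M: "integrable M ?i" "(LINT x|M. ?i x) \<le> \<mu>" and h: "h \<in> borel_measurable M" "integrable M (\<lambda>x. \<bar>h x\<bar> powr p)"
      and \<delta>: "\<delta> > 0" for M and h :: "'a \<Rightarrow> real" and \<delta>
  proof -
    note [measurable] = h(1) borel_measurable_integrable[OF M(1)]
    have int: "integrable M (\<lambda>x. \<delta> * ?i x + \<delta> powr (1 - p) * \<bar>h x\<bar> powr p)"
      using M h by (intro Bochner_Integration.integrable_add integrable_mult_right) auto
    have pw: "?i x * \<bar>h x\<bar> \<le> \<delta> * ?i x + \<delta> powr (1 - p) * \<bar>h x\<bar> powr p" for x
      using le_add_powr[OF p(1) \<delta>, of "\<bar>h x\<bar>"] \<delta> by (auto simp: indicator_def)
    have int2: "integrable M (\<lambda>x. ?i x * \<bar>h x\<bar>)"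
    proof (rule Bochner_Integration.integrable_bound[OF int])
      show "(\<lambda>x. ?i x * \<bar>h x\<bar>) \<in> borel_measurable M" by measurable
      show "AE x in M. norm (?i x * \<bar>h x\<bar>) \<le> norm (\<delta> * ?i x + \<delta> powr (1 - p) * \<bar>h x\<bar> powr p)"
        using pw \<delta> by (intro AE_I2) (auto simp: abs_mult)
    qed
    have "(LINT x|M. ?i x * \<bar>h x\<bar>) \<le> (LINT x|M. \<delta> * ?i x + \<delta> powr (1 - p) * \<bar>h x\<bar> powr p)"
      by (intro integral_mono int2 int pw)
    also have "\<dots> = \<delta> * (LINT x|M. ?i x) + \<delta> powr (1 - p) * (LINT x|M. \<bar>h x\<bar> powr p)"
      using M h by (subst Bochner_Integration.integral_add) auto
    also have "\<dots> \<le> \<delta> * \<mu> + \<delta> powr (1 - p) * (LINT x|M. \<bar>h x\<bar> powr p)"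
      using M \<delta> by (intro add_right_mono mult_left_mono) auto
    finally show ?thesis using int2 by blast
  qed
  have avg_L1: "(\<lambda>n. LINT x|lborel. ?i x * \<bar>ball_avg (\<phi> n) r x\<bar>) \<longlonglongrightarrow> 0"
    and avg_int: "integrable lborel (\<lambda>x. ?i x * \<bar>ball_avg (\<phi> n) r x\<bar>)" if r: "r > 0" for r n
  proof -
    define s where "s = real DIM('a) / p - 1"
    define K where "K = unit_vol TYPE('a) powr (- 1 / p) / (1 - 2 powr (- s)) * G powr (1 / p) * r powr (- s)"
    have K: "\<bar>ball_avg (\<phi> n) r x\<bar> \<le> K" for n x
      unfolding K_def using \<phi>(2) by (intro C1_ball_avg_le[OF f p r _ \<phi>(4) s_def]) simp
    have iK: "integrable lborel (\<lambda>x. K * ?i x)" by (intro integrable_mult_right ii)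
    have bd: "norm (?i x * \<bar>ball_avg (\<phi> n) r x\<bar>) \<le> K * ?i x" for n x
      using K[of n x] by (auto simp: indicator_def)
    show "integrable lborel (\<lambda>x. ?i x * \<bar>ball_avg (\<phi> n) r x\<bar>)"
    proof (rule Bochner_Integration.integrable_bound[OF iK])
      show "AE x in lborel. norm (?i x * \<bar>ball_avg (\<phi> n) r x\<bar>) \<le> norm (K * ?i x)"
        unfolding real_norm_def[of "K * _"] by (intro AE_I2 order_trans[OF bd abs_ge_self])
    qed measurable
    have "(\<lambda>n. LINT x|lborel. ?i x * \<bar>ball_avg (\<phi> n) r x\<bar>) \<longlonglongrightarrow> (LINT x|lborel. ?i x * \<bar>0\<bar>)"
    proof (rule integral_dominated_convergence[OF _ _ iK])
      show "AE x in lborel. (\<lambda>n. ?i x * \<bar>ball_avg (\<phi> n) r x\<bar>) \<longlonglongrightarrow> ?i x * \<bar>0\<bar>"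
        by (intro AE_I2 tendsto_mult tendsto_const tendsto_rabs avg_lim r)
      show "AE x in lborel. norm (?i x * \<bar>ball_avg (\<phi> n) r x\<bar>) \<le> K * ?i x" for n
        using bd by (intro AE_I2)
    qed measurable
    then show "(\<lambda>n. LINT x|lborel. ?i x * \<bar>ball_avg (\<phi> n) r x\<bar>) \<longlonglongrightarrow> 0" by simp
  qed
  have est: "(LINT x|?M. ?i x * \<bar>w n x\<bar>) \<le> 2 * (\<delta> * \<mu>) + \<delta> powr (1 - p) * inverse (real (Suc n))
      + \<delta> powr (1 - p) * (r powr p * G) + (LINT x|lborel. ?i x * \<bar>ball_avg (\<phi> n) r x\<bar>)"
    if r: "r > 0" and \<delta>: "\<delta> > 0" for r \<delta> n
  proof -
    have d: "(\<lambda>x. \<phi> n x - w n x) \<in> Lp_space \<Omega> p" and wL: "w n \<in> Lp_space \<Omega> p" and \<phi>L: "\<phi> n \<in> Lp_space \<Omega> p"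
      using W01p_grad[OF \<Omega> W01p_diff[OF \<Omega> p0 W01p_test[OF \<Omega> p0 \<phi>(1)] w]] W01p_grad[OF \<Omega> w] W1p_grad_test[OF \<Omega> p0 \<phi>(1)]
      by (auto simp: W1p_grad_def)
    have 1: "integrable ?M (\<lambda>x. ?i x * \<bar>\<phi> n x - w n x\<bar>)"
      "(LINT x|?M. ?i x * \<bar>\<phi> n x - w n x\<bar>) \<le> \<delta> * \<mu> + \<delta> powr (1 - p) * inverse (real (Suc n))"
    proof -
      have "integrable ?M (\<lambda>x. ?i x * \<bar>\<phi> n x - w n x\<bar>) \<and> (LINT x|?M. ?i x * \<bar>\<phi> n x - w n x\<bar>)
        \<le> \<delta> * \<mu> + \<delta> powr (1 - p) * (LINT x|?M. \<bar>\<phi> n x - w n x\<bar> powr p)"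
        using d by (intro loc[OF iM _ _ \<delta>]) (auto simp: Lp_space_def)
      moreover have "\<delta> powr (1 - p) * (LINT x|?M. \<bar>\<phi> n x - w n x\<bar> powr p) \<le> \<delta> powr (1 - p) * inverse (real (Suc n))"
        using \<phi>(3)[of n] by (intro mult_left_mono) (auto simp: Lp_int_def)
      ultimately show "integrable ?M (\<lambda>x. ?i x * \<bar>\<phi> n x - w n x\<bar>)"
        "(LINT x|?M. ?i x * \<bar>\<phi> n x - w n x\<bar>) \<le> \<delta> * \<mu> + \<delta> powr (1 - p) * inverse (real (Suc n))" by linarith+
    qed
    have 2: "integrable lborel (\<lambda>x. ?i x * \<bar>\<phi> n x - ball_avg (\<phi> n) r x\<bar>)"
      "(LINT x|lborel. ?i x * \<bar>\<phi> n x - ball_avg (\<phi> n) r x\<bar>) \<le> \<delta> * \<mu> + \<delta> powr (1 - p) * (r powr p * G)"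
    proof -
      have n: "(\<integral>\<^sup>+x. ennreal (\<bar>\<phi> n x - ball_avg (\<phi> n) r x\<bar> powr p) \<partial>lborel) \<le> ennreal (r powr p * G)"
        using order_trans[OF C1_ball_avg_approx[OF f p(1) r] mult_left_mono[OF \<phi>(4)]] \<phi>(2) by (simp add: ennreal_mult)
      have i: "integrable lborel (\<lambda>x. \<bar>\<phi> n x - ball_avg (\<phi> n) r x\<bar> powr p)"
        unfolding integrable_iff_bounded using order.strict_trans1[OF n ennreal_less_top] by simp
      have "ennreal (LINT x|lborel. \<bar>\<phi> n x - ball_avg (\<phi> n) r x\<bar> powr p) \<le> ennreal (r powr p * G)"
        using n i by (subst nn_integral_eq_integral[symmetric]) auto
      then have le: "(LINT x|lborel. \<bar>\<phi> n x - ball_avg (\<phi> n) r x\<bar> powr p) \<le> r powr p * G"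
        using \<phi>(2) by (subst (asm) ennreal_le_iff) auto
      have "integrable lborel (\<lambda>x. ?i x * \<bar>\<phi> n x - ball_avg (\<phi> n) r x\<bar>) \<and> (LINT x|lborel. ?i x * \<bar>\<phi> n x - ball_avg (\<phi> n) r x\<bar>)
        \<le> \<delta> * \<mu> + \<delta> powr (1 - p) * (LINT x|lborel. \<bar>\<phi> n x - ball_avg (\<phi> n) r x\<bar> powr p)"
        using i by (intro loc[OF ii _ _ _ \<delta>]) (auto simp: \<mu>_def)
      moreover have "\<delta> powr (1 - p) * (LINT x|lborel. \<bar>\<phi> n x - ball_avg (\<phi> n) r x\<bar> powr p) \<le> \<delta> powr (1 - p) * (r powr p * G)"
        using le by (intro mult_left_mono) auto
      ultimately show "integrable lborel (\<lambda>x. ?i x * \<bar>\<phi> n x - ball_avg (\<phi> n) r x\<bar>)"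
        "(LINT x|lborel. ?i x * \<bar>\<phi> n x - ball_avg (\<phi> n) r x\<bar>) \<le> \<delta> * \<mu> + \<delta> powr (1 - p) * (r powr p * G)" by linarith+
    qed
    have i\<phi>: "integrable ?M (\<lambda>x. ?i x * \<bar>\<phi> n x\<bar>)" and iw: "integrable ?M (\<lambda>x. ?i x * \<bar>w n x\<bar>)"
      using loc[OF iM, of "\<phi> n" 1] loc[OF iM, of "w n" 1] \<phi>L wL by (auto simp: Lp_space_def)
    have "(LINT x|?M. ?i x * \<bar>w n x\<bar>) \<le> (LINT x|?M. ?i x * \<bar>\<phi> n x - w n x\<bar> + ?i x * \<bar>\<phi> n x\<bar>)"
      using 1(1) i\<phi> iw by (intro integral_mono Bochner_Integration.integrable_add) (auto simp: indicator_def)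
    also have "\<dots> = (LINT x|?M. ?i x * \<bar>\<phi> n x - w n x\<bar>) + (LINT x|?M. ?i x * \<bar>\<phi> n x\<bar>)"
      using 1(1) i\<phi> by simp
    also have "(LINT x|?M. ?i x * \<bar>\<phi> n x\<bar>) = (LINT x|lborel. ?i x * \<bar>\<phi> n x\<bar>)"
      using test_function_outside[OF \<phi>(1)] by (intro lebesgue_on_lborel(1)[OF \<Omega>]) auto
    also have "\<dots> \<le> (LINT x|lborel. ?i x * \<bar>\<phi> n x - ball_avg (\<phi> n) r x\<bar> + ?i x * \<bar>ball_avg (\<phi> n) r x\<bar>)"
    proof (rule integral_mono)
      show "integrable lborel (\<lambda>x. ?i x * \<bar>\<phi> n x\<bar>)"
        using i\<phi> test_function_outside[OF \<phi>(1)] by (subst lebesgue_on_lborel(2)[OF \<Omega>, symmetric]) auto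
      show "integrable lborel (\<lambda>x. ?i x * \<bar>\<phi> n x - ball_avg (\<phi> n) r x\<bar> + ?i x * \<bar>ball_avg (\<phi> n) r x\<bar>)"
        by (intro Bochner_Integration.integrable_add 2(1) avg_int r)
      show "?i x * \<bar>\<phi> n x\<bar> \<le> ?i x * \<bar>\<phi> n x - ball_avg (\<phi> n) r x\<bar> + ?i x * \<bar>ball_avg (\<phi> n) r x\<bar>" for x
        by (auto simp: indicator_def)
    qed
    also have "\<dots> = (LINT x|lborel. ?i x * \<bar>\<phi> n x - ball_avg (\<phi> n) r x\<bar>) + (LINT x|lborel. ?i x * \<bar>ball_avg (\<phi> n) r x\<bar>)"
      by (intro Bochner_Integration.integral_add 2(1) avg_int r)
    finally show ?thesis using 1(2) 2(2) by linarith
  qed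
  show ?thesis
  proof (rule order_tendstoI)
    fix \<epsilon> :: real assume \<epsilon>: "0 < \<epsilon>"
    \<comment> \<open>Order of choices: \<open>\<delta>\<close> makes the volume term small, then
      \<open>r\<close>, depending on \<open>\<delta>\<close>, the averaging error, and finally
      \<open>n\<close> the rest. Adding 1 to \<open>\<mu>\<close> avoids division by 0.\<close>
    define z where "z = \<mu> + 1"
    have z: "z > 0" "\<mu> \<le> z" using \<mu> by (auto simp: z_def)
    define \<delta> where "\<delta> = \<epsilon> / (8 * z)"
    have \<delta>: "\<delta> > 0" using \<epsilon> z by (simp add: \<delta>_def)
    have "2 * (\<delta> * \<mu>) = \<epsilon> / 4 * (\<mu> / z)" using z by (simp add: \<delta>_def)
    also have "\<dots> \<le> \<epsilon> / 4 * 1" using z \<epsilon> by (intro mult_left_mono) auto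
    finally have t1: "2 * (\<delta> * \<mu>) \<le> \<epsilon> / 4" by simp
    define r where "r = (\<epsilon> / (4 * G * \<delta> powr (1 - p))) powr (1 / p)"
    have b: "\<epsilon> / (4 * G * \<delta> powr (1 - p)) > 0" using \<epsilon> \<delta> \<phi>(2) by simp
    have r: "r > 0" unfolding r_def using b by (simp only: powr_gt_zero)
    have "r powr p = \<epsilon> / (4 * G * \<delta> powr (1 - p))" using p abs_of_pos[OF b] unfolding r_def powr_powr by simp
    then have t2: "\<delta> powr (1 - p) * (r powr p * G) = \<epsilon> / 4" using \<delta> \<phi>(2) by simp
    have "(\<lambda>n. \<delta> powr (1 - p) * inverse (real (Suc n))) \<longlonglongrightarrow> \<delta> powr (1 - p) * 0"
      by (intro tendsto_mult tendsto_const LIMSEQ_inverse_real_of_nat)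
    then have "eventually (\<lambda>n. \<delta> powr (1 - p) * inverse (real (Suc n)) < \<epsilon> / 4) sequentially"
      using \<epsilon> by (intro order_tendstoD(2)[where y=0]) auto
    moreover have "eventually (\<lambda>n. (LINT x|lborel. ?i x * \<bar>ball_avg (\<phi> n) r x\<bar>) < \<epsilon> / 4) sequentially"
      using \<epsilon> by (intro order_tendstoD(2)[OF avg_L1[OF r]]) simp
    ultimately show "eventually (\<lambda>n. (LINT x|?M. ?i x * \<bar>w n x\<bar>) < \<epsilon>) sequentially"
    proof eventually_elim
      case (elim n)
      show ?case using est[OF r \<delta>, of n] t1 t2 elim by linarith
    qed
  next
    fix a :: real assume "a < 0"
    moreover have "0 \<le> (LINT x|?M. ?i x * \<bar>w n x\<bar>)" for n by (intro integral_nonneg_AE) auto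
    ultimately show "eventually (\<lambda>n. a < (LINT x|?M. ?i x * \<bar>w n x\<bar>)) sequentially"
      by (intro always_eventually allI) (meson order.strict_trans2)
  qed
qed

section \<open>Lower semicontinuity\<close>

text \<open>
  The Brezis--Lieb lemma with local convergence in \<open>L\<^sup>1\<close> in place of convergence almost everywhere:
  outside of a bounded set on which \<open>l\<close> is bounded, the \<open>L\<^sup>q\<close> mass of \<open>l\<close> is small.
\<close>

lemma brezis_lieb:
  fixes \<Omega> :: "'a::euclidean_space set" and w :: "nat \<Rightarrow> 'a \<Rightarrow> real"
  assumes \<Omega>: "open \<Omega>" and q: "2 \<le> q" and w: "\<And>n. w n \<in> Lp_space \<Omega> q" and l: "l \<in> Lp_space \<Omega> q"
    and B: "\<And>n. Lp_int \<Omega> q (w n) \<le> B"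
    and loc: "\<And>R. (\<lambda>n. LINT x|lebesgue_on \<Omega>. indicator (cball 0 R) x * \<bar>w n x\<bar>) \<longlonglongrightarrow> 0"
  shows "(\<lambda>n. Lp_int \<Omega> q (\<lambda>x. w n x + l x) - Lp_int \<Omega> q (w n) - Lp_int \<Omega> q l) \<longlonglongrightarrow> 0"
proof (rule LIMSEQ_I)
  let ?M = "lebesgue_on \<Omega>"
  have q1: "1 < q" using q by simp
  have wm [measurable]: "w n \<in> borel_measurable ?M" for n using w by (auto simp: Lp_space_def)
  have lm [measurable]: "l \<in> borel_measurable ?M" using l by (auto simp: Lp_space_def)
  have wi: "integrable ?M (\<lambda>x. \<bar>w n x\<bar> powr q)" for n using w by (auto simp: Lp_space_def)
  have li: "integrable ?M (\<lambda>x. \<bar>l x\<bar> powr q)" using l by (auto simp: Lp_space_def)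
  have si: "integrable ?M (\<lambda>x. \<bar>w n x + l x\<bar> powr q)" for n
    using Lp_space_add[OF w l, of n] q by (auto simp: Lp_space_def)
  have xm [measurable]: "(\<lambda>x::'a. x) \<in> borel_measurable ?M" by (intro measurable_restrict_space1 measurable_completion) simp
  fix \<epsilon> :: real assume \<epsilon>: "0 < \<epsilon>"
  have B0: "0 \<le> B" using B[of 0] Lp_int_nonneg[of \<Omega> q "w 0"] by linarith
  define e where "e = \<epsilon> / (4 * (B + 1))"
  have e: "e > 0" using \<epsilon> B0 by (simp add: e_def)
  have eB: "e * B \<le> \<epsilon> / 4"
  proof -
    have "e * B = \<epsilon> / 4 * (B / (B + 1))" using B0 by (simp add: e_def)
    also have "\<dots> \<le> \<epsilon> / 4 * 1" using B0 \<epsilon> by (intro mult_left_mono) auto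
    finally show ?thesis by simp
  qed
  obtain C1 where C1: "C1 \<ge> 0" "\<And>a b. \<bar>\<bar>a + b\<bar> powr q - \<bar>a\<bar> powr q - \<bar>b\<bar> powr q\<bar> \<le> e * \<bar>a\<bar> powr q + C1 * \<bar>b\<bar> powr q"
    by (rule brezis_lieb_eps[OF q1 e]) (rule that)
  \<comment> \<open>\<open>C1\<close> is fixed before \<open>m\<close>, since the mass of
    \<open>l\<close> outside \<open>E m\<close> must be small compared with it. \<open>C2\<close>
    depends on \<open>m\<close> and is beaten afterwards by letting \<open>n\<close> grow.\<close>
  define E where "E m = {x. norm x \<le> real m \<and> \<bar>l x\<bar> \<le> real m}" for m :: nat
  have Em [measurable]: "Measurable.pred ?M (\<lambda>x. x \<in> E m)" for m unfolding E_def by simp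
  have "(\<lambda>m. LINT x|?M. indicator (- E m) x * \<bar>l x\<bar> powr q) \<longlonglongrightarrow> (LINT x|?M. 0)"
  proof (rule integral_dominated_convergence[OF _ _ li])
    show "AE x in ?M. (\<lambda>m. indicator (- E m) x * \<bar>l x\<bar> powr q) \<longlonglongrightarrow> 0"
    proof (intro AE_I2)
      fix x
      obtain m0 :: nat where "max (norm x) \<bar>l x\<bar> \<le> real m0" using real_arch_simple by blast
      then have "x \<in> E m" if "m \<ge> m0" for m using that unfolding E_def by simp
      then have "eventually (\<lambda>m. indicator (- E m) x * \<bar>l x\<bar> powr q = 0) sequentially"
        by (auto simp: eventually_sequentially indicator_def)
      then show "(\<lambda>m. indicator (- E m) x * \<bar>l x\<bar> powr q) \<longlonglongrightarrow> 0" by (rule tendsto_eventually)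
    qed
    show "AE x in ?M. norm (indicator (- E m) x * \<bar>l x\<bar> powr q) \<le> \<bar>l x\<bar> powr q" for m
      by (intro AE_I2) (auto simp: indicator_def)
  qed measurable
  then have "(\<lambda>m. C1 * (LINT x|?M. indicator (- E m) x * \<bar>l x\<bar> powr q)) \<longlonglongrightarrow> C1 * 0"
    by (intro tendsto_mult tendsto_const) simp
  then have "eventually (\<lambda>m. C1 * (LINT x|?M. indicator (- E m) x * \<bar>l x\<bar> powr q) < \<epsilon> / 4) sequentially"
    using \<epsilon> by (intro order_tendstoD(2)[where y=0]) auto
  then obtain m where m: "C1 * (LINT x|?M. indicator (- E m) x * \<bar>l x\<bar> powr q) < \<epsilon> / 4"
    by (auto simp: eventually_sequentially)
  have m0: "0 \<le> real m" by simp
  obtain C2 where C2: "C2 \<ge> 0" "\<And>a b. \<bar>b\<bar> \<le> real m \<Longrightarrow> \<bar>\<bar>a + b\<bar> powr q - \<bar>a\<bar> powr q - \<bar>b\<bar> powr q\<bar> \<le> e * \<bar>a\<bar> powr q + C2 * \<bar>a\<bar>"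
    by (rule brezis_lieb_bounded[OF q e m0]) (rule that)
  let ?D = "\<lambda>n x. \<bar>w n x + l x\<bar> powr q - \<bar>w n x\<bar> powr q - \<bar>l x\<bar> powr q"
  \<comment> \<open>One majorant for both regions: \<open>C1\<close> acts off \<open>E m\<close>,
    \<open>C2\<close> on \<open>E m\<close>, which lies in the ball of radius
    \<open>m\<close>.\<close>
  let ?H = "\<lambda>n x. e * \<bar>w n x\<bar> powr q + C1 * (indicator (- E m) x * \<bar>l x\<bar> powr q) + C2 * (indicator (cball 0 (real m)) x * \<bar>w n x\<bar>)"
  have i1: "integrable ?M (\<lambda>x. indicator (- E m) x * \<bar>l x\<bar> powr q)"
  proof (rule Bochner_Integration.integrable_bound[OF li])
    show "AE x in ?M. norm (indicator (- E m) x * \<bar>l x\<bar> powr q) \<le> norm (\<bar>l x\<bar> powr q)"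
      by (intro AE_I2) (auto simp: indicator_def)
  qed measurable
  have i2: "integrable ?M (\<lambda>x. indicator (cball 0 (real m)) x * \<bar>w n x\<bar>)" for n
    using integrable_abs[OF Lp_space_set_integrable(1)[OF q1 \<Omega> w, of 0 "real m" n]] by (simp add: abs_mult)
  have pw: "\<bar>?D n x\<bar> \<le> ?H n x" for n x
  proof (cases "x \<in> E m")
    case True
    then have "\<bar>?D n x\<bar> \<le> e * \<bar>w n x\<bar> powr q + C2 * \<bar>w n x\<bar>" by (intro C2) (simp add: E_def)
    then show ?thesis using True by (simp add: E_def)
  next
    case False
    then have "?H n x \<ge> e * \<bar>w n x\<bar> powr q + C1 * \<bar>l x\<bar> powr q" using C2(1) by simp
    then show ?thesis by (rule order_trans[OF C1(2)])
  qed
  have bnd: "\<bar>Lp_int \<Omega> q (\<lambda>x. w n x + l x) - Lp_int \<Omega> q (w n) - Lp_int \<Omega> q l\<bar>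
    \<le> e * B + C1 * (LINT x|?M. indicator (- E m) x * \<bar>l x\<bar> powr q) + C2 * (LINT x|?M. indicator (cball 0 (real m)) x * \<bar>w n x\<bar>)" for n
  proof -
    have iD: "integrable ?M (?D n)" by (intro Bochner_Integration.integrable_diff si wi li)
    have iH: "integrable ?M (?H n)" by (intro Bochner_Integration.integrable_add integrable_mult_right wi i1 i2)
    have "Lp_int \<Omega> q (\<lambda>x. w n x + l x) - Lp_int \<Omega> q (w n) - Lp_int \<Omega> q l = (LINT x|?M. ?D n x)"
      using si[of n] wi[of n] li by (simp add: Lp_int_def)
    also have "\<bar>\<dots>\<bar> \<le> (LINT x|?M. \<bar>?D n x\<bar>)" by (rule integral_abs_bound)
    also have "\<dots> \<le> (LINT x|?M. ?H n x)" by (intro integral_mono integrable_abs iD iH pw)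
    also have "\<dots> = e * Lp_int \<Omega> q (w n) + C1 * (LINT x|?M. indicator (- E m) x * \<bar>l x\<bar> powr q) + C2 * (LINT x|?M. indicator (cball 0 (real m)) x * \<bar>w n x\<bar>)"
      using wi[of n] i1 i2[of n] by (simp add: Lp_int_def)
    also have "\<dots> \<le> e * B + C1 * (LINT x|?M. indicator (- E m) x * \<bar>l x\<bar> powr q) + C2 * (LINT x|?M. indicator (cball 0 (real m)) x * \<bar>w n x\<bar>)"
      using e B[of n] by (intro add_right_mono mult_left_mono) auto
    finally show ?thesis .
  qed
  have "(\<lambda>n. C2 * (LINT x|?M. indicator (cball 0 (real m)) x * \<bar>w n x\<bar>)) \<longlonglongrightarrow> C2 * 0"
    by (intro tendsto_mult tendsto_const loc)
  then have "eventually (\<lambda>n. C2 * (LINT x|?M. indicator (cball 0 (real m)) x * \<bar>w n x\<bar>) < \<epsilon> / 4) sequentially"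
    using \<epsilon> by (intro order_tendstoD(2)[where y=0]) auto
  then obtain n0 where n0: "\<And>n. n \<ge> n0 \<Longrightarrow> C2 * (LINT x|?M. indicator (cball 0 (real m)) x * \<bar>w n x\<bar>) < \<epsilon> / 4"
    by (auto simp: eventually_sequentially)
  show "\<exists>n0. \<forall>n\<ge>n0. norm (Lp_int \<Omega> q (\<lambda>x. w n x + l x) - Lp_int \<Omega> q (w n) - Lp_int \<Omega> q l - 0) < \<epsilon>"
  proof (intro exI allI impI)
    fix n assume "n0 \<le> n"
    then show "norm (Lp_int \<Omega> q (\<lambda>x. w n x + l x) - Lp_int \<Omega> q (w n) - Lp_int \<Omega> q l - 0) < \<epsilon>"
      using bnd[of n] n0[of n] m eB \<epsilon> by simp
  qed
qed

lemma Lp_int_lindqvist: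
  fixes a b :: "'a::euclidean_space \<Rightarrow> 'b::euclidean_space"
  assumes p: "2 \<le> p" and a: "a \<in> Lp_space \<Omega> p" and b: "b \<in> Lp_space \<Omega> p"
  shows "Lp_int \<Omega> p a + p * (LINT x|lebesgue_on \<Omega>. norm (a x) powr (p - 2) * (a x \<bullet> (b x - a x)))
    + Lp_int \<Omega> p (\<lambda>x. b x - a x) / (2 powr (p - 1) - 1) \<le> Lp_int \<Omega> p b"
proof -
  let ?M = "lebesgue_on \<Omega>"
  have d: "(\<lambda>x. b x - a x) \<in> Lp_space \<Omega> p"
    using Lp_space_add[OF b Lp_space_scaleR[OF a, of "-1"]] p by simp
  have i1: "integrable ?M (\<lambda>x. norm (a x) powr p)" "integrable ?M (\<lambda>x. norm (b x) powr p)"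
    "integrable ?M (\<lambda>x. norm (b x - a x) powr p)"
    using a b d by (auto simp: Lp_space_def)
  have i2: "integrable ?M (\<lambda>x. norm (a x) powr (p - 2) * (a x \<bullet> (b x - a x)))"
    using p by (intro Lp_pairing(1)[OF _ a d]) simp
  have "(LINT x|?M. norm (a x) powr p + p * (norm (a x) powr (p - 2) * (a x \<bullet> (b x - a x)))
      + norm (b x - a x) powr p / (2 powr (p - 1) - 1)) \<le> (LINT x|?M. norm (b x) powr p)"
    by (intro integral_mono Bochner_Integration.integrable_add integrable_mult_right integrable_divide i1 i2 lindqvist[OF p])
  then show ?thesis using i1 i2 by (simp add: Lp_int_def)
qed

section \<open>Monotonicity and local Lipschitz bounds for the primitive\<close>

lemma primitive_add:
  assumes "continuous_on {0..} M" "0 \<le> a" "a \<le> b"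
  shows "primitive M b = primitive M a + integral {a..b} M" "M integrable_on {a..b}"
proof -
  have "M integrable_on {0..b}" by (intro integrable_continuous_real continuous_on_subset[OF assms(1)]) auto
  then show "primitive M b = primitive M a + integral {a..b} M"
    using Henstock_Kurzweil_Integration.integral_combine[of 0 a b M] assms by (simp add: primitive_def)
  show "M integrable_on {a..b}"
    using assms by (intro integrable_continuous_real continuous_on_subset[OF assms(1)]) auto
qed

lemma primitive_mono:
  assumes "continuous_on {0..} M" "\<forall>t\<ge>0. 0 \<le> M t" "0 \<le> a" "a \<le> b"
  shows "primitive M a \<le> primitive M b"
proof -
  have "0 \<le> integral {a..b} M"
    using assms primitive_add(2)[OF assms(1,3,4)] by (intro Henstock_Kurzweil_Integration.integral_nonneg) auto
  then show ?thesis using primitive_add(1)[OF assms(1,3,4)] by linarith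
qed

text \<open>Moves the vanishing error of Lindqvist's inequality, which occurs inside the argument of
  the primitive and may have either sign, to the outside.\<close>

lemma primitive_ge_diff:
  assumes "continuous_on {0..} M" "\<forall>t\<ge>0. 0 \<le> M t" and C: "\<And>t. t \<in> {0..R} \<Longrightarrow> M t \<le> C" "0 \<le> C"
    and "0 \<le> x" "0 \<le> y" "y \<le> R" "y - d \<le> x" "0 \<le> d"
  shows "primitive M y - C * d \<le> primitive M x"
proof (cases "y \<le> x")
  case True
  have "primitive M y \<le> primitive M x" using primitive_mono[OF assms(1,2) \<open>0 \<le> y\<close> True] .
  moreover have "0 \<le> C * d" using C assms by simp
  ultimately show ?thesis by linarith
next
  case False
  have "integral {x..y} M \<le> integral {x..y} (\<lambda>_. C)"
    using False assms primitive_add(2)[OF assms(1) \<open>0 \<le> x\<close>, of y]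
    by (intro Henstock_Kurzweil_Integration.integral_le) auto
  also have "\<dots> = C * (y - x)" using False by simp
  also have "\<dots> \<le> C * d" using C assms by (intro mult_left_mono) auto
  finally show ?thesis using primitive_add(1)[OF assms(1) \<open>0 \<le> x\<close>, of y] False by linarith
qed

lemma bounded_functional_diff:
  assumes T: "bounded_functional (W01p \<Omega> p) nrm T" and \<Omega>: "open \<Omega>" and p: "0 < p"
    and u: "u \<in> W01p \<Omega> p" and v: "v \<in> W01p \<Omega> p"
  shows "T (\<lambda>x. u x - v x) = T u - T v"
proof -
  have "T (\<lambda>x. u x + (-1) * v x) = T u + T (\<lambda>x. (-1) * v x)"
    by (rule bounded_functional_add[OF T u W01p_cmult[OF \<Omega> p v]])
  also have "T (\<lambda>x. (-1) * v x) = (-1) * T v"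
    by (rule bounded_functional_cmult[OF T v])
  finally show ?thesis by simp
qed

theorem theorem1p1:
  fixes \<Omega> :: "(real ^ 'n) set"
    and N :: nat
    and p pstar cp :: real
    and M :: "real \<Rightarrow> real"
  assumes "N = CARD('n)"
    and "2 \<le> p" and "p < real N"
    and "pstar = p * real N / (real N - p)"
    and "open \<Omega>" and "connected \<Omega>" and "smooth_boundary \<Omega>"
    and "continuous_on {0..} M" and "\<forall>t\<ge>0. M t \<ge> 0"
    and "cp = (2 powr (p - 1) - 1) powr (pstar / p) * (p / pstar) *
               best_embedding_constant \<Omega> p pstar powr (- (pstar / p))"
    and "\<forall>t\<ge>0. \<forall>s\<ge>0. primitive M (t + s) \<ge> primitive M t + primitive M s"
    and "(INF t\<in>{0<..}. primitive M t / t powr (pstar / p)) \<ge> cp"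
  shows "seq_weakly_lsc (W01p \<Omega> p) (grad_norm \<Omega> p) (kirchhoff_energy M \<Omega> p pstar)"
  unfolding seq_weakly_lsc_def
proof (intro allI impI)
  fix u l assume wc: "weakly_converges (W01p \<Omega> p) (grad_norm \<Omega> p) u l"
  define q where "q = pstar"
  note \<Omega> = \<open>open \<Omega>\<close>
  have dim: "real N = real DIM(real ^ 'n)" using assms(1) by simp
  have p: "1 < p" "p < real DIM(real ^ 'n)" "0 < p" using assms(2,3) dim by auto
  have q_def': "q = p * real DIM(real ^ 'n) / (real DIM(real ^ 'n) - p)"
    using assms(4) unfolding q_def dim .
  have "p \<le> q" using p by (auto simp: q_def' field_simps)
  then have q: "2 \<le> q" "0 < q" "p \<le> q" using assms(2) by auto
  have u: "u n \<in> W01p \<Omega> p" and l: "l \<in> W01p \<Omega> p" for n using wc by (auto simp: weakly_converges_def)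
  define w where "w n x = u n x - l x" for n x
  have w: "w n \<in> W01p \<Omega> p" for n unfolding w_def[abs_def] by (intro W01p_diff[OF \<Omega> p(3)] u l)
  have weak: "(\<lambda>n. T (w n)) \<longlonglongrightarrow> 0" if T: "bounded_functional (W01p \<Omega> p) (grad_norm \<Omega> p) T" for T
  proof -
    have "(\<lambda>n. T (u n) - T l) \<longlonglongrightarrow> T l - T l"
      using wc T by (intro tendsto_diff tendsto_const) (auto simp: weakly_converges_def)
    then show ?thesis unfolding w_def[abs_def] bounded_functional_diff[OF T \<Omega> p(3) u l] by simp
  qed
  define a where "a = Lp_int \<Omega> p (weak_gradient \<Omega> l)"
  define b where "b n = Lp_int \<Omega> p (weak_gradient \<Omega> (w n))" for n
  define A where "A n = Lp_int \<Omega> p (weak_gradient \<Omega> (u n))" for n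
  have nonneg: "0 \<le> a" "0 \<le> b n" "0 \<le> A n" for n by (simp_all add: a_def b_def A_def)
  obtain B where B': "B > 0" "\<And>n. Lp_int \<Omega> p (weak_gradient \<Omega> (w n)) \<le> B"
  proof (rule weakly_bounded_grad_norm[OF \<Omega> p(1) w])
    show "Bseq (\<lambda>n. T (w n))" if "bounded_functional (W01p \<Omega> p) (grad_norm \<Omega> p) T" for T
      using weak[OF that] by (intro convergent_imp_Bseq) (auto simp: convergent_def)
  qed (rule that)
  note B = B'[folded b_def]
  define S where "S = best_embedding_constant \<Omega> p q powr (- (q / p))"
  have S0: "S \<ge> 0" by (simp add: S_def)
  have sob: "Lp_int \<Omega> q (w n) \<le> S * b n powr (q / p)" for n
    unfolding S_def b_def by (rule best_embedding_constant_bound[OF \<Omega> p(1,2) q_def' w])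
  have Lq: "v \<in> Lp_space \<Omega> q" if "v \<in> W01p \<Omega> p" for v
    using W01p_sobolev[OF p(1,2) q_def'] \<Omega> that by metis
  define X where "X n = Lp_int \<Omega> q (u n) - Lp_int \<Omega> q (w n) - Lp_int \<Omega> q l" for n
  have X: "X \<longlonglongrightarrow> 0"
  proof -
    have "(\<lambda>n. Lp_int \<Omega> q (\<lambda>x. w n x + l x) - Lp_int \<Omega> q (w n) - Lp_int \<Omega> q l) \<longlonglongrightarrow> 0"
    proof (rule brezis_lieb[OF \<Omega> q(1) Lq[OF w] Lq[OF l]])
      show "Lp_int \<Omega> q (w n) \<le> S * B powr (q / p)" for n
        using sob[of n] mult_left_mono[OF powr_mono2[OF _ nonneg(2) B(2), of "q / p" n] S0] p q by (meson divide_nonneg_pos less_imp_le order_trans)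
      show "(\<lambda>n. LINT x|lebesgue_on \<Omega>. indicator (cball 0 R) x * \<bar>w n x\<bar>) \<longlonglongrightarrow> 0" for R
        by (rule weak_null_L1_loc[of \<Omega> p w, OF \<Omega> p(1,2) w weak])
    qed
    then show ?thesis by (simp add: X_def[abs_def] w_def)
  qed
  define e where "e n = p * gradient_pairing \<Omega> p l (w n)" for n
  have e: "e \<longlonglongrightarrow> 0"
  proof -
    have "bounded_functional (W01p \<Omega> p) (grad_norm \<Omega> p) (gradient_pairing \<Omega> p l)"
      unfolding bounded_functional_def
      using gradient_pairing_linear[OF \<Omega> p(1) l] by blast
    from tendsto_mult[OF tendsto_const[of p] weak[OF this]] show ?thesis by (simp add: e_def[abs_def])
  qed
  define c where "c = 1 / (2 powr (p - 1) - 1)"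
  have two: "2 powr (p - 1) > 1" using p powr_less_mono[of 0 "p - 1" 2] by simp
  have c: "c > 0" using two by (simp add: c_def)
  have lind: "a + e n + c * b n \<le> A n" for n
  proof -
    have gl: "W1p_grad \<Omega> p l (weak_gradient \<Omega> l)" and gu: "W1p_grad \<Omega> p (u n) (weak_gradient \<Omega> (u n))"
      by (intro W01p_grad[OF \<Omega>] u l)+
    \<comment> \<open>Up to a null set this difference is the gradient of \<open>w n\<close>, so the
      linear term in Lindqvist's inequality is the fixed functional
      \<open>gradient_pairing \<Omega> p l\<close> evaluated at \<open>w n\<close>.\<close>
    have gw: "W1p_grad \<Omega> p (w n) (\<lambda>x. weak_gradient \<Omega> (u n) x - weak_gradient \<Omega> l x)"
      unfolding w_def[abs_def] using p by (intro W1p_grad_diff[OF \<Omega> _ gu gl]) simp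
    have "b n = Lp_int \<Omega> p (\<lambda>x. weak_gradient \<Omega> (u n) x - weak_gradient \<Omega> l x)"
      using grad_norm_powr[OF \<Omega> gw] p by (simp add: grad_norm_Lp_int b_def)
    then show ?thesis
      using Lp_int_lindqvist[OF assms(2), of "weak_gradient \<Omega> l" \<Omega> "weak_gradient \<Omega> (u n)"] gl gu
      by (simp add: W1p_grad_def a_def A_def e_def c_def gradient_pairing_eq[OF \<Omega> l gw])
  qed
  define P where "P = primitive M"
  have P0: "P 0 = 0" by (simp add: P_def primitive_def)
  have Pnn: "0 \<le> P t" if "0 \<le> t" for t using primitive_mono[OF assms(8,9) order_refl that] P0 by (simp add: P_def)
  have growth: "1 / q * Lp_int \<Omega> q (w n) \<le> 1 / p * P (c * b n)" for n
  \<comment> \<open>The infimum ranges over positive arguments only; for \<open>b n = 0\<close> the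
    embedding makes the left-hand side vanish.\<close>
  proof (cases "b n = 0")
    case True
    then have "Lp_int \<Omega> q (w n) \<le> 0" using sob[of n] by simp
    then have "Lp_int \<Omega> q (w n) = 0" using Lp_int_nonneg[of \<Omega> q "w n"] by linarith
    then show ?thesis using True P0 by simp
  next
    case False
    then have t: "c * b n > 0" using nonneg(2)[of n] c by simp
    have "cp \<le> (INF t\<in>{0<..}. primitive M t / t powr (pstar / p))" by (rule assms(12))
    also have "\<dots> \<le> P (c * b n) / (c * b n) powr (q / p)"
      unfolding P_def q_def
    proof (rule cINF_lower)
      \<comment> \<open>The infimum is taken in the reals, where it is a lower bound only for a set
        bounded below.\<close>
      show "bdd_below ((\<lambda>t. primitive M t / t powr (pstar / p)) ` {0<..})"
        using Pnn by (intro bdd_belowI2[of _ 0]) (auto simp: P_def)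
    qed (use t in simp)
    finally have "cp * (c * b n) powr (q / p) \<le> P (c * b n)"
      using t by (subst (asm) pos_le_divide_eq) auto
    \<comment> \<open>The factor of \<open>cp\<close> raised to \<open>q / p\<close> is the
      reciprocal of \<open>c\<close>; what is left is the embedding bound times
      \<open>p / q\<close>.\<close>
    moreover have "cp * (c * b n) powr (q / p) = p / q * (S * b n powr (q / p))"
    proof -
      have "(2 powr (p - 1) - 1) powr (q / p) * c powr (q / p) = 1"
        using two p by (simp add: c_def flip: powr_mult)
      then show ?thesis unfolding assms(10) q_def[symmetric] S_def[symmetric] powr_mult
        by (simp add: mult_ac)
    qed
    moreover have "p / q * Lp_int \<Omega> q (w n) \<le> p / q * (S * b n powr (q / p))"
      using p q by (intro mult_left_mono sob) auto
    ultimately have "p / q * Lp_int \<Omega> q (w n) \<le> P (c * b n)" by linarith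
    then show ?thesis using p q by (simp add: field_simps)
  qed
  \<comment> \<open>Bounds the arguments \<open>a + c * b n\<close> for all \<open>n\<close>. On
    \<open>{0..R}\<close> the continuous \<open>M\<close> has a bound \<open>K\<close>, so the error
    \<open>e n\<close> costs at most \<open>K * \<bar>e n\<bar>\<close>.\<close>
  define R where "R = a + c * B"
  have "bounded (M ` {0..R})"
    by (intro compact_imp_bounded compact_continuous_image continuous_on_subset[OF assms(8)]) auto
  then obtain K where K: "K > 0" "\<And>t. t \<in> {0..R} \<Longrightarrow> M t \<le> K"
    unfolding bounded_pos by force
  have energy: "kirchhoff_energy M \<Omega> p pstar v = 1 / p * P (Lp_int \<Omega> p (weak_gradient \<Omega> v)) - 1 / q * Lp_int \<Omega> q v" for v
    unfolding kirchhoff_energy_def q_def[symmetric] using p q by (simp add: grad_norm_Lp_int Lp_norm_powr P_def)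
  have main: "kirchhoff_energy M \<Omega> p pstar l - (1 / p * (K * \<bar>e n\<bar>) + 1 / q * X n) \<le> kirchhoff_energy M \<Omega> p pstar (u n)" for n
  proof -
    have "P (a + c * b n) - K * \<bar>e n\<bar> \<le> P (A n)" unfolding P_def
    proof (rule primitive_ge_diff[OF assms(8,9) K(2)])
      show "0 \<le> a + c * b n" using nonneg c by simp
      show "a + c * b n \<le> R" unfolding R_def using B(2)[of n] c by simp
      show "a + c * b n - \<bar>e n\<bar> \<le> A n" using lind[of n] by linarith
    qed (use K nonneg in auto)
    \<comment> \<open>Superadditivity separates the energy of the limit from the contribution of
      \<open>w n\<close>, which \<open>growth\<close> sets against the L^q mass lost in the
      limit.\<close>
    moreover have "P a + P (c * b n) \<le> P (a + c * b n)"
      using assms(11) nonneg c unfolding P_def by simp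
    ultimately have "1 / p * (P a + P (c * b n) - K * \<bar>e n\<bar>) \<le> 1 / p * P (A n)"
      using p by (intro mult_left_mono) auto
    then have "1 / p * P a + 1 / q * Lp_int \<Omega> q (w n) - 1 / p * (K * \<bar>e n\<bar>) \<le> 1 / p * P (A n)"
      using growth[of n] by (simp only: distrib_left right_diff_distrib)
    moreover have "1 / q * Lp_int \<Omega> q (u n) = 1 / q * X n + 1 / q * Lp_int \<Omega> q (w n) + 1 / q * Lp_int \<Omega> q l"
      by (simp add: X_def flip: distrib_left add_divide_distrib)
    ultimately show ?thesis unfolding energy a_def[symmetric] A_def[symmetric] by linarith
  qed
  have "(\<lambda>n. kirchhoff_energy M \<Omega> p pstar l - (1 / p * (K * \<bar>e n\<bar>) + 1 / q * X n))
    \<longlonglongrightarrow> kirchhoff_energy M \<Omega> p pstar l - (1 / p * (K * \<bar>0\<bar>) + 1 / q * 0)"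
    by (intro tendsto_diff tendsto_add tendsto_mult tendsto_const tendsto_rabs e X)
  then have "(\<lambda>n. ereal (kirchhoff_energy M \<Omega> p pstar l - (1 / p * (K * \<bar>e n\<bar>) + 1 / q * X n)))
    \<longlonglongrightarrow> ereal (kirchhoff_energy M \<Omega> p pstar l)" by simp
  then have "ereal (kirchhoff_energy M \<Omega> p pstar l)
    = liminf (\<lambda>n. ereal (kirchhoff_energy M \<Omega> p pstar l - (1 / p * (K * \<bar>e n\<bar>) + 1 / q * X n)))"
    by (intro lim_imp_Liminf[symmetric]) auto
  also have "\<dots> \<le> liminf (\<lambda>n. ereal (kirchhoff_energy M \<Omega> p pstar (u n)))"
    using main by (intro Liminf_mono always_eventually) auto
  finally show "ereal (kirchhoff_energy M \<Omega> p pstar l) \<le> liminf (\<lambda>n. ereal (kirchhoff_energy M \<Omega> p pstar (u n)))" .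
qed

end
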